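(* Let $n\geq 2$. Let $\Omega\subseteq\mathbb{R}^{n}$ be a periodic set such that $\partial\Omega$ is a $C^{\infty}$ manifold. Let $X,Y\in\mathbb{R}^{n}$ be independent random variables such that $X$ is uniformly distributed in $[-1/2,1/2]^{n}$ and $Y$ is a standard Gaussian random vector. Let $0<\epsilon<1/2$. Let $B\subseteq\mathbb{R}^{n}$ be a periodic half space. Then $$\mathbb{P}(X\in\Omega,\ X+\epsilon Y\in\Omega)\;\leq\;\mathbb{P}(X\in B,\ X+\epsilon Y\in B)-\int_{[-\frac12,\frac12]^{n}\cap\partial\Omega}\Big(1-\frac{\|N(x)\|_{1}}{\sqrt{n}}\Big)dx+o(\epsilon).$$ In particular, $$\mathbb{P}(X\in\Omega,\ X+\epsilon Y\in\Omega)\;\leq\;\mathbb{P}(X\in B,\ X+\epsilon Y\in B)+o(\epsilon).$$ Here the implied constants in $o(\epsilon)$ can depend on $\Omega$.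
   Context: A subset $\Omega\subseteq\mathbb{R}^{n}$ is called periodic if $\Omega+v=\Omega^{c}$ for every standard basis vector $v\in\mathbb{R}^{n}$, and $-\Omega=\Omega^{c}$ (up to changes to $\Omega$ of Lebesgue measure zero). A periodic half space is any set of the form $B=\{x=(x_1,\ldots,x_n)\in\mathbb{R}^{n}\colon \sin(\pi(\epsilon_{1}x_{1}+\cdots+\epsilon_{n}x_{n}))\geq 0\}$ with $\epsilon_{1},\ldots,\epsilon_{n}\in\{-1,1\}$. In integrals over (subsets of) $\partial\Omega$, $dx$ denotes Lebesgue (surface) measure restricted to the surface $\partial\Omega\subseteq\mathbb{R}^{n}$. A $C^{\infty}$ manifold is locally the graph of a $C^{\infty}$ function. For $x\in\partial\Omega$, $N(x)$ is the exterior normal vector at $x$ with $\|N(x)\|_{2}=1$. For $q\geq 1$, $\|x\|_{q}^{q}=|x_{1}|^{q}+\cdots+|x_{n}|^{q}$. The notation $o(\epsilon)$ refers to the limit $\epsilon\to0^{+}$.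
   Formalization: The boundary integral carries the factor ε/√(2π) (without it the bound fails whenever the integral is positive), is taken over [-1/2,1/2)^n so that faces are not counted twice, and the exterior normal N(x) is assumed to exist at every point of ∂Ω. *)

theory Defs
  imports "HOL-Probability.Probability" "HOL-Library.Landau_Symbols"
begin

section \<open>Periodic sets\<close>

text \<open>Each of the two identities is required up to a Lebesgue null set. The second one can never
  hold pointwise, since it fails at the origin.\<close>

definition ae_eq :: "(real^'n) set \<Rightarrow> (real^'n) set \<Rightarrow> bool" where
  "ae_eq A B \<longleftrightarrow> sym_diff A B \<in> null_sets lebesgue"

definition periodic :: "(real^'n) set \<Rightarrow> bool" where
  "periodic \<Omega> \<longleftrightarrow>
     (\<forall>i. ae_eq ((\<lambda>x. x + axis i 1) ` \<Omega>) (- \<Omega>)) \<and> ae_eq (uminus ` \<Omega>) (- \<Omega>)"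

definition periodic_half_space :: "(real^'n) set \<Rightarrow> bool" where
  "periodic_half_space B \<longleftrightarrow>
     (\<exists>s :: 'n \<Rightarrow> real. (\<forall>i. s i \<in> {-1, 1}) \<and>
        B = {x. sin (pi * (\<Sum>i\<in>UNIV. s i * x $ i)) \<ge> 0})"

section \<open>Smooth hypersurfaces\<close>

text \<open>\<open>k\<close> times continuously differentiable on an open set, by iterating directional
  derivatives of a Frechet differentiable function.\<close>

primrec Ck_on :: "nat \<Rightarrow> (real^'n) set \<Rightarrow> (real^'n \<Rightarrow> real) \<Rightarrow> bool" where
  "Ck_on 0 U f \<longleftrightarrow> continuous_on U f"
| "Ck_on (Suc k) U f \<longleftrightarrow> (\<forall>x\<in>U. f differentiable (at x)) \<and>
     (\<forall>v. Ck_on k U (\<lambda>x. frechet_derivative f (at x) v))"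

definition smooth_on :: "(real^'n) set \<Rightarrow> (real^'n \<Rightarrow> real) \<Rightarrow> bool" where
  "smooth_on U f \<longleftrightarrow> (\<forall>k. Ck_on k U f)"

text \<open>In the open set \<open>U\<close>, \<open>S\<close> is the graph of \<open>g\<close> over the coordinate hyperplane orthogonal to
  the \<open>i\<close>-th basis vector. A function of the remaining \<open>n - 1\<close> coordinates is represented as a
  function on the whole space that ignores the \<open>i\<close>-th coordinate.\<close>

definition graph_chart ::
  "(real^'n) set \<Rightarrow> 'n \<Rightarrow> (real^'n \<Rightarrow> real) \<Rightarrow> (real^'n) set \<Rightarrow> bool" where
  "graph_chart S i g U \<longleftrightarrow> open U \<and> smooth_on U g \<and>
     (\<forall>y z. (\<forall>j. j \<noteq> i \<longrightarrow> y $ j = z $ j) \<longrightarrow> g y = g z) \<and>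
     S \<inter> U = {y \<in> U. y $ i = g y}"

definition smooth_hypersurface :: "(real^'n) set \<Rightarrow> bool" where
  "smooth_hypersurface S \<longleftrightarrow> (\<forall>x\<in>S. \<exists>i g U. x \<in> U \<and> graph_chart S i g U)"

section \<open>Surface measure\<close>

definition graph_point :: "'n \<Rightarrow> (real^'n \<Rightarrow> real) \<Rightarrow> real^'n \<Rightarrow> real^'n" where
  "graph_point i g y = (\<chi> j. if j = i then g y else y $ j)"

definition grad_sq :: "(real^'n \<Rightarrow> real) \<Rightarrow> real^'n \<Rightarrow> real" where
  "grad_sq g x = (\<Sum>j\<in>UNIV. (frechet_derivative g (at x) (axis j 1))\<^sup>2)"

text \<open>The area \<open>\<integral> sqrt (1 + |\<nabla>g|\<^sup>2)\<close> of the part \<open>A\<close> of the graph of \<open>g\<close>. The integral over the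
  \<open>n - 1\<close> coordinates other than the \<open>i\<close>-th is written as an \<open>n\<close>-dimensional integral over the slab
  \<open>0 \<le> y $ i \<le> 1\<close> of thickness one, on which the integrand does not depend on \<open>y $ i\<close>. The
  derivative is taken at the point of the graph, where a chart is known to be smooth.\<close>

definition graph_area :: "'n \<Rightarrow> (real^'n \<Rightarrow> real) \<Rightarrow> (real^'n) set \<Rightarrow> ennreal" where
  "graph_area i g A =
     (\<integral>\<^sup>+ y \<in> {y. 0 \<le> y $ i \<and> y $ i \<le> 1 \<and> graph_point i g y \<in> A}.
        ennreal (sqrt (1 + grad_sq g (graph_point i g y))) \<partial>lborel)"

text \<open>The surface measure of a (Borel) smooth hypersurface, extended by zero to the Borel sets of
  the ambient space: it is the unique measure given by the area formula in every graph chart.\<close>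

definition is_surface_measure :: "(real^'n) set \<Rightarrow> (real^'n) measure \<Rightarrow> bool" where
  "is_surface_measure S \<sigma> \<longleftrightarrow> sets \<sigma> = sets borel \<and> emeasure \<sigma> (- S) = 0 \<and>
     (\<forall>i g U A. graph_chart S i g U \<longrightarrow> A \<in> sets borel \<longrightarrow> A \<subseteq> S \<inter> U \<longrightarrow>
        emeasure \<sigma> A = graph_area i g A)"

definition surface_measure :: "(real^'n) set \<Rightarrow> (real^'n) measure" where
  "surface_measure S = (THE \<sigma>. is_surface_measure S \<sigma>)"

section \<open>Exterior normal\<close>

text \<open>A unit vector that is orthogonal to the velocity of every curve in the boundary through \<open>x\<close>,
  with the complement on its positive side and \<open>\<Omega>\<close> on its negative side. In particular a boundary
  point with \<open>\<Omega>\<close> (or its complement) on both sides has no exterior normal.\<close>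

definition exterior_unit_normal :: "(real^'n) set \<Rightarrow> real^'n \<Rightarrow> real^'n \<Rightarrow> bool" where
  "exterior_unit_normal \<Omega> x v \<longleftrightarrow> norm v = 1 \<and>
     (\<forall>\<gamma> w. (\<forall>t::real. \<gamma> t \<in> frontier \<Omega>) \<longrightarrow> \<gamma> 0 = x \<longrightarrow>
        (\<gamma> has_vector_derivative w) (at 0) \<longrightarrow> v \<bullet> w = 0) \<and>
     (\<forall>\<^sub>F t in at_right 0. x + t *\<^sub>R v \<notin> \<Omega> \<and> x - t *\<^sub>R v \<in> \<Omega>)"

section \<open>The random variables\<close>

definition cube :: "(real^'n) set" where
  "cube = {x. \<forall>i. -1/2 \<le> x $ i \<and> x $ i \<le> 1/2}"

text \<open>The half-open cube is an exact fundamental domain for translations by integer vectors, so a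
  piece of hypersurface lying in a face of the cube is counted once rather than twice.\<close>

definition half_open_cube :: "(real^'n) set" where
  "half_open_cube = {x. \<forall>i. -1/2 \<le> x $ i \<and> x $ i < 1/2}"

definition uniform_on_cube :: "'m measure \<Rightarrow> ('m \<Rightarrow> real^'n) \<Rightarrow> bool" where
  "uniform_on_cube M X \<longleftrightarrow>
     distributed M lborel X (\<lambda>x. indicator cube x / emeasure lborel (cube :: (real^'n) set))"

definition standard_gaussian :: "'m measure \<Rightarrow> ('m \<Rightarrow> real^'n) \<Rightarrow> bool" where
  "standard_gaussian M Y \<longleftrightarrow>
     distributed M lborel Y (\<lambda>y. ennreal (\<Prod>i\<in>UNIV. std_normal_density (y $ i)))"

text \<open>The probability of \<open>X \<in> \<Omega>\<close> and \<open>X + \<epsilon> Y \<in> \<Omega>\<close>. The completion of the probability space makes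
  this the intended number also for sets that are Lebesgue but not Borel measurable, such as an open
  set with smooth boundary together with an arbitrary part of that boundary. For a periodic
  set with smooth boundary it is \<open>1/2 - \<epsilon> / sqrt (2 * pi) * P + o(\<epsilon>)\<close>, where \<open>P\<close> is the boundary
  area in a fundamental cube and \<open>1 / sqrt (2 * pi)\<close> is the mean of the positive part of a standard
  Gaussian. This is why boundary integrals enter estimates of it with the factor
  \<open>\<epsilon> / sqrt (2 * pi)\<close>.\<close>

definition stay_prob ::
  "'m measure \<Rightarrow> ('m \<Rightarrow> real^'n) \<Rightarrow> ('m \<Rightarrow> real^'n) \<Rightarrow> real \<Rightarrow> (real^'n) set \<Rightarrow> real" where
  "stay_prob M X Y \<epsilon> \<Omega> =
     measure (completion M) {\<omega> \<in> space M. X \<omega> \<in> \<Omega> \<and> X \<omega> + \<epsilon> *\<^sub>R Y \<omega> \<in> \<Omega>}"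

end

theory Submission
  imports Defs
begin

text \<open>Let \<open>O\<close> and \<open>E\<close> be the interiors of \<open>\<Omega>\<close> and of its complement and \<open>S = frontier \<Omega>\<close>. Every boundary
  point has points of \<open>O\<close> and of \<open>E\<close> arbitrarily close to it, one set on each side of the normal, so
  the almost-everywhere identities of periodicity hold exactly for these open sets: a translation by
  a basis vector and the reflection at the origin both exchange \<open>O\<close> and \<open>E\<close>, and \<open>S\<close> is invariant
  under the integer lattice. As \<open>(X, Y)\<close> and \<open>(-X, -Y)\<close> have the same law, staying in \<open>O\<close> is as
  likely as staying in \<open>E\<close>. Hence twice the probability of staying is \<open>1\<close> minus the probability \<open>C(\<epsilon>)\<close>
  that \<open>X\<close> and \<open>X + \<epsilon> Y\<close> lie on different sides (\<open>stay_prob_change_prob\<close>), and the claim compares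
  the numbers \<open>C(\<epsilon>)\<close> of \<open>\<Omega>\<close> and of a half space. The event of changing sides is periodic in \<open>X\<close> under
  all integer translations, so any fundamental domain of the lattice may replace the cube.

  For the half space with sign vector \<open>s\<close>, changing sides forces \<open>\<lfloor>s \<bullet> x\<rfloor>\<close> and \<open>\<lfloor>s \<bullet> (x + \<epsilon> y)\<rfloor>\<close> to
  differ. The difference of these floors is \<open>\<epsilon> s \<bullet> y\<close> up to a difference of fractional parts, which
  integrates to zero by periodicity. So \<open>C(\<epsilon>)\<close> is at most the mean of \<open>\<epsilon> \<bar>s \<bullet> Y\<bar>\<close>, which is \<open>\<epsilon> sqrt (2 / pi) sqrt n\<close>, without any
  error term (\<open>half_space_change_prob\<close>).

  For \<open>\<Omega>\<close> the bound needed is \<open>liminf C(\<epsilon>) / \<epsilon> \<ge> sqrt (2 / pi) \<sigma>(S \<inter> Q)\<close>, where \<open>\<sigma>\<close> is the surface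
  measure and \<open>Q\<close> the half-open cube (\<open>change_prob_liminf\<close>). Where \<open>S\<close> is a graph in direction
  \<open>e\<^sub>i\<close>, write a nearby point as \<open>p + \<epsilon> s e\<^sub>i\<close> with \<open>p\<close> on \<open>S\<close>. For fixed \<open>p\<close>, \<open>s\<close>, \<open>y\<close> and small \<open>\<epsilon>\<close>, the
  sides of \<open>p + \<epsilon> s e\<^sub>i\<close> and \<open>p + \<epsilon> (s e\<^sub>i + y)\<close> are decided by the signs of the inner products of
  \<open>s e\<^sub>i\<close> and \<open>s e\<^sub>i + y\<close> with the normal \<open>N p\<close>. They differ for \<open>s\<close> in an interval of length
  \<open>\<bar>N p \<bullet> y\<bar> / \<bar>N p $ i\<bar>\<close>. Since \<open>1 / \<bar>N p $ i\<bar>\<close> is the density of surface area over the base of the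
  graph and \<open>sqrt (2 / pi)\<close> is the mean of \<open>\<bar>N p \<bullet> Y\<bar>\<close>, Fatou's lemma gives the bound on every compact part of a
  chart, and inner regularity gives it on all of \<open>S \<inter> Q\<close>.

  Finally \<open>\<sigma>(S \<inter> Q)\<close> is the integral of \<open>1 - \<parallel>N\<parallel>\<^sub>1 / sqrt n\<close> plus that of \<open>\<parallel>N\<parallel>\<^sub>1 / sqrt n\<close>. The second one is
  at least \<open>sqrt n\<close>: a segment from \<open>x\<close> to \<open>x + e\<^sub>i\<close> with \<open>x\<close> off \<open>S\<close> joins \<open>O\<close> and \<open>E\<close>, so it meets \<open>S\<close>,
  and the projection of \<open>S \<inter> Q\<close> along \<open>e\<^sub>i\<close>, which therefore has full measure, is at most as large as
  the integral of \<open>\<bar>N $ i\<bar>\<close> (\<open>flux_ge_1\<close>).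

  All integrals over \<open>S\<close> presuppose that the surface measure exists, that is, that the area formula
  gives the same value in overlapping charts. This and the bound for projections both follow from one
  fact: a differentiable map enlarges volume at most by the integral of its Jacobian determinant
  (\<open>emeasure_image_le_det\<close>).\<close>

section \<open>Integration along one coordinate\<close>

definition set_coord :: "'n \<Rightarrow> real \<Rightarrow> real^'n \<Rightarrow> real^'n" where
  "set_coord i t y = (\<chi> j. if j = i then t else y $ j)"

lemma set_coord_nth [simp]: "set_coord i t y $ j = (if j = i then t else y $ j)"
  by (simp add: set_coord_def)

lemma set_coord_eq: "set_coord i t y = y + (t - y $ i) *\<^sub>R axis i 1"
  by (auto simp: vec_eq_iff axis_def)

lemma graph_point_set_coord: "graph_point i g y = set_coord i (g y) y"
  by (simp add: graph_point_def set_coord_def)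

lemma set_coord_idem [simp]: "set_coord i s (set_coord i t y) = set_coord i s y"
  by (simp add: vec_eq_iff)

lemma set_coord_self [simp]: "set_coord i (y $ i) y = y"
  by (simp add: vec_eq_iff)

lemma continuous_on_set_coord [continuous_intros]:
  fixes f :: "'a::topological_space \<Rightarrow> real" and h :: "'a \<Rightarrow> real^'n"
  assumes "continuous_on A f" "continuous_on A h"
  shows "continuous_on A (\<lambda>x. set_coord i (f x) (h x))"
  unfolding set_coord_eq using assms by (intro continuous_intros) 

lemma measurable_set_coord [measurable (raw)]:
  fixes f :: "'a \<Rightarrow> real" and h :: "'a \<Rightarrow> real^'n"
  assumes [measurable]: "f \<in> borel_measurable M" "h \<in> borel_measurable M"
  shows "(\<lambda>x. set_coord i (f x) (h x)) \<in> borel_measurable M"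
proof -
  have "(\<lambda>p. set_coord i (fst p) (snd p)) \<in> borel_measurable (borel :: (real \<times> (real^'n)) measure)"
    by (intro borel_measurable_continuous_onI continuous_intros)
  from measurable_compose[OF _ this, of "\<lambda>x. (f x, h x)" M] show ?thesis
    by (simp add: borel_prod[symmetric])
qed

definition slab :: "'n \<Rightarrow> (real^'n) set" where
  "slab i = {y. 0 \<le> y $ i \<and> y $ i \<le> 1}"

lemma slab_borel [measurable]: "slab i \<in> sets borel"
  unfolding slab_def by measurable

lemma nn_integral_lborel_translate:
  fixes f :: "'a::euclidean_space \<Rightarrow> ennreal"
  assumes [measurable]: "f \<in> borel_measurable borel"
  shows "(\<integral>\<^sup>+x. f (a + x) \<partial>lborel) = (\<integral>\<^sup>+x. f x \<partial>lborel)"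
proof -
  have "(\<integral>\<^sup>+x. f x \<partial>lborel) = (\<integral>\<^sup>+x. f x \<partial>distr lborel borel ((+) a))"
    by (simp add: lborel_distr_plus)
  also have "\<dots> = (\<integral>\<^sup>+x. f (a + x) \<partial>lborel)"
    by (subst nn_integral_distr) auto
  finally show ?thesis by simp
qed

text \<open>Tonelli's theorem for one coordinate against the others, without splitting off a space of lower
  dimension: the inner integral does not depend on the coordinate \<open>i\<close> of \<open>y\<close>, and the slab has
  thickness one. Only translation invariance is involved, since moving \<open>y\<close> by \<open>r\<close> in direction \<open>i\<close>
  keeps it in the slab for a set of parameters \<open>r\<close> of length one.\<close>

lemma nn_integral_slab:
  fixes f :: "real^'n \<Rightarrow> ennreal"
  assumes [measurable]: "f \<in> borel_measurable borel"
  shows "(\<integral>\<^sup>+y. f y \<partial>lborel) = (\<integral>\<^sup>+y\<in>slab i. (\<integral>\<^sup>+t. f (set_coord i t y) \<partial>lborel) \<partial>lborel)"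
proof -
  let ?e = "axis i 1 :: real^'n"
  have "(\<integral>\<^sup>+y\<in>slab i. (\<integral>\<^sup>+t. f (set_coord i t y) \<partial>lborel) \<partial>lborel)
      = (\<integral>\<^sup>+y. (\<integral>\<^sup>+r. f (y + r *\<^sub>R ?e) * indicator (slab i) y \<partial>lborel) \<partial>lborel)"
  proof (rule nn_integral_cong)
    fix y :: "real^'n"
    have "(\<integral>\<^sup>+t. f (set_coord i t y) \<partial>lborel) = (\<integral>\<^sup>+r. f (set_coord i (y $ i + r) y) \<partial>lborel)"
      by (rule nn_integral_lborel_translate[symmetric]) measurable
    also have "\<dots> = (\<integral>\<^sup>+r. f (y + r *\<^sub>R ?e) \<partial>lborel)"
      by (simp add: set_coord_eq)
    finally show "(\<integral>\<^sup>+t. f (set_coord i t y) \<partial>lborel) * indicator (slab i) y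
      = (\<integral>\<^sup>+r. f (y + r *\<^sub>R ?e) * indicator (slab i) y \<partial>lborel)"
      by (simp add: nn_integral_multc)
  qed
  also have "\<dots> = (\<integral>\<^sup>+r. (\<integral>\<^sup>+y. f (y + r *\<^sub>R ?e) * indicator (slab i) y \<partial>lborel) \<partial>lborel)"
    by (rule lborel_pair.Fubini') measurable
  also have "\<dots> = (\<integral>\<^sup>+r. (\<integral>\<^sup>+y. f y * indicator (slab i) (y - r *\<^sub>R ?e) \<partial>lborel) \<partial>lborel)"
  proof (rule nn_integral_cong)
    fix r :: real
    show "(\<integral>\<^sup>+y. f (y + r *\<^sub>R ?e) * indicator (slab i) y \<partial>lborel)
      = (\<integral>\<^sup>+y. f y * indicator (slab i) (y - r *\<^sub>R ?e) \<partial>lborel)"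
      using nn_integral_lborel_translate[of "\<lambda>y. f y * indicator (slab i) (y - r *\<^sub>R ?e)" "r *\<^sub>R ?e"]
      by (simp add: add.commute)
  qed
  also have "\<dots> = (\<integral>\<^sup>+y. (\<integral>\<^sup>+r. f y * indicator (slab i) (y - r *\<^sub>R ?e) \<partial>lborel) \<partial>lborel)"
    by (rule lborel_pair.Fubini') measurable
  also have "\<dots> = (\<integral>\<^sup>+y. f y \<partial>lborel)"
  proof (rule nn_integral_cong)
    fix y :: "real^'n"
    have "indicator (slab i) (y - r *\<^sub>R ?e) = (indicator {y $ i - 1..y $ i} r :: ennreal)" for r
      by (auto simp: slab_def indicator_def axis_def)
    then show "(\<integral>\<^sup>+r. f y * indicator (slab i) (y - r *\<^sub>R ?e) \<partial>lborel) = f y"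
      by (simp add: nn_integral_cmult)
  qed
  finally show ?thesis by simp
qed

section \<open>Volume of differentiable images\<close>

text \<open>The bound for the volume of an image by the Jacobian determinant refers to an order of the
  coordinates. A copy of the index type, ordered through an enumeration of its elements, provides one
  for every finite index type: passing to the copy only renames coordinates and preserves volume.\<close>

typedef 'n ranked = "UNIV :: 'n set" by simp

definition rank_of :: "'n::finite \<Rightarrow> nat" where
  "rank_of = to_nat_on UNIV"

lemma inj_rank_of: "rank_of x = rank_of y \<Longrightarrow> x = y"
  by (metis UNIV_I countable_finite finite rank_of_def to_nat_on_inj)

instantiation ranked :: (finite) "{finite, wellorder}"
begin

definition less_eq_ranked :: "'a ranked \<Rightarrow> 'a ranked \<Rightarrow> bool" where
  "x \<le> y \<longleftrightarrow> rank_of (Rep_ranked x) \<le> rank_of (Rep_ranked y)"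

definition less_ranked :: "'a ranked \<Rightarrow> 'a ranked \<Rightarrow> bool" where
  "x < y \<longleftrightarrow> rank_of (Rep_ranked x) < rank_of (Rep_ranked y)"

instance
proof
  have "(UNIV :: 'a ranked set) = range Abs_ranked"
    by (metis Rep_ranked_inverse surj_def)
  then show "finite (UNIV :: 'a ranked set)"
    by (metis finite finite_imageI)
next
  fix x y z :: "'a ranked"
  show "(x < y) = (x \<le> y \<and> \<not> y \<le> x)" "x \<le> x" "x \<le> y \<or> y \<le> x"
    by (auto simp: less_eq_ranked_def less_ranked_def)
  show "x \<le> y \<Longrightarrow> y \<le> z \<Longrightarrow> x \<le> z"
    by (auto simp: less_eq_ranked_def)
  show "x \<le> y \<Longrightarrow> y \<le> x \<Longrightarrow> x = y"
    by (metis Rep_ranked_inject antisym inj_rank_of less_eq_ranked_def)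
next
  fix P :: "'a ranked \<Rightarrow> bool" and a
  assume step: "\<And>x. (\<And>y. y < x \<Longrightarrow> P y) \<Longrightarrow> P x"
  show "P a"
    by (induction a rule: measure_induct_rule[where f = "\<lambda>x. rank_of (Rep_ranked x)"])
      (metis step less_ranked_def)
qed

end

definition to_ranked :: "real^'n \<Rightarrow> real^('n ranked)" where
  "to_ranked x = (\<chi> k. x $ Rep_ranked k)"

definition of_ranked :: "real^('n ranked) \<Rightarrow> real^'n" where
  "of_ranked y = (\<chi> k. y $ Abs_ranked k)"

lemma of_to_ranked [simp]: "of_ranked (to_ranked x) = x"
  by (simp add: of_ranked_def to_ranked_def Abs_ranked_inverse vec_eq_iff)

lemma to_of_ranked [simp]: "to_ranked (of_ranked x) = x"
  by (simp add: of_ranked_def to_ranked_def Rep_ranked_inverse vec_eq_iff)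

lemma bounded_linear_to_ranked: "bounded_linear (to_ranked :: real^'n \<Rightarrow> _)"
  unfolding linear_conv_bounded_linear[symmetric]
  by (rule linearI) (auto simp: to_ranked_def vec_eq_iff)

lemma bounded_linear_of_ranked: "bounded_linear (of_ranked :: _ \<Rightarrow> real^'n)"
  unfolding linear_conv_bounded_linear[symmetric]
  by (rule linearI) (auto simp: of_ranked_def vec_eq_iff)

lemma measurable_to_ranked [measurable]: "(to_ranked :: real^'n \<Rightarrow> _) \<in> borel_measurable borel"
  by (intro borel_measurable_continuous_onI linear_continuous_on bounded_linear_to_ranked)

lemma measurable_of_ranked [measurable]: "(of_ranked :: _ \<Rightarrow> real^'n) \<in> borel_measurable borel"
  by (intro borel_measurable_continuous_onI linear_continuous_on bounded_linear_of_ranked)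

lemma bij_Rep_ranked: "bij (Rep_ranked :: 'n ranked \<Rightarrow> 'n)"
  by (metis Abs_ranked_inverse Rep_ranked_inverse UNIV_I bijI')

lemma prod_Basis_cart:
  fixes h :: "real^'n \<Rightarrow> 'b::comm_monoid_mult"
  shows "(\<Prod>b\<in>Basis. h b) = (\<Prod>k\<in>UNIV. h (axis k 1))"
proof -
  have B: "Basis = range (\<lambda>k. axis k 1 :: real^'n)"
    by (auto simp: Basis_vec_def)
  have "inj (\<lambda>k. axis k 1 :: real^'n)"
    by (auto simp: inj_on_def axis_eq_axis)
  then show ?thesis by (simp add: B prod.reindex)
qed

lemma distr_to_ranked: "distr lborel borel to_ranked = (lborel :: (real^('n::finite ranked)) measure)"
proof (rule lborel_eqI[symmetric])
  fix l u :: "real^('n ranked)"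
  assume le: "\<And>b. b \<in> Basis \<Longrightarrow> l \<bullet> b \<le> u \<bullet> b"
  have pre: "to_ranked -` box l u = box (of_ranked l) (of_ranked u :: real^'n)"
    unfolding mem_box_cart set_eq_iff vimage_eq to_ranked_def of_ranked_def
    by simp (metis Abs_ranked_inverse Rep_ranked_inverse UNIV_I)
  have le': "of_ranked l \<bullet> b \<le> of_ranked u \<bullet> b" if "b \<in> Basis" for b :: "real^'n"
  proof -
    have "\<exists>k. b = axis k 1" using that by (auto simp: Basis_vec_def)
    then obtain k where "b = axis k 1" ..
    then show ?thesis using le[of "axis (Abs_ranked k) 1"]
      by (simp add: inner_axis of_ranked_def)
  qed
  have "emeasure (distr lborel borel to_ranked) (box l u) = emeasure lborel (box (of_ranked l) (of_ranked u :: real^'n))"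
    by (subst emeasure_distr) (auto simp: pre)
  also have "\<dots> = (\<Prod>b\<in>Basis. (of_ranked u - of_ranked l :: real^'n) \<bullet> b)"
    using le' by (subst emeasure_lborel_box) auto
  also have "(\<Prod>b\<in>Basis. (of_ranked u - of_ranked l :: real^'n) \<bullet> b) = (\<Prod>k\<in>UNIV. (u - l) $ Abs_ranked k)"
    by (subst prod_Basis_cart) (simp add: inner_axis of_ranked_def)
  also have "\<dots> = (\<Prod>k\<in>UNIV. (u - l) $ k)"
    by (subst prod.reindex_bij_betw[OF bij_Rep_ranked, symmetric]) (simp add: Rep_ranked_inverse)
  also have "\<dots> = (\<Prod>b\<in>Basis. (u - l) \<bullet> b)"
    by (simp add: prod_Basis_cart inner_axis)
  finally show "emeasure (distr lborel borel to_ranked) (box l u) = (\<Prod>b\<in>Basis. (u - l) \<bullet> b)" .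
qed simp

lemma emeasure_image_le_det_wellorder:
  fixes h :: "real^'m::{finite,wellorder} \<Rightarrow> real^'m::_"
  assumes D: "D \<in> sets borel"
    and der: "\<And>x. x \<in> D \<Longrightarrow> (h has_derivative h' x) (at x)"
    and Jm [measurable]: "(\<lambda>x. indicator D x * \<bar>det (matrix (h' x))\<bar>) \<in> borel_measurable borel"
  shows "emeasure lebesgue (h ` D) \<le> (\<integral>\<^sup>+x\<in>D. ennreal \<bar>det (matrix (h' x))\<bar> \<partial>lborel)" (is "_ \<le> ?I")
proof (cases "?I = \<infinity>")
  case False
  let ?J = "\<lambda>x. \<bar>det (matrix (h' x))\<bar>"
  obtain r where r: "?I = ennreal r" "r \<ge> 0"
    using False by (cases ?I) auto
  have "(\<integral>\<^sup>+x. ennreal (indicator D x * ?J x) \<partial>lborel) = ?I"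
    by (intro nn_integral_cong) (auto simp: indicator_def)
  with r have "(\<integral>\<^sup>+x. ennreal (indicator D x * ?J x) \<partial>lborel) = ennreal r" by simp
  from nn_integral_has_integral[OF Jm _ this r(2)]
  have "((\<lambda>x. indicator D x * ?J x) has_integral r) UNIV" by simp
  then have "((\<lambda>x. if x \<in> D then ?J x else 0) has_integral r) UNIV"
    by (rule has_integral_eq[rotated]) (auto simp: indicator_def)
  then have int: "(?J has_integral r) D"
    by (simp add: has_integral_restrict_UNIV)
  have D': "D \<in> sets lebesgue" using D by simp
  have der': "\<And>x. x \<in> D \<Longrightarrow> (h has_derivative h' x) (at x within D)"
    using der by (blast intro: has_derivative_at_withinI)
  have "h ` D \<in> lmeasurable" "measure lebesgue (h ` D) \<le> r"
    using measurable_differentiable_image[OF D' der' has_integral_integrable[OF int]]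
      measure_differentiable_image[OF D' der' has_integral_integrable[OF int]]
      integral_unique[OF int] by auto
  then show ?thesis
    unfolding r by (simp add: emeasure_eq_measure2 ennreal_leI)
qed simp

text \<open>An image under a differentiable map need not be a Borel set. Renaming coordinates preserves also the
  completed measure, because completion commutes with push-forward along a map that preserves null
  sets.\<close>

lemma emeasure_lebesgue_to_ranked:
  fixes A :: "(real^'n) set"
  assumes "to_ranked ` A \<in> sets lebesgue"
  shows "emeasure lebesgue (to_ranked ` A) = emeasure lebesgue A"
proof -
  have 1: "distr lebesgue lborel to_ranked = (lborel :: (real^('n ranked)) measure)"
    unfolding distr_to_ranked[symmetric]
    by (subst (2) distr_completion[symmetric]) (auto intro!: distr_cong simp: distr_to_ranked)
  have m: "to_ranked \<in> lebesgue \<rightarrow>\<^sub>M (lborel :: (real^('n ranked)) measure)"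
    by (simp add: measurable_completion)
  have 2: "lebesgue = distr lebesgue (lebesgue :: (real^('n ranked)) measure) to_ranked"
    using completion.completion_distr_eq[OF m] by (simp add: 1)
  have m2: "to_ranked \<in> lebesgue \<rightarrow>\<^sub>M (lebesgue :: (real^('n ranked)) measure)"
    by (rule completion.measurable_completion2[OF m]) (simp add: 1)
  have "emeasure lebesgue (to_ranked ` A) = emeasure (distr lebesgue lebesgue to_ranked) (to_ranked ` A)"
    by (rule arg_cong[OF 2, of "\<lambda>M. emeasure M (to_ranked ` A)"])
  also have "\<dots> = emeasure lebesgue (to_ranked -` to_ranked ` A)"
    using emeasure_distr[OF m2 assms] by simp
  also have "to_ranked -` to_ranked ` A = A"
    by (metis inj_vimage_image_eq injI of_to_ranked)
  finally show ?thesis .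
qed

text \<open>The matrix of a linear map with rows and columns indexed by the ordered copy. Its determinant is the
  determinant of the map.\<close>

definition ranked_matrix :: "(real^'n \<Rightarrow> real^'n) \<Rightarrow> real^('n ranked)^('n ranked)" where
  "ranked_matrix f = (\<chi> k l. f (axis (Rep_ranked l) 1) $ Rep_ranked k)"

lemma ranked_matrix_conv:
  fixes f :: "real^'n \<Rightarrow> real^'n"
  shows "ranked_matrix f = matrix (\<lambda>x. to_ranked (f (of_ranked x)))"
proof -
  have "of_ranked (axis l 1) = axis (Rep_ranked l) (1::real)" for l :: "'n ranked"
    by (auto simp: of_ranked_def axis_def vec_eq_iff Abs_ranked_inverse Rep_ranked_inverse)
  then show ?thesis
    by (simp add: ranked_matrix_def matrix_def to_ranked_def)
qed

text \<open>Points that are covered several times enlarge only the right-hand side.\<close>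

lemma emeasure_image_le_det:
  fixes h :: "real^'n \<Rightarrow> real^'n"
  assumes D [measurable]: "D \<in> sets borel"
    and der: "\<And>x. x \<in> D \<Longrightarrow> (h has_derivative h' x) (at x)"
    and J: "\<And>x. x \<in> D \<Longrightarrow> \<bar>det (ranked_matrix (h' x))\<bar> = J x"
    and Jm [measurable]: "(\<lambda>x. indicator D x * J x) \<in> borel_measurable borel"
  shows "h ` D \<in> sets lebesgue"
    and "emeasure lebesgue (h ` D) \<le> (\<integral>\<^sup>+x\<in>D. ennreal (J x) \<partial>lborel)"
proof -
  have diff: "h differentiable_on D"
    using der by (meson differentiable_at_withinI differentiable_def differentiable_on_def)
  show hD: "h ` D \<in> sets lebesgue"
    by (rule differentiable_image_in_sets_lebesgue[OF _ _ diff]) auto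
  define H where "H = (\<lambda>x. to_ranked (h (of_ranked x)))"
  define H' where "H' = (\<lambda>x y. to_ranked (h' (of_ranked x) (of_ranked y)))"
  define E where "E = of_ranked -` D"
  have im: "H ` E = to_ranked ` h ` D"
    unfolding H_def E_def by (auto simp: image_iff) (metis of_to_ranked vimageI)
  have E: "E \<in> sets borel"
    unfolding E_def using measurable_sets[OF measurable_of_ranked D] by simp
  have derH: "(H has_derivative H' x) (at x)" if "x \<in> E" for x
  proof -
    have 1: "(h has_derivative h' (of_ranked x)) (at (of_ranked x))"
      using that der by (simp add: E_def)
    have 2: "(h \<circ> of_ranked has_derivative h' (of_ranked x) \<circ> of_ranked) (at x)"
      by (rule diff_chain_at[OF bounded_linear_imp_has_derivative[OF bounded_linear_of_ranked] 1])
    show ?thesis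
      using bounded_linear.has_derivative[OF bounded_linear_to_ranked 2]
      by (simp add: H_def H'_def o_def)
  qed
  have det: "\<bar>det (matrix (H' x))\<bar> = J (of_ranked x)" if "x \<in> E" for x
    using J[of "of_ranked x"] that by (simp add: E_def H'_def ranked_matrix_conv)
  have ind: "indicator E x * \<bar>det (matrix (H' x))\<bar> = indicator D (of_ranked x) * J (of_ranked x)" for x
    using det[of x] by (auto simp: indicator_def E_def)
  have "H ` E \<in> sets lebesgue"
    using derH by (intro differentiable_image_in_sets_lebesgue)
      (use E in \<open>auto simp: differentiable_on_def differentiable_def intro: has_derivative_at_withinI\<close>)
  then have "emeasure lebesgue (h ` D) = emeasure lebesgue (H ` E)"
    unfolding im by (rule emeasure_lebesgue_to_ranked[symmetric])
  also have "\<dots> \<le> (\<integral>\<^sup>+x\<in>E. ennreal \<bar>det (matrix (H' x))\<bar> \<partial>lborel)"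
    by (rule emeasure_image_le_det_wellorder[OF E derH])
      (auto simp: ind intro!: measurable_compose[OF measurable_of_ranked Jm])
  also have "\<dots> = (\<integral>\<^sup>+x. ennreal (indicator D (of_ranked x) * J (of_ranked x)) \<partial>lborel)"
    by (intro nn_integral_cong) (simp add: ind[symmetric], auto simp: indicator_def)
  also have "\<dots> = (\<integral>\<^sup>+x. ennreal (indicator D x * J x) \<partial>lborel)"
    unfolding distr_to_ranked[symmetric]
    by (subst nn_integral_distr) (auto intro!: measurable_compose[OF measurable_of_ranked Jm])
  also have "\<dots> = (\<integral>\<^sup>+x\<in>D. ennreal (J x) \<partial>lborel)"
    by (intro nn_integral_cong) (auto simp: indicator_def)
  finally show "emeasure lebesgue (h ` D) \<le> (\<integral>\<^sup>+x\<in>D. ennreal (J x) \<partial>lborel)" .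
qed

text \<open>Cramer's rule for the identity matrix.\<close>

lemma det_unit_rows_except:
  fixes v :: "real^'m"
  shows "det (\<chi> k. if k = i then v else axis k 1) = v $ i"
proof -
  have "(\<chi> k. if k = i then v else axis k 1) =
    ((\<chi> k. if k = i then sum (\<lambda>l. v$l *s row l (mat 1)) UNIV else row k (mat 1)) :: real^'m^'m)"
    by (auto simp: vec_eq_iff row_def mat_def axis_def if_distrib sum.delta cong: if_cong)
  then show ?thesis
    using cramer_lemma_transpose[of i v "mat 1"] by simp
qed

text \<open>The derivative of a change of the direction of projection: it replaces coordinate \<open>j\<close> by a linear
  form \<open>v\<close> and then exchanges the coordinates \<open>i\<close> and \<open>j\<close>.\<close>

lemma det_ranked_matrix_swap_shear:
  fixes v :: "real^'n"
  assumes "i \<noteq> j"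
  shows "\<bar>det (ranked_matrix (\<lambda>x. \<chi> k. if k = i then x $ j else if k = j then v \<bullet> x else x $ k))\<bar> = \<bar>v $ i\<bar>"
proof -
  let ?a = "Abs_ranked :: 'n \<Rightarrow> 'n ranked"
  let ?B = "\<chi> k. if k = ?a i then to_ranked v else axis k 1"
  let ?p = "Transposition.transpose (?a i) (?a j)"
  have ab: "?a x = ?a y \<longleftrightarrow> x = y" for x y by (simp add: Abs_ranked_inject)
  have ab2: "Rep_ranked k = x \<longleftrightarrow> k = ?a x" for k x
    by (metis Abs_ranked_inverse Rep_ranked_inverse UNIV_I)
  have "ranked_matrix (\<lambda>x. \<chi> k. if k = i then x $ j else if k = j then v \<bullet> x else x $ k)
      = (\<chi> k. ?B $ ?p k)"
  proof (unfold vec_eq_iff, intro allI)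
    fix k l :: "'n ranked"
    obtain k' l' where k: "k = ?a k'" "l = ?a l'" by (meson Abs_ranked_cases)
    have axis: "(axis (?a x) 1 :: real^('n ranked)) $ ?a y = (if x = y then 1 else 0)"
      "(axis x 1 :: real^'n) $ y = (if x = y then 1 else 0)" for x y
      by (auto simp: axis_def ab)
    consider "k' = i" | "k' = j" | "k' \<noteq> i" "k' \<noteq> j" by blast
    then show "ranked_matrix (\<lambda>x. \<chi> k. if k = i then x $ j else if k = j then v \<bullet> x else x $ k) $ k $ l
        = (\<chi> k. ?B $ ?p k) $ k $ l"
      by cases (use assms in \<open>simp_all add: ranked_matrix_def k Abs_ranked_inverse ab axis
        to_ranked_def inner_axis transpose_apply_first transpose_apply_second transpose_apply_other\<close>)
  qed
  also have "det \<dots> = of_int (sign ?p) * det ?B"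
    by (rule det_permute_rows) (simp add: permutes_swap_id)
  also have "\<bar>\<dots>\<bar> = \<bar>v $ i\<bar>"
    by (simp add: det_unit_rows_except abs_mult sign_def to_ranked_def Abs_ranked_inverse)
  finally show ?thesis .
qed

text \<open>An orthogonal map and its inverse both have Jacobian determinant \<open>1\<close> in absolute value, so neither
  of them enlarges volume.\<close>

lemma distr_lborel_orthogonal:
  fixes f :: "real^'n \<Rightarrow> real^'n"
  assumes "orthogonal_transformation f"
  shows "distr lborel borel f = lborel"
proof -
  have le: "emeasure lborel (g ` D) \<le> emeasure lborel D" and gm: "g \<in> borel_measurable borel"
    if g: "orthogonal_transformation g" and D: "D \<in> sets borel" "g ` D \<in> sets borel" for g :: "real^'n \<Rightarrow> real^'n" and D
  proof -
    have lin: "linear g" using g by (simp add: orthogonal_transformation_linear)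
    then have bl: "bounded_linear g" by (simp add: linear_conv_bounded_linear)
    show "g \<in> borel_measurable borel"
      by (intro borel_measurable_continuous_onI linear_continuous_on bl)
    have "orthogonal_transformation (\<lambda>x. to_ranked (g (of_ranked x)))"
    proof -
      have "linear (\<lambda>x. to_ranked (g (of_ranked x)))"
        using bounded_linear_compose[OF bounded_linear_to_ranked bounded_linear_compose[OF bl bounded_linear_of_ranked]]
        by (simp add: linear_conv_bounded_linear o_def)
      moreover have n1: "norm (to_ranked x) = norm x" for x :: "real^'n"
        unfolding norm_vec_def L2_set_def to_ranked_def
        using sum.reindex_bij_betw[OF bij_Rep_ranked, of "\<lambda>k. (norm (x $ k))\<^sup>2"] by simp
      moreover have "norm (of_ranked x) = norm x" for x :: "real^('n ranked)"
        using n1[of "of_ranked x"] by simp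
      ultimately show ?thesis using g by (simp add: orthogonal_transformation)
    qed
    then have "orthogonal_matrix (ranked_matrix g)"
      by (simp add: ranked_matrix_conv orthogonal_transformation_matrix)
    then have det: "\<bar>det (ranked_matrix g)\<bar> = 1"
      using det_orthogonal_matrix by force
    have "emeasure lebesgue (g ` D) \<le> (\<integral>\<^sup>+x\<in>D. ennreal 1 \<partial>lborel)"
      by (rule emeasure_image_le_det(2)[where h' = "\<lambda>_. g"])
        (use D det in \<open>auto intro: bounded_linear_imp_has_derivative bl\<close>)
    then show "emeasure lborel (g ` D) \<le> emeasure lborel D"
      using D by simp
  qed
  define g where "g = inv f"
  have og: "orthogonal_transformation g"
    unfolding g_def by (rule orthogonal_transformation_inv[OF assms])
  have bij: "bij f" using assms by (rule orthogonal_transformation_bij)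
  have gf: "g (f x) = x" "f (g x) = x" for x
    using bij by (simp_all add: g_def bij_is_inj bij_is_surj surj_f_inv_f)
  have fm: "f \<in> borel_measurable borel" using gm[OF assms, of "{}"] by simp
  have gmm: "g \<in> borel_measurable borel" using gm[OF og, of "{}"] by simp
  show ?thesis
  proof (rule measure_eqI)
    fix A assume "A \<in> sets (distr lborel borel f)"
    then have A: "A \<in> sets borel" by simp
    have P: "f -` A \<in> sets borel" using measurable_sets[OF fm A] by simp
    have i1: "f ` (f -` A) = A" by (metis bij bij_is_surj surj_image_vimage_eq)
    have i2: "g ` A = f -` A" using gf by (auto simp: image_iff) (metis gf)
    have "emeasure lborel A \<le> emeasure lborel (f -` A)"
      by (rule le[OF assms P, unfolded i1, OF A])
    moreover have "emeasure lborel (f -` A) \<le> emeasure lborel A"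
      by (rule le[OF og A, unfolded i2, OF P])
    ultimately show "emeasure (distr lborel borel f) A = emeasure lborel A"
      using fm A by (simp add: emeasure_distr)
  qed simp
qed

section \<open>Charts and normals\<close>

definition grad :: "(real^'n \<Rightarrow> real) \<Rightarrow> real^'n \<Rightarrow> real^'n" where
  "grad g x = (\<chi> j. frechet_derivative g (at x) (axis j 1))"

lemma grad_sq_eq: "grad_sq g x = (norm (grad g x))\<^sup>2"
  unfolding power2_norm_eq_inner by (simp add: grad_sq_def grad_def inner_vec_def power2_eq_square)

lemma has_derivative_grad:
  fixes g :: "real^'n \<Rightarrow> real"
  assumes "(g has_derivative g') (at x)"
  shows "g' = (\<lambda>h. grad g x \<bullet> h)"
proof
  fix h
  have lin: "linear g'" using assms by (rule has_derivative_linear)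
  have "g' h = g' (\<Sum>j\<in>UNIV. h $ j *s axis j 1)"
    by (simp add: basis_expansion)
  also have "\<dots> = (\<Sum>j\<in>UNIV. h $ j * g' (axis j 1))"
    by (simp add: linear_sum[OF lin] scalar_mult_eq_scaleR linear_cmul[OF lin])
  also have "\<dots> = grad g x \<bullet> h"
    by (simp add: grad_def inner_vec_def frechet_derivative_at[OF assms, symmetric] mult.commute)
  finally show "g' h = grad g x \<bullet> h" .
qed

context
  fixes S :: "(real^'n) set" and i :: 'n and g :: "real^'n \<Rightarrow> real" and U :: "(real^'n) set"
  assumes chart: "graph_chart S i g U"
begin

lemma chart_open: "open U"
  using chart by (simp add: graph_chart_def)

lemma chart_C1:
  shows chart_has_derivative: "x \<in> U \<Longrightarrow> (g has_derivative (\<lambda>h. grad g x \<bullet> h)) (at x)"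
    and chart_continuous_on_grad: "continuous_on U (grad g)"
proof -
  have "Ck_on (Suc 0) U g" using chart by (simp only: graph_chart_def smooth_on_def)
  then have d: "\<forall>x\<in>U. g differentiable (at x)"
    and c: "\<forall>v. continuous_on U (\<lambda>x. frechet_derivative g (at x) v)" by auto
  show "x \<in> U \<Longrightarrow> (g has_derivative (\<lambda>h. grad g x \<bullet> h)) (at x)"
    using d has_derivative_grad by (metis frechet_derivative_works)
  show "continuous_on U (grad g)"
    unfolding grad_def using c by (intro continuous_on_vec_lambda) auto
qed

lemma chart_indep: "(\<And>j. j \<noteq> i \<Longrightarrow> y $ j = z $ j) \<Longrightarrow> g y = g z"
  using chart unfolding graph_chart_def by blast

lemma chart_set_coord [simp]: "g (set_coord i t y) = g y"
  by (rule chart_indep) simp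

lemma chart_mem_iff: "p \<in> U \<Longrightarrow> p \<in> S \<longleftrightarrow> p $ i = g p"
  using chart unfolding graph_chart_def by blast

lemma graph_point_fixed: "p \<in> S \<Longrightarrow> p \<in> U \<Longrightarrow> graph_point i g p = p"
  using chart_mem_iff by (auto simp: graph_point_set_coord vec_eq_iff)

lemma graph_point_in_hypersurface: "graph_point i g y \<in> U \<Longrightarrow> graph_point i g y \<in> S"
  by (subst chart_mem_iff) (auto simp: graph_point_set_coord)

text \<open>A chart is smooth on \<open>U\<close>, but the coordinate \<open>i\<close> of \<open>y\<close> is irrelevant to \<open>g\<close>. So \<open>g\<close> is differentiable
  at every base point \<open>y\<close> whose graph point lies in \<open>U\<close>, even if \<open>y\<close> itself does not.\<close>

lemma chart_has_derivative_off_graph: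
  assumes "graph_point i g y \<in> U"
  shows "(g has_derivative (\<lambda>h. grad g (graph_point i g y) \<bullet> h)) (at y)"
proof -
  let ?c = "(g y - y $ i) *\<^sub>R axis i 1"
  have "graph_point i g y = y + ?c"
    by (simp add: graph_point_set_coord set_coord_eq)
  with chart_has_derivative[OF assms]
  have 1: "(g has_derivative (\<lambda>h. grad g (graph_point i g y) \<bullet> h)) (at ((\<lambda>z. z + ?c) y))" by simp
  have 2: "((\<lambda>z. z + ?c) has_derivative (\<lambda>h. h)) (at y)"
    by (auto intro!: derivative_eq_intros)
  have "g \<circ> (\<lambda>z. z + ?c) = g"
    by (rule ext) (auto intro!: chart_indep simp: axis_def)
  then show ?thesis using diff_chain_at[OF 2 1] by (simp add: o_def)
qed

lemma graph_point_has_derivative: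
  assumes "graph_point i g y \<in> U"
  shows "(graph_point i g has_derivative (\<lambda>h. set_coord i (grad g (graph_point i g y) \<bullet> h) h)) (at y)"
proof -
  have e: "graph_point i g = (\<lambda>z. z + (g z - z $ i) *\<^sub>R axis i 1)"
    by (simp add: fun_eq_iff graph_point_set_coord set_coord_eq)
  show ?thesis
    unfolding e set_coord_eq
    using chart_has_derivative_off_graph[OF assms]
    by (auto intro!: derivative_eq_intros bounded_linear.has_derivative[OF bounded_linear_vec_nth] simp: e)
qed

lemma chart_grad_nth [simp]:
  assumes "x \<in> U"
  shows "grad g x $ i = 0"
proof -
  have 1: "((\<lambda>t. x + t *\<^sub>R axis i 1) has_derivative (\<lambda>t. t *\<^sub>R axis i 1)) (at (0::real))"
    by (auto intro!: derivative_eq_intros)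
  have 2: "(g has_derivative (\<lambda>h. grad g x \<bullet> h)) (at (x + (0::real) *\<^sub>R axis i 1))"
    using chart_has_derivative[OF assms] by simp
  have "g \<circ> (\<lambda>t. x + t *\<^sub>R axis i 1) = (\<lambda>t::real. g x)"
    by (rule ext) (auto intro!: chart_indep simp: axis_def)
  with diff_chain_at[OF 1 2]
  have "((\<lambda>t::real. g x) has_derivative (\<lambda>t. grad g x \<bullet> (t *\<^sub>R axis i 1))) (at 0)"
    by (simp add: o_def)
  moreover have "((\<lambda>t::real. g x) has_derivative (\<lambda>t. 0)) (at 0)" by simp
  ultimately have "(\<lambda>t::real. grad g x \<bullet> (t *\<^sub>R axis i 1)) = (\<lambda>t. 0)"
    by (rule has_derivative_unique)
  from fun_cong[OF this, of 1] show ?thesis by (simp add: inner_axis)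
qed

lemma isCont_graph_point:
  assumes "graph_point i g y \<in> U"
  shows "isCont (graph_point i g) y"
  using graph_point_has_derivative[OF assms] by (rule has_derivative_continuous)

lemma open_chart_base: "open {y. graph_point i g y \<in> U}"
proof (subst open_subopen, safe)
  fix y assume y: "graph_point i g y \<in> U"
  have "eventually (\<lambda>z. graph_point i g z \<in> U) (nhds y)"
    using topological_tendstoD[OF isCont_graph_point[OF y, unfolded isCont_def tendsto_at_iff_tendsto_nhds] chart_open y] .
  then show "\<exists>T. open T \<and> y \<in> T \<and> T \<subseteq> {y. graph_point i g y \<in> U}"
    unfolding eventually_nhds by blast
qed

lemma continuous_on_graph_point: "continuous_on {y. graph_point i g y \<in> U} (graph_point i g)"
  using isCont_graph_point by (auto intro: continuous_at_imp_continuous_on)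

end

text \<open>What being an exterior normal says about the hypersurface alone, without reference to sides. It
  determines the normal up to its sign, and the areas computed in different charts are compared
  through quantities that are insensitive to this sign.\<close>

definition unit_normal_field :: "(real^'n) set \<Rightarrow> (real^'n \<Rightarrow> real^'n) \<Rightarrow> bool" where
  "unit_normal_field S N \<longleftrightarrow> (\<forall>p\<in>S. norm (N p) = 1 \<and>
     (\<forall>\<gamma> w. (\<forall>t::real. \<gamma> t \<in> S) \<longrightarrow> \<gamma> 0 = p \<longrightarrow> (\<gamma> has_vector_derivative w) (at 0) \<longrightarrow> N p \<bullet> w = 0))"

text \<open>The tangent vectors of a graph are \<open>w + (grad g p \<bullet> w) e\<^sub>i\<close> for \<open>w\<close> orthogonal to \<open>e\<^sub>i\<close>, and the vectors
  orthogonal to all of them are the multiples of \<open>e\<^sub>i - grad g p\<close>. The second identity is the norm of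
  the first; it says that \<open>1 / \<bar>N p $ i\<bar>\<close> is the area density, whatever chart in direction \<open>i\<close> is used.\<close>

lemma chart_normal:
  fixes S :: "(real^'n) set"
  assumes chart: "graph_chart S i g U" and N: "unit_normal_field S N" and p: "p \<in> S" "p \<in> U"
  shows chart_normal_eq: "N p = (N p $ i) *\<^sub>R (axis i 1 - grad g p)"
    and chart_normal_scale: "\<bar>N p $ i\<bar> * sqrt (1 + grad_sq g p) = 1"
proof -
  have gp: "graph_point i g p = p" using graph_point_fixed[OF chart p] .
  have tangent: "N p \<bullet> set_coord i (grad g p \<bullet> w) w = 0" for w
  proof -
    from open_chart_base[OF chart] obtain e where e: "e > 0" "ball p e \<subseteq> {y. graph_point i g y \<in> U}"
      using p gp by (metis mem_Collect_eq openE)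
    define c where "c = e / (2 * (norm w + 1))"
    have pos: "norm w + 1 > 0" by (simp add: add_nonneg_pos)
    then have c0: "c > 0" using e by (simp add: c_def)
    have "c * (2 * (norm w + 1)) = e" using pos by (simp add: c_def)
    then have "2 * (c * norm w) + 2 * c = e" by (simp add: algebra_simps)
    moreover have "0 \<le> c * norm w" using c0 by simp
    ultimately have "c * norm w < e" using c0 by linarith
    note c = c0 this
    \<comment> \<open>a velocity is tested with a curve that stays in the chart for all times, so the
      straight line through \<open>p\<close> is traversed back and forth by a sine with derivative \<open>1\<close> at \<open>0\<close>\<close>
    define \<beta> where "\<beta> t = p + (c * sin (t / c)) *\<^sub>R w" for t
    define \<gamma> where "\<gamma> t = graph_point i g (\<beta> t)" for t
    have ball: "\<beta> t \<in> ball p e" for t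
    proof -
      have "dist p (\<beta> t) = c * \<bar>sin (t / c)\<bar> * norm w"
        using c by (simp add: \<beta>_def dist_norm abs_mult)
      also have "\<dots> \<le> c * 1 * norm w"
        using c by (intro mult_right_mono mult_left_mono) auto
      finally show ?thesis using c by simp
    qed
    have "\<gamma> t \<in> S" for t
      unfolding \<gamma>_def
      by (rule graph_point_in_hypersurface[OF chart]) (use ball[of t] e(2) in blast)
    moreover have "\<gamma> 0 = p" by (simp add: \<gamma>_def \<beta>_def gp)
    moreover have "(\<gamma> has_vector_derivative set_coord i (grad g p \<bullet> w) w) (at 0)"
    proof -
      have s: "((\<lambda>t. c * sin (t / c)) has_real_derivative 1) (at 0)"
        using c by (auto intro!: derivative_eq_intros)
      have "(\<beta> has_vector_derivative w) (at 0)"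
        unfolding \<beta>_def has_vector_derivative_def
        using s[unfolded has_field_derivative_def] c0
        by (auto intro!: derivative_eq_intros simp: fun_eq_iff)
      then have 1: "(\<beta> has_derivative (\<lambda>t. t *\<^sub>R w)) (at 0)"
        by (simp add: has_vector_derivative_def)
      have 2: "(graph_point i g has_derivative (\<lambda>h. set_coord i (grad g p \<bullet> h) h)) (at (\<beta> 0))"
        using graph_point_has_derivative[OF chart, of p] p by (simp add: \<beta>_def gp)
      have "(\<lambda>t. set_coord i (grad g p \<bullet> (t *\<^sub>R w)) (t *\<^sub>R w)) = (\<lambda>t. t *\<^sub>R set_coord i (grad g p \<bullet> w) w)"
        by (auto simp: fun_eq_iff vec_eq_iff)
      then show ?thesis
        using diff_chain_at[OF 1 2] by (simp add: has_vector_derivative_def \<gamma>_def[abs_def] o_def)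
    qed
    ultimately show ?thesis
      using N p(1) unfolding unit_normal_field_def by blast
  qed
  have "N p $ j = - (N p $ i) * (grad g p $ j)" if "j \<noteq> i" for j
  proof -
    have "set_coord i (grad g p \<bullet> axis j 1) (axis j 1) = axis j 1 + (grad g p $ j) *\<^sub>R axis i 1"
      using that by (simp add: inner_axis) (auto simp: vec_eq_iff axis_def)
    with tangent[of "axis j 1"] have "N p $ j + grad g p $ j * N p $ i = 0"
      by (simp add: inner_add_right inner_axis)
    then show ?thesis by (simp add: mult.commute eq_neg_iff_add_eq_0)
  qed
  then show eq: "N p = (N p $ i) *\<^sub>R (axis i 1 - grad g p)"
    using chart_grad_nth[OF chart p(2)] by (auto simp: vec_eq_iff axis_def)
  have "norm (axis i 1 - grad g p) = sqrt (1 + grad_sq g p)"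
    using chart_grad_nth[OF chart p(2)]
    by (simp add: norm_eq_sqrt_inner grad_sq_eq power2_norm_eq_inner inner_diff_left inner_diff_right inner_axis inner_commute[of "axis i 1"])
  then have "\<bar>N p $ i\<bar> * sqrt (1 + grad_sq g p) = norm (N p)"
    using arg_cong[OF eq, of norm] by simp
  then show "\<bar>N p $ i\<bar> * sqrt (1 + grad_sq g p) = 1"
    using N p(1) unfolding unit_normal_field_def by auto
qed

lemma unit_normal_field_frontier:
  assumes "\<forall>x\<in>frontier \<Omega>. exterior_unit_normal \<Omega> x (N x)"
  shows "unit_normal_field (frontier \<Omega>) N"
  using assms unfolding unit_normal_field_def exterior_unit_normal_def by blast

lemma connected_avoiding_frontier:
  assumes "connected T" "T \<inter> frontier \<Omega> = {}"
  shows "T \<subseteq> interior \<Omega> \<or> T \<subseteq> interior (- \<Omega>)"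
proof -
  have "T \<subseteq> \<Omega> \<or> T \<inter> \<Omega> = {}"
    using connected_Int_frontier[OF assms(1), of \<Omega>] assms(2) by blast
  moreover have "closure \<Omega> \<inter> T \<subseteq> interior \<Omega>"
    using assms(2) unfolding frontier_def by blast
  ultimately show ?thesis
    unfolding interior_complement using closure_subset[of \<Omega>] interior_subset[of \<Omega>] by blast
qed

text \<open>The exterior normal speaks only about points \<open>p \<plusminus> t N p\<close> on the normal line. Flattening the graph
  shows that near \<open>p\<close> the points above it form part of a connected set that avoids the boundary, and
  so do the points below. One point on either side therefore decides on which side \<open>\<Omega>\<close> lies, and a
  point \<open>p + t a\<close> is above or below the graph for small \<open>t\<close> according to the sign of the first
  derivative of its height over the graph.\<close>

lemma exterior_normal_sides:
  fixes \<Omega> :: "(real^'n) set"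
  assumes chart: "graph_chart (frontier \<Omega>) i g U" and p: "p \<in> frontier \<Omega>" "p \<in> U"
    and field: "\<forall>x\<in>frontier \<Omega>. exterior_unit_normal \<Omega> x (N x)"
  shows "N p \<bullet> a > 0 \<Longrightarrow> eventually (\<lambda>t. p + t *\<^sub>R a \<in> interior (- \<Omega>)) (at_right 0)"
    and "N p \<bullet> a < 0 \<Longrightarrow> eventually (\<lambda>t. p + t *\<^sub>R a \<in> interior \<Omega>) (at_right 0)"
proof -
  let ?S = "frontier \<Omega>" and ?s = "N p $ i"
  have Nf: "unit_normal_field ?S N" using field by (rule unit_normal_field_frontier)
  note Neq = chart_normal_eq[OF chart Nf p] and Nsc = chart_normal_scale[OF chart Nf p]
  have s0: "?s \<noteq> 0" using Nsc by auto
  have gp: "graph_point i g p = p" and gpi: "g p = p $ i"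
    using graph_point_fixed[OF chart p] chart_mem_iff[OF chart p(2)] p(1) by auto
  \<comment> \<open>maps the horizontal hyperplane through \<open>p\<close> to the graph and keeps vertical distances\<close>
  define \<Psi> where "\<Psi> y = set_coord i (g y + (y $ i - p $ i)) y" for y
  let ?dom = "{y. graph_point i g y \<in> U}"
  have contg: "isCont g y" if "y \<in> ?dom" for y
    using chart_has_derivative_off_graph[OF chart, of y] that by (auto intro: has_derivative_continuous)
  then have cont\<Psi>: "continuous_on ?dom \<Psi>"
    unfolding \<Psi>_def by (intro continuous_intros continuous_at_imp_continuous_on) auto
  have "open (?dom \<inter> \<Psi> -` U)"
    using continuous_on_open_vimage[OF open_chart_base[OF chart]] cont\<Psi> chart_open[OF chart]
    by (metis Int_commute)
  moreover have "p \<in> ?dom \<inter> \<Psi> -` U"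
    using p gp gpi by (simp add: \<Psi>_def)
  ultimately obtain \<delta> where \<delta>: "\<delta> > 0" "ball p \<delta> \<subseteq> ?dom \<inter> \<Psi> -` U"
    by (meson openE)
  \<comment> \<open>for \<open>r = N p $ i\<close> a half ball that \<open>\<Psi>\<close> maps to the side to which \<open>N p\<close> points, for
    \<open>r = - N p $ i\<close> the opposite half ball\<close>
  define D where "D r = ball p \<delta> \<inter> {y. r * (y $ i - p $ i) > 0}" for r
  have D: "\<Psi> ` D r \<subseteq> interior \<Omega> \<or> \<Psi> ` D r \<subseteq> interior (- \<Omega>)" for r
  proof (rule connected_avoiding_frontier)
    have "{y. r * (y $ i - p $ i) > 0} = {y. (r *\<^sub>R axis i 1) \<bullet> y > r * p $ i}"
      by (auto simp: inner_axis' algebra_simps)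
    then have "convex (D r)"
      unfolding D_def by (metis convex_Int convex_ball convex_halfspace_gt)
    moreover have "continuous_on (D r) \<Psi>"
      by (rule continuous_on_subset[OF cont\<Psi>]) (use \<delta> in \<open>auto simp: D_def\<close>)
    ultimately show "connected (\<Psi> ` D r)"
      by (intro connected_continuous_image convex_connected)
    show "\<Psi> ` D r \<inter> ?S = {}"
    proof -
      have "\<Psi> y \<notin> ?S" if y: "y \<in> D r" for y
      proof
        assume "\<Psi> y \<in> ?S"
        moreover have "\<Psi> y \<in> U" using y \<delta> by (auto simp: D_def)
        ultimately have "\<Psi> y $ i = g (\<Psi> y)" using chart_mem_iff[OF chart] by blast
        then have "y $ i = p $ i" by (simp add: \<Psi>_def chart_set_coord[OF chart])
        then show False using y by (simp add: D_def)
      qed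
      then show ?thesis by blast
    qed
  qed
  have near: "eventually (\<lambda>z. \<forall>r. r * (z $ i - g z) > 0 \<longrightarrow> z \<in> \<Psi> ` D r) (nhds p)"
  proof -
    define \<Phi> where "\<Phi> z = set_coord i (p $ i + (z $ i - g z)) z" for z
    have "continuous (at p) \<Phi>"
      unfolding \<Phi>_def set_coord_eq
      using contg[of p] p gp by (intro continuous_intros continuous_componentwise) auto
    moreover have "\<Phi> p = p" by (simp add: \<Phi>_def gpi)
    ultimately have "(\<Phi> \<longlongrightarrow> p) (nhds p)"
      by (metis isCont_def tendsto_at_iff_tendsto_nhds)
    then have "eventually (\<lambda>z. \<Phi> z \<in> ball p \<delta>) (nhds p)"
      using \<delta> by (intro topological_tendstoD) auto
    then show ?thesis
    proof eventually_elim
      case (elim z)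
      have "\<Psi> (\<Phi> z) = z"
        by (simp add: \<Psi>_def \<Phi>_def chart_set_coord[OF chart])
      moreover have "\<Phi> z \<in> D r" if "r * (z $ i - g z) > 0" for r
        using elim that by (simp add: D_def \<Phi>_def)
      ultimately show ?case by (metis image_eqI)
    qed
  qed
  \<comment> \<open>height of \<open>p + t b\<close> over the graph, oriented by the normal\<close>
  define k where "k b t = ?s * ((p + t *\<^sub>R b) $ i - g (p + t *\<^sub>R b))" for b and t :: real
  have k': "(k b has_real_derivative N p \<bullet> b) (at 0)" for b
  proof -
    have 1: "((\<lambda>t. p + t *\<^sub>R b) has_derivative (\<lambda>t. t *\<^sub>R b)) (at (0::real))"
      by (auto intro!: derivative_eq_intros)
    have 2: "(g has_derivative (\<lambda>h. grad g p \<bullet> h)) (at (p + (0::real) *\<^sub>R b))"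
      using chart_has_derivative[OF chart p(2)] by simp
    have 3: "((\<lambda>t::real. g (p + t *\<^sub>R b)) has_derivative (\<lambda>t. grad g p \<bullet> (t *\<^sub>R b))) (at 0)"
      using diff_chain_at[OF 1 2] by (simp add: o_def)
    have "N p \<bullet> b = ?s * (b $ i - grad g p \<bullet> b)"
      by (subst Neq) (simp add: inner_diff_left inner_axis')
    then have "(\<lambda>t. ?s * (t * b $ i - grad g p \<bullet> (t *\<^sub>R b))) = (*) (N p \<bullet> b)"
      by (auto simp: fun_eq_iff right_diff_distrib mult.left_commute mult.commute)
    moreover have "(k b has_derivative (\<lambda>t. ?s * (t * b $ i - grad g p \<bullet> (t *\<^sub>R b)))) (at 0)"
      unfolding k_def by (auto intro!: derivative_eq_intros 3)
    ultimately show ?thesis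
      by (simp add: has_field_derivative_def)
  qed
  have k0: "k b 0 = 0" for b by (simp add: k_def gpi)
  have pos: "eventually (\<lambda>t. k b t > 0) (at_right 0)" if b: "N p \<bullet> b > 0" for b
  proof -
    obtain d where "d > 0" "\<And>h. 0 < h \<Longrightarrow> h < d \<Longrightarrow> k b 0 < k b (0 + h)"
      using DERIV_pos_inc_right[OF k' b] by blast
    then show ?thesis using k0 unfolding eventually_at_right_field by (intro exI[of _ d]) auto
  qed
  have neg: "eventually (\<lambda>t. k b t < 0) (at_right 0)" if b: "N p \<bullet> b < 0" for b
  proof -
    obtain d where "d > 0" "\<And>h. 0 < h \<Longrightarrow> h < d \<Longrightarrow> k b 0 > k b (0 + h)"
      using DERIV_neg_dec_right[OF k' b] by blast
    then show ?thesis using k0 unfolding eventually_at_right_field by (intro exI[of _ d]) auto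
  qed
  have near': "eventually (\<lambda>t. \<forall>r. r * ((p + t *\<^sub>R b) $ i - g (p + t *\<^sub>R b)) > 0 \<longrightarrow> p + t *\<^sub>R b \<in> \<Psi> ` D r) (at_right 0)" for b
  proof -
    have "((\<lambda>t. p + t *\<^sub>R b) \<longlongrightarrow> p + 0 *\<^sub>R b) (at_right (0::real))"
      by (intro tendsto_intros)
    then have "filterlim (\<lambda>t. p + t *\<^sub>R b) (nhds p) (at_right (0::real))" by simp
    from eventually_compose_filterlim[OF near this] show ?thesis .
  qed
  have up: "eventually (\<lambda>t. p + t *\<^sub>R b \<in> \<Psi> ` D ?s) (at_right 0)" if "N p \<bullet> b > 0" for b
    using pos[OF that] near'[of b] by eventually_elim (auto simp: k_def)
  have down: "eventually (\<lambda>t. p + t *\<^sub>R b \<in> \<Psi> ` D (- ?s)) (at_right 0)" if "N p \<bullet> b < 0" for b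
    using neg[OF that] near'[of b] by eventually_elim (auto simp: k_def)
  have ext: "exterior_unit_normal \<Omega> p (N p)" using field p by blast
  then have n1: "N p \<bullet> N p = 1" and
    sides: "eventually (\<lambda>t. p + t *\<^sub>R N p \<notin> \<Omega> \<and> p - t *\<^sub>R N p \<in> \<Omega>) (at_right 0)"
    unfolding exterior_unit_normal_def by (auto simp: dot_square_norm)
  have "eventually (\<lambda>t::real. p + t *\<^sub>R N p \<in> \<Psi> ` D ?s \<and> p + t *\<^sub>R N p \<notin> \<Omega>) (at_right 0)"
    using up[of "N p"] sides n1 by (auto elim: eventually_elim2)
  then obtain t1 :: real where "p + t1 *\<^sub>R N p \<in> \<Psi> ` D ?s" "p + t1 *\<^sub>R N p \<notin> \<Omega>"
    using eventually_happens'[OF trivial_limit_at_right_real] by blast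
  then have U: "\<Psi> ` D ?s \<subseteq> interior (- \<Omega>)"
    using D[of ?s] interior_subset by blast
  have "eventually (\<lambda>t::real. p + t *\<^sub>R (- N p) \<in> \<Psi> ` D (- ?s) \<and> p + t *\<^sub>R (- N p) \<in> \<Omega>) (at_right 0)"
    using down[of "- N p"] sides n1 by (auto elim: eventually_elim2)
  then obtain t2 :: real where "p + t2 *\<^sub>R (- N p) \<in> \<Psi> ` D (- ?s)" "p + t2 *\<^sub>R (- N p) \<in> \<Omega>"
    using eventually_happens'[OF trivial_limit_at_right_real] by blast
  then have L: "\<Psi> ` D (- ?s) \<subseteq> interior \<Omega>"
    using D[of "- ?s"] interior_subset by blast
  show "eventually (\<lambda>t. p + t *\<^sub>R a \<in> interior (- \<Omega>)) (at_right 0)" if "N p \<bullet> a > 0"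
    using up[OF that] by (rule eventually_mono) (use U in blast)
  show "eventually (\<lambda>t. p + t *\<^sub>R a \<in> interior \<Omega>) (at_right 0)" if "N p \<bullet> a < 0"
    using down[OF that] by (rule eventually_mono) (use L in blast)
qed

section \<open>The area formula does not depend on the chart\<close>

text \<open>The volume bound says that the push-forward of the Jacobian density dominates volume on the image,
  and an inequality of measures passes to integrals.\<close>

lemma nn_integral_image_le:
  fixes h :: "real^'n \<Rightarrow> real^'n" and F :: "real^'n \<Rightarrow> ennreal"
  assumes D [measurable]: "D \<in> sets borel" and E [measurable]: "h ` D \<in> sets borel"
    and der: "\<And>x. x \<in> D \<Longrightarrow> (h has_derivative h' x) (at x)"
    and J: "\<And>x. x \<in> D \<Longrightarrow> \<bar>det (ranked_matrix (h' x))\<bar> = J x"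
    and Jm [measurable]: "(\<lambda>x. indicator D x * J x) \<in> borel_measurable borel"
    and F [measurable]: "F \<in> borel_measurable borel"
  shows "(\<integral>\<^sup>+z\<in>h ` D. F z \<partial>lborel) \<le> (\<integral>\<^sup>+x\<in>D. ennreal (J x) * F (h x) \<partial>lborel)"
proof -
  define hm where "hm x = (if x \<in> D then h x else 0)" for x
  have "continuous_on D h"
    using der by (intro continuous_at_imp_continuous_on ballI has_derivative_continuous)
  then have hm [measurable]: "hm \<in> borel_measurable borel"
    unfolding hm_def by (intro borel_measurable_continuous_on_if D) auto
  define \<mu> where "\<mu> = density lborel (\<lambda>z. indicator (h ` D) z :: ennreal)"
  define \<nu> where "\<nu> = distr (density lborel (\<lambda>x. ennreal (indicator D x * J x))) borel hm"
  have "\<mu> \<le> \<nu>"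
  proof (subst le_measure, simp add: \<mu>_def \<nu>_def, intro ballI)
    fix B assume "B \<in> sets \<mu>"
    then have B [measurable]: "B \<in> sets borel" by (simp add: \<mu>_def)
    let ?D = "D \<inter> hm -` B"
    have Dm [measurable]: "?D \<in> sets borel"
      using measurable_sets[OF hm B] by auto
    have im: "h ` ?D = h ` D \<inter> B" by (auto simp: hm_def)
    have "emeasure \<mu> B = emeasure lborel (h ` D \<inter> B)"
      unfolding \<mu>_def by (subst emeasure_density) (auto simp flip: indicator_inter_arith)
    also have "\<dots> = emeasure lebesgue (h ` ?D)" unfolding im by simp
    also have "\<dots> \<le> (\<integral>\<^sup>+x\<in>?D. ennreal (J x) \<partial>lborel)"
    proof (rule emeasure_image_le_det(2)[OF Dm])
      have "(\<lambda>x. indicator ?D x * J x) = (\<lambda>x. indicator (hm -` B) x * (indicator D x * J x))"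
        by (auto simp: indicator_def)
      moreover have "\<dots> \<in> borel_measurable borel"
        using measurable_sets[OF hm B] by (intro borel_measurable_times Jm borel_measurable_indicator) simp
      ultimately show "(\<lambda>x. indicator ?D x * J x) \<in> borel_measurable borel" by simp
    qed (use der J in auto)
    also have "\<dots> = emeasure \<nu> B"
      unfolding \<nu>_def using measurable_sets[OF hm B]
      by (subst emeasure_distr, simp, simp, subst emeasure_density, simp, simp)
        (auto simp: indicator_def intro!: nn_integral_cong)
    finally show "emeasure \<mu> B \<le> emeasure \<nu> B" .
  qed
  then have "nn_integral \<mu> F \<le> nn_integral \<nu> F"
    by (intro nn_integral_mono_measure) (simp_all add: \<mu>_def \<nu>_def)
  moreover have "nn_integral \<mu> F = (\<integral>\<^sup>+z\<in>h ` D. F z \<partial>lborel)"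
    unfolding \<mu>_def by (subst nn_integral_density) (auto simp: mult.commute)
  moreover have "nn_integral \<nu> F = (\<integral>\<^sup>+x\<in>D. ennreal (J x) * F (h x) \<partial>lborel)"
    unfolding \<nu>_def
    by (subst nn_integral_distr, simp, simp, subst nn_integral_density, simp, simp)
      (auto simp: hm_def indicator_def intro!: nn_integral_cong)
  ultimately show ?thesis by simp
qed

text \<open>The base of the part \<open>A\<close> of a graph, thickened to a set of positive volume.\<close>

definition sheet :: "'n \<Rightarrow> (real^'n \<Rightarrow> real) \<Rightarrow> (real^'n) set \<Rightarrow> (real^'n) set" where
  "sheet i g A = {y \<in> slab i. graph_point i g y \<in> A}"

definition area_density :: "'n \<Rightarrow> (real^'n \<Rightarrow> real) \<Rightarrow> real^'n \<Rightarrow> real" where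
  "area_density i g y = sqrt (1 + grad_sq g (graph_point i g y))"

lemma graph_area_sheet: "graph_area i g A = (\<integral>\<^sup>+y\<in>sheet i g A. ennreal (area_density i g y) \<partial>lborel)"
  by (simp add: graph_area_def sheet_def slab_def area_density_def conj_assoc)

text \<open>The thickened projection of \<open>A\<close> along the coordinate \<open>i\<close>. For a subset of a graph in direction \<open>i\<close> it
  is the base \<open>sheet i g A\<close>, but it makes sense for every set.\<close>

definition shadow :: "'n \<Rightarrow> (real^'n) set \<Rightarrow> (real^'n) set" where
  "shadow i A = {y \<in> slab i. \<exists>t. set_coord i t y \<in> A}"

text \<open>Turns the base of a graph in direction \<open>j\<close> into its projection along \<open>i\<close>: the graph point over \<open>y\<close>
  keeps all coordinates except \<open>i\<close>, which is free in the thickened projection and receives the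
  coordinate \<open>j\<close> that is free in the thickened base.\<close>

definition tilt :: "'n \<Rightarrow> 'n \<Rightarrow> (real^'n \<Rightarrow> real) \<Rightarrow> real^'n \<Rightarrow> real^'n" where
  "tilt i j h y = set_coord i (y $ j) (graph_point j h y)"

context
  fixes S :: "(real^'n) set" and j :: 'n and h :: "real^'n \<Rightarrow> real" and V :: "(real^'n) set"
  assumes chart: "graph_chart S j h V"
begin

lemma measurable_on_graph:
  fixes f :: "real^'n \<Rightarrow> 'b::real_normed_vector"
  assumes "continuous_on V f"
  shows "(\<lambda>y. if graph_point j h y \<in> V then f (graph_point j h y) else 0) \<in> borel_measurable borel"
proof -
  have "{y. graph_point j h y \<in> V} \<in> sets borel"
    using open_chart_base[OF chart] by (rule borel_open)
  moreover have "continuous_on {y. graph_point j h y \<in> V} (\<lambda>y. f (graph_point j h y))"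
    by (rule continuous_on_compose2[OF assms continuous_on_graph_point[OF chart]]) auto
  ultimately have "(\<lambda>y. if y \<in> {y. graph_point j h y \<in> V} then f (graph_point j h y) else 0) \<in> borel_measurable borel"
    by (intro borel_measurable_continuous_on_if) auto
  then show ?thesis by simp
qed

lemma sheet_borel:
  assumes A: "A \<in> sets borel" "A \<subseteq> V"
  shows "sheet j h A \<in> sets borel"
proof -
  let ?f = "\<lambda>y. if graph_point j h y \<in> V then graph_point j h y else 0"
  have "{y. graph_point j h y \<in> V} \<in> sets borel"
    using open_chart_base[OF chart] by (rule borel_open)
  moreover have "?f -` A \<in> sets borel"
    using measurable_sets[OF measurable_on_graph[of "\<lambda>x. x"] A(1)] by (simp add: continuous_on_id)
  moreover have "sheet j h A = slab j \<inter> ({y. graph_point j h y \<in> V} \<inter> ?f -` A)"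
    using A(2) by (auto simp: sheet_def)
  ultimately show ?thesis by simp
qed

lemma continuous_on_area: "continuous_on V (\<lambda>p. sqrt (1 + grad_sq h p))"
  unfolding grad_sq_eq using chart_continuous_on_grad[OF chart] by (intro continuous_intros)

lemma measurable_area_density:
  assumes A: "A \<in> sets borel" "A \<subseteq> V"
  shows "(\<lambda>y. indicator (sheet j h A) y * ennreal (area_density j h y)) \<in> borel_measurable borel"
proof -
  have [measurable]: "sheet j h A \<in> sets borel" using assms by (rule sheet_borel)
  note [measurable] = measurable_on_graph[OF continuous_on_area]
  have "(\<lambda>y. indicator (sheet j h A) y * ennreal (area_density j h y)) =
    (\<lambda>y. indicator (sheet j h A) y * ennreal (if graph_point j h y \<in> V then sqrt (1 + grad_sq h (graph_point j h y)) else 0))"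
    using A by (auto simp: fun_eq_iff sheet_def indicator_def area_density_def)
  then show ?thesis by simp
qed

lemma tilt_sheet_eq_shadow:
  assumes "i \<noteq> j" and A: "A \<subseteq> S \<inter> V"
  shows "tilt i j h ` sheet j h A = shadow i A"
proof safe
  fix y assume y: "y \<in> sheet j h A"
  have "set_coord i (graph_point j h y $ i) (tilt i j h y) = graph_point j h y"
    by (simp add: tilt_def)
  moreover have "graph_point j h y \<in> A" using y by (simp add: sheet_def)
  ultimately have "\<exists>t. set_coord i t (tilt i j h y) \<in> A" by metis
  with y show "tilt i j h y \<in> shadow i A"
    by (simp add: shadow_def sheet_def slab_def) (simp add: tilt_def)
next
  fix z assume "z \<in> shadow i A"
  then obtain t where t: "set_coord i t z \<in> A" and z: "z \<in> slab i" by (auto simp: shadow_def)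
  define p where "p = set_coord i t z"
  have p: "p \<in> A" "p \<in> S" "p \<in> V" using t A by (auto simp: p_def)
  define y where "y = set_coord j (z $ i) p"
  have gy: "graph_point j h y = p"
    using graph_point_fixed[OF chart p(2,3)]
    by (simp add: y_def graph_point_set_coord chart_set_coord[OF chart])
  have "y \<in> sheet j h A"
    using z p gy by (simp add: sheet_def slab_def) (simp add: y_def)
  moreover have "tilt i j h y = z"
    by (simp add: tilt_def gy) (simp add: y_def p_def)
  ultimately show "z \<in> tilt i j h ` sheet j h A" by blast
qed

lemma sheet_eq_shadow:
  assumes A: "A \<subseteq> S \<inter> V"
  shows "sheet j h A = shadow j A"
proof safe
  fix y assume "y \<in> sheet j h A"
  then show "y \<in> shadow j A"
    by (auto simp: sheet_def shadow_def graph_point_set_coord)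
next
  fix y assume "y \<in> shadow j A"
  then obtain t where t: "set_coord j t y \<in> A" "y \<in> slab j" by (auto simp: shadow_def)
  then have "set_coord j t y = graph_point j h (set_coord j t y)"
    using graph_point_fixed[OF chart] A by (metis IntD1 IntD2 subsetD)
  also have "\<dots> = graph_point j h y"
    by (simp add: graph_point_set_coord chart_set_coord[OF chart])
  finally show "y \<in> sheet j h A" using t by (simp add: sheet_def)
qed

lemma tilt_has_derivative:
  assumes "i \<noteq> j" "graph_point j h y \<in> V"
  shows "(tilt i j h has_derivative (\<lambda>v. \<chi> k. if k = i then v $ j else if k = j
    then grad h (graph_point j h y) \<bullet> v else v $ k)) (at y)"
proof -
  let ?D = "\<lambda>v. set_coord j (grad h (graph_point j h y) \<bullet> v) v"
  have e: "tilt i j h = (\<lambda>z. graph_point j h z + (z $ j - graph_point j h z $ i) *\<^sub>R axis i 1)"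
    by (simp add: tilt_def[abs_def] set_coord_eq)
  have "(tilt i j h has_derivative (\<lambda>v. ?D v + (v $ j - ?D v $ i) *\<^sub>R axis i 1)) (at y)"
    unfolding e using graph_point_has_derivative[OF chart assms(2)]
    by (auto intro!: derivative_eq_intros bounded_linear.has_derivative[OF bounded_linear_vec_nth] simp del: set_coord_nth)
  also have "(\<lambda>v. ?D v + (v $ j - ?D v $ i) *\<^sub>R axis i 1) = (\<lambda>v. \<chi> k. if k = i then v $ j else if k = j
    then grad h (graph_point j h y) \<bullet> v else v $ k)"
    using assms(1) by (auto simp: fun_eq_iff vec_eq_iff axis_def)
  finally show ?thesis .
qed

lemma tilt_measurable:
  assumes A: "A \<in> sets borel" "A \<subseteq> V"
  shows "(\<lambda>y. indicator (sheet j h A) y * \<bar>grad h (graph_point j h y) $ i\<bar>) \<in> borel_measurable borel"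
proof -
  have [measurable]: "sheet j h A \<in> sets borel" using assms by (rule sheet_borel)
  have "continuous_on V (\<lambda>p. \<bar>grad h p $ i\<bar>)"
    using chart_continuous_on_grad[OF chart] by (intro continuous_intros)
  note [measurable] = measurable_on_graph[OF this]
  have "(\<lambda>y. indicator (sheet j h A) y * \<bar>grad h (graph_point j h y) $ i\<bar>) =
    (\<lambda>y. indicator (sheet j h A) y * (if graph_point j h y \<in> V then \<bar>grad h (graph_point j h y) $ i\<bar> else 0))"
    using A by (auto simp: fun_eq_iff sheet_def indicator_def)
  then show ?thesis by simp
qed

lemma shadow_le_tilt:
  assumes "i \<noteq> j" and A: "A \<in> sets borel" "A \<subseteq> S \<inter> V"
  shows "shadow i A \<in> sets lebesgue"
    and "emeasure lebesgue (shadow i A) \<le> (\<integral>\<^sup>+y\<in>sheet j h A. ennreal \<bar>grad h (graph_point j h y) $ i\<bar> \<partial>lborel)"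
proof -
  have D: "sheet j h A \<in> sets borel" using A by (intro sheet_borel) auto
  note * = emeasure_image_le_det[OF D tilt_has_derivative[OF assms(1)] det_ranked_matrix_swap_shear[OF assms(1)] tilt_measurable[OF A(1)],
      unfolded tilt_sheet_eq_shadow[OF assms(1) A(2)]]
  show "shadow i A \<in> sets lebesgue"
    by (rule *(1)) (use A in \<open>auto simp: sheet_def\<close>)
  show "emeasure lebesgue (shadow i A) \<le> (\<integral>\<^sup>+y\<in>sheet j h A. ennreal \<bar>grad h (graph_point j h y) $ i\<bar> \<partial>lborel)"
    by (rule *(2)) (use A in \<open>auto simp: sheet_def\<close>)
qed

end

text \<open>The left-hand side is the Jacobian of \<open>tilt i j h\<close>, so the volume of a projection along \<open>i\<close> is
  bounded by the integral of the absolute component \<open>i\<close> of the normal with respect to surface area.\<close>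

lemma area_density_tilt:
  fixes S :: "(real^'n) set"
  assumes chart: "graph_chart S j h V" and N: "unit_normal_field S N" and p: "p \<in> S" "p \<in> V" and "i \<noteq> j"
  shows "\<bar>grad h p $ i\<bar> = \<bar>N p $ i\<bar> * sqrt (1 + grad_sq h p)"
proof -
  have "N p $ i = - (N p $ j * grad h p $ i)"
    using arg_cong[OF chart_normal_eq[OF chart N p], of "\<lambda>v. v $ i"] assms(5) by (simp add: axis_def)
  then have "\<bar>N p $ i\<bar> * sqrt (1 + grad_sq h p) = \<bar>grad h p $ i\<bar> * (\<bar>N p $ j\<bar> * sqrt (1 + grad_sq h p))"
    by (simp add: abs_mult)
  then show ?thesis using chart_normal_scale[OF chart N p] by simp
qed

text \<open>The base of one graph is the image of the base of the other one under \<open>tilt\<close>, and the Jacobian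
  converts one area density into the other. The opposite inequality is the same statement with the
  charts exchanged.\<close>

lemma graph_area_le:
  fixes S :: "(real^'n) set"
  assumes c1: "graph_chart S i g U" and c2: "graph_chart S j h V" and N: "unit_normal_field S N"
    and ij: "i \<noteq> j" and A: "A \<in> sets borel" "A \<subseteq> S \<inter> U \<inter> V"
  shows "graph_area i g A \<le> graph_area j h A"
proof -
  have [measurable]: "A \<in> sets borel" by fact
  have D: "sheet j h A \<in> sets borel" using A by (intro sheet_borel[OF c2]) auto
  have im: "tilt i j h ` sheet j h A = sheet i g A"
    using tilt_sheet_eq_shadow[OF c2 ij] sheet_eq_shadow[OF c1] A by simp
  have E: "sheet i g A \<in> sets borel" using A by (intro sheet_borel[OF c1]) auto
  have F: "(\<lambda>y. indicator (sheet i g A) y * ennreal (area_density i g y)) \<in> borel_measurable borel"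
    using A by (intro measurable_area_density[OF c1]) auto
  have "graph_area i g A = (\<integral>\<^sup>+z\<in>tilt i j h ` sheet j h A. indicator (sheet i g A) z * ennreal (area_density i g z) \<partial>lborel)"
    unfolding graph_area_sheet im by (auto simp: indicator_def intro!: nn_integral_cong)
  also have "\<dots> \<le> (\<integral>\<^sup>+y\<in>sheet j h A. ennreal \<bar>grad h (graph_point j h y) $ i\<bar> *
      (indicator (sheet i g A) (tilt i j h y) * ennreal (area_density i g (tilt i j h y))) \<partial>lborel)"
    by (rule nn_integral_image_le[OF D _ tilt_has_derivative[OF c2 ij] det_ranked_matrix_swap_shear[OF ij] tilt_measurable[OF c2 A(1)] F])
      (use A E in \<open>auto simp: im, auto simp: sheet_def\<close>)
  also have "\<dots> = graph_area j h A"
    unfolding graph_area_sheet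
  proof (intro nn_integral_cong)
    fix y
    show "ennreal \<bar>grad h (graph_point j h y) $ i\<bar> * (indicator (sheet i g A) (tilt i j h y) * ennreal (area_density i g (tilt i j h y))) *
         indicator (sheet j h A) y = ennreal (area_density j h y) * indicator (sheet j h A) y"
    proof (cases "y \<in> sheet j h A")
      case True
      define p where "p = graph_point j h y"
      have pA: "p \<in> A" using True by (simp add: p_def sheet_def)
      then have p: "p \<in> S" "p \<in> U" "p \<in> V" using A by auto
      have t: "tilt i j h y \<in> sheet i g A" using im True by blast
      have "graph_point i g (tilt i j h y) = graph_point i g p"
        by (simp add: tilt_def graph_point_set_coord chart_set_coord[OF c1] p_def)
      then have gp: "graph_point i g (tilt i j h y) = p"
        using graph_point_fixed[OF c1] p by simp
      have "\<bar>grad h p $ i\<bar> * sqrt (1 + grad_sq g p) = sqrt (1 + grad_sq h p) * (\<bar>N p $ i\<bar> * sqrt (1 + grad_sq g p))"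
        using area_density_tilt[OF c2 N p(1,3) ij] by simp
      also have "\<dots> = sqrt (1 + grad_sq h p)"
        using chart_normal_scale[OF c1 N p(1,2)] by simp
      finally show ?thesis
        using True t by (simp add: area_density_def gp p_def[symmetric] ennreal_mult'[symmetric])
    qed simp
  qed
  finally show ?thesis .
qed

lemma graph_area_unique:
  fixes S :: "(real^'n) set"
  assumes c1: "graph_chart S i g U" and c2: "graph_chart S j h V" and N: "unit_normal_field S N"
    and A: "A \<in> sets borel" "A \<subseteq> S \<inter> U \<inter> V"
  shows "graph_area i g A = graph_area j h A"
proof (cases "i = j")
  case False
  then show ?thesis
    using graph_area_le[OF c1 c2 N] graph_area_le[OF c2 c1 N] A by (metis antisym inf.commute inf.left_commute)
next
  case True
  have sh: "sheet i g A = sheet j h A"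
    using sheet_eq_shadow[OF c1] sheet_eq_shadow[OF c2] A True by simp
  show ?thesis
    unfolding graph_area_sheet sh
  proof (intro nn_integral_cong)
    fix y
    have "area_density i g y = area_density j h y" if y: "y \<in> sheet j h A"
    proof -
      have 1: "graph_point i g y \<in> A" "graph_point j h y \<in> A" using y sh by (auto simp: sheet_def)
      define p where "p = graph_point j h y"
      have p: "p \<in> S" "p \<in> U" "p \<in> V" using 1 A by (auto simp: p_def)
      have "graph_point i g y = graph_point i g p"
        by (simp add: True graph_point_set_coord chart_set_coord[OF c1[unfolded True]] p_def)
      then have gp: "graph_point i g y = p" using graph_point_fixed[OF c1] p by simp
      have "N p $ j \<noteq> 0" using chart_normal_scale[OF c2 N p(1,3)] by auto
      moreover have "\<bar>N p $ j\<bar> * sqrt (1 + grad_sq g p) = \<bar>N p $ j\<bar> * sqrt (1 + grad_sq h p)"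
        using chart_normal_scale[OF c2 N p(1,3)] chart_normal_scale[OF c1 N p(1,2)] True by simp
      ultimately show ?thesis
        unfolding area_density_def gp p_def[symmetric] by (simp del: real_sqrt_eq_iff)
    qed
    then show "ennreal (area_density i g y) * indicator (sheet j h A) y =
      ennreal (area_density j h y) * indicator (sheet j h A) y"
      by (auto simp: indicator_def)
  qed
qed

section \<open>The surface measure\<close>

lemma Ck_on_subset: "V \<subseteq> U \<Longrightarrow> Ck_on k U f \<Longrightarrow> Ck_on k V f"
  by (induction k arbitrary: f) (auto intro: continuous_on_subset)

lemma graph_chart_subset:
  assumes "graph_chart S i g U" "open V" "V \<subseteq> U"
  shows "graph_chart S i g V"
  using assms Ck_on_subset[OF assms(3)] unfolding graph_chart_def smooth_on_def by blast

text \<open>Near a point of \<open>U\<close> the gradient is bounded, and the thickened base over a small ball is bounded, too.\<close>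

lemma local_finite_area:
  fixes S :: "(real^'n) set"
  assumes chart: "graph_chart S i g U" and x: "x \<in> U"
  obtains r where "r > 0" "ball x r \<subseteq> U" "\<And>A. A \<subseteq> ball x r \<Longrightarrow> graph_area i g A < \<infinity>"
proof -
  let ?f = "\<lambda>p. sqrt (1 + grad_sq g p)"
  obtain r1 where r1: "r1 > 0" "ball x r1 \<subseteq> U" using chart_open[OF chart] x openE by blast
  have "isCont ?f x"
    using continuous_on_area[OF chart] chart_open[OF chart] x by (simp add: continuous_on_eq_continuous_at)
  then obtain r2 where r2: "r2 > 0" "\<And>p. dist p x < r2 \<Longrightarrow> dist (?f p) (?f x) < 1"
    unfolding continuous_at_eps_delta by (metis zero_less_one)
  define r where "r = min r1 r2"
  have r: "r > 0" "ball x r \<subseteq> U" using r1 r2 by (auto simp: r_def)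
  let ?R = "r + (\<bar>x $ i\<bar> + r + 2)"
  have "graph_area i g A < \<infinity>" if A: "A \<subseteq> ball x r" for A
  proof -
    have "graph_area i g A \<le> (\<integral>\<^sup>+y. ennreal (?f x + 1) * indicator (ball x ?R) y \<partial>lborel)"
      unfolding graph_area_sheet
    proof (rule nn_integral_mono)
      fix y
      show "ennreal (area_density i g y) * indicator (sheet i g A) y \<le> ennreal (?f x + 1) * indicator (ball x ?R) y"
      proof (cases "y \<in> sheet i g A")
        case True
        then have gp: "graph_point i g y \<in> ball x r" and s: "0 \<le> y $ i" "y $ i \<le> 1" using A by (auto simp: sheet_def slab_def)
        then have "dist (?f (graph_point i g y)) (?f x) < 1"
          by (intro r2(2)) (simp add: r_def dist_commute)
        then have 1: "area_density i g y \<le> ?f x + 1" by (simp add: area_density_def dist_real_def)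
        have "\<bar>graph_point i g y $ i - x $ i\<bar> < r"
          using component_le_norm_cart[of "graph_point i g y - x" i] gp by (simp add: dist_norm norm_minus_commute)
        then have "\<bar>g y - y $ i\<bar> < \<bar>x $ i\<bar> + r + 2" using s by (simp add: graph_point_set_coord)
        moreover have "dist x y \<le> dist x (graph_point i g y) + dist (graph_point i g y) y" by (rule dist_triangle)
        moreover have "dist (graph_point i g y) y = \<bar>g y - y $ i\<bar>"
          by (simp add: graph_point_set_coord set_coord_eq dist_norm)
        ultimately have "y \<in> ball x ?R" using gp by simp
        with 1 True show ?thesis by (simp add: ennreal_leI)
      qed simp
    qed
    also have "\<dots> = ennreal (?f x + 1) * emeasure lborel (ball x ?R)"
      by (simp add: nn_integral_cmult_indicator)
    also have "\<dots> < \<infinity>"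
      using emeasure_bounded_finite[OF bounded_ball, of x ?R] by (simp add: ennreal_mult_less_top)
    finally show ?thesis .
  qed
  with r show ?thesis by (intro that)
qed

text \<open>A chart on the empty set belongs to the family so that a sequence of charts exists even if the
  hypersurface is empty.\<close>

lemma countable_atlas:
  fixes S :: "(real^'n) set"
  assumes "smooth_hypersurface S"
  obtains ix :: "nat \<Rightarrow> 'n" and gx Ux where "\<And>k. graph_chart S (ix k) (gx k) (Ux k)" "S \<subseteq> (\<Union>k. Ux k)"
    "\<And>k A. A \<subseteq> Ux k \<Longrightarrow> graph_area (ix k) (gx k) A < \<infinity>"
proof -
  define ok where "ok i g U \<longleftrightarrow> graph_chart S i g U \<and> (\<forall>A. A \<subseteq> U \<longrightarrow> graph_area i g A < \<infinity>)" for i g U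
  let ?F = "{U. \<exists>i g. ok i g U}"
  have op: "open U" if "U \<in> ?F" for U
    using that chart_open by (auto simp: ok_def)
  obtain F where F: "F \<subseteq> ?F" "countable F" "\<Union>F = \<Union>?F"
    by (rule Lindelof[of ?F, OF op])
  have "Ck_on k {} f" for k and f :: "real^'n \<Rightarrow> real" by (induction k arbitrary: f) auto
  then have "ok i (\<lambda>_. 0) {}" for i
    by (auto simp: ok_def graph_chart_def smooth_on_def graph_area_def)
  then have e: "insert {} F \<subseteq> ?F" using F by auto
  define Ux where "Ux = from_nat_into (insert {} F)"
  have ran: "range Ux = insert {} F"
    unfolding Ux_def using F(2) by (intro range_from_nat_into) auto
  have "\<forall>k. \<exists>i g. ok i g (Ux k)" using e ran by blast
  then obtain ix gx where ok: "\<And>k. ok (ix k) (gx k) (Ux k)" by metis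
  have "S \<subseteq> \<Union>?F"
  proof
    fix x assume x: "x \<in> S"
    then obtain i g U where U: "x \<in> U" "graph_chart S i g U" using assms unfolding smooth_hypersurface_def by blast
    then obtain r where r: "r > 0" "ball x r \<subseteq> U" "\<And>A. A \<subseteq> ball x r \<Longrightarrow> graph_area i g A < \<infinity>"
      using local_finite_area by metis
    then have "ok i g (ball x r)"
      using graph_chart_subset[OF U(2) open_ball r(2)] by (simp add: ok_def)
    then have "ball x r \<in> ?F" by blast
    then show "x \<in> \<Union>?F" using r(1) by (intro UnionI[of "ball x r"]) auto
  qed
  then have "S \<subseteq> (\<Union>k. Ux k)" using F(3) ran by auto
  with ok show ?thesis by (intro that) (auto simp: ok_def)
qed

text \<open>Surface area on the part \<open>A\<close> of a single chart: the area density on the base, pushed forward to the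
  graph. Outside of the chart the projection to the graph is arbitrary, and the value \<open>0\<close> makes it
  measurable.\<close>

definition chart_measure :: "'n \<Rightarrow> (real^'n \<Rightarrow> real) \<Rightarrow> (real^'n) set \<Rightarrow> (real^'n) set \<Rightarrow> (real^'n) measure" where
  "chart_measure j h V A = distr (density lborel (\<lambda>y. indicator (sheet j h A) y * ennreal (area_density j h y)))
     borel (\<lambda>y. if graph_point j h y \<in> V then graph_point j h y else 0)"

lemma
  fixes S :: "(real^'n) set"
  assumes chart: "graph_chart S j h V" and A: "A \<in> sets borel" "A \<subseteq> V"
  shows sets_chart_measure [simp]: "sets (chart_measure j h V A) = sets borel"
    and emeasure_chart_measure: "E \<in> sets borel \<Longrightarrow> emeasure (chart_measure j h V A) E = graph_area j h (A \<inter> E)"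
    and nn_integral_chart_measure: "f \<in> borel_measurable borel \<Longrightarrow>
      nn_integral (chart_measure j h V A) f = (\<integral>\<^sup>+y\<in>sheet j h A. ennreal (area_density j h y) * f (graph_point j h y) \<partial>lborel)"
proof -
  note [measurable] = measurable_area_density[OF chart A] measurable_on_graph[OF chart continuous_on_id]
  show "sets (chart_measure j h V A) = sets borel" by (simp add: chart_measure_def)
  show *: "nn_integral (chart_measure j h V A) f = (\<integral>\<^sup>+y\<in>sheet j h A. ennreal (area_density j h y) * f (graph_point j h y) \<partial>lborel)"
    if [measurable]: "f \<in> borel_measurable borel" for f
    unfolding chart_measure_def
    by (subst nn_integral_distr, simp, simp, subst nn_integral_density, simp, simp)
      (use A in \<open>auto simp: indicator_def sheet_def intro!: nn_integral_cong\<close>)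
  show "emeasure (chart_measure j h V A) E = graph_area j h (A \<inter> E)" if E: "E \<in> sets borel"
  proof -
    have "emeasure (chart_measure j h V A) E = nn_integral (chart_measure j h V A) (indicator E)"
      using E by (simp add: chart_measure_def)
    also have "\<dots> = graph_area j h (A \<inter> E)"
      unfolding graph_area_sheet using E
      by (subst *) (auto simp: indicator_def sheet_def intro!: nn_integral_cong)
    finally show ?thesis .
  qed
qed

text \<open>A unit normal field is part of the data because it makes the area formulas of different charts
  comparable.\<close>

locale charted_hypersurface =
  fixes S :: "(real^'n) set" and N :: "real^'n \<Rightarrow> real^'n"
    and ix :: "nat \<Rightarrow> 'n" and gx :: "nat \<Rightarrow> real^'n \<Rightarrow> real" and Ux :: "nat \<Rightarrow> (real^'n) set"
  assumes closed_S: "closed S" and chart: "\<And>k. graph_chart S (ix k) (gx k) (Ux k)"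
    and cover: "S \<subseteq> (\<Union>k. Ux k)"
    and finite_area: "\<And>k A. A \<subseteq> Ux k \<Longrightarrow> graph_area (ix k) (gx k) A < \<infinity>"
    and normal: "unit_normal_field S N"
begin

definition piece :: "nat \<Rightarrow> (real^'n) set" where
  "piece k = S \<inter> disjointed Ux k"

lemma S_borel [measurable]: "S \<in> sets borel"
  using closed_S by (rule borel_closed)

lemma Ux_borel [measurable]: "Ux k \<in> sets borel"
  using chart_open[OF chart] by (rule borel_open)

lemma piece_borel [measurable]: "piece k \<in> sets borel"
proof -
  have "disjointed Ux k \<in> sets borel" using sets.range_disjointed_sets[of Ux borel] Ux_borel by (auto simp: image_subset_iff)
  then show ?thesis by (simp add: piece_def)
qed

lemma piece_subset: "piece k \<subseteq> S \<inter> Ux k"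
  using disjointed_subset[of Ux k] by (auto simp: piece_def)

lemma disjoint_pieces: "disjoint_family piece"
  using disjoint_family_disjointed[of Ux] by (auto simp: piece_def disjoint_family_on_def)

lemma UN_pieces: "(\<Union>k. piece k) = S"
  unfolding piece_def Int_UN_distrib[symmetric] UN_disjointed_eq using cover by (rule Int_absorb2)

abbreviation "piece_measure k \<equiv> chart_measure (ix k) (gx k) (Ux k) (piece k)"

lemma emeasure_piece_measure: "E \<in> sets borel \<Longrightarrow> emeasure (piece_measure k) E = graph_area (ix k) (gx k) (piece k \<inter> E)"
  using piece_subset by (intro emeasure_chart_measure[OF chart]) auto

text \<open>The pieces are disjoint and cover \<open>S\<close>, and each lies in a chart, so this is the only candidate for the
  surface measure.\<close>

definition glued_measure :: "(real^'n) measure" where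
  "glued_measure = measure_of UNIV (sets borel) (\<lambda>E. \<Sum>k. emeasure (piece_measure k) E)"

lemma sets_glued_measure [simp]: "sets glued_measure = sets borel"
  unfolding glued_measure_def using sets.sets_measure_of_eq[of "borel :: (real^'n) measure"] by simp

lemma emeasure_glued_measure:
  assumes E: "E \<in> sets borel"
  shows "emeasure glued_measure E = (\<Sum>k. graph_area (ix k) (gx k) (piece k \<inter> E))"
proof -
  have sets_piece_measure: "sets (piece_measure k) = sets borel" for k using piece_subset by (intro sets_chart_measure[OF chart]) auto
  have "emeasure glued_measure E = (\<Sum>k. emeasure (piece_measure k) E)"
    unfolding glued_measure_def
  proof (rule emeasure_measure_of_sigma)
    show "sigma_algebra UNIV (sets (borel :: (real^'n) measure))"
      using sets.sigma_algebra_axioms[of "borel :: (real^'n) measure"] by simp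
    show "positive (sets borel) (\<lambda>E. \<Sum>k. emeasure (piece_measure k) E)" by (simp add: positive_def)
    show "countably_additive (sets borel) (\<lambda>E. \<Sum>k. emeasure (piece_measure k) E)"
    proof (rule countably_additiveI)
      fix A :: "nat \<Rightarrow> (real^'n) set"
      assume A: "range A \<subseteq> sets borel" "disjoint_family A" "(\<Union>i. A i) \<in> sets borel"
      have "(\<Sum>i. \<Sum>k. emeasure (piece_measure k) (A i)) = (\<integral>\<^sup>+k. (\<Sum>i. emeasure (piece_measure k) (A i)) \<partial>count_space UNIV)"
        by (subst nn_integral_suminf) (auto simp: nn_integral_count_space_nat)
      also have "\<dots> = (\<Sum>k. emeasure (piece_measure k) (\<Union>i. A i))"
        unfolding nn_integral_count_space_nat
        using A by (intro suminf_cong suminf_emeasure) (auto simp: sets_piece_measure)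
      finally show "(\<Sum>i. \<Sum>k. emeasure (piece_measure k) (A i)) = (\<Sum>k. emeasure (piece_measure k) (\<Union>i. A i))" .
    qed
    show "E \<in> sets borel" by fact
  qed
  then show ?thesis using E by (simp add: emeasure_piece_measure)
qed

lemma is_surface_measure_glued_measure: "is_surface_measure S glued_measure"
  unfolding is_surface_measure_def
proof (intro conjI allI impI)
  show "sets glued_measure = sets borel" by simp
  have e: "graph_area i g {} = 0" for i :: 'n and g by (simp add: graph_area_def)
  have "piece k \<inter> - S = {}" for k using piece_subset by auto
  then show "emeasure glued_measure (- S) = 0" by (subst emeasure_glued_measure) (auto simp: e)
  fix i g U A assume c: "graph_chart S i g U" and A: "A \<in> sets borel" "A \<subseteq> S \<inter> U"
  let ?m = "chart_measure i g U A"
  have m: "sets ?m = sets borel" "\<And>E. E \<in> sets borel \<Longrightarrow> emeasure ?m E = graph_area i g (A \<inter> E)"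
    using A by (intro sets_chart_measure[OF c] emeasure_chart_measure[OF c]; auto)+
  have "emeasure glued_measure A = (\<Sum>k. graph_area i g (piece k \<inter> A))"
    unfolding emeasure_glued_measure[OF A(1)]
    using A piece_subset by (intro suminf_cong graph_area_unique[OF chart c normal]) auto
  also have "\<dots> = (\<Sum>k. emeasure ?m (piece k))"
    by (simp add: m inf.commute)
  also have "\<dots> = emeasure ?m (\<Union>k. piece k)"
    using disjoint_pieces by (intro suminf_emeasure) (auto simp: m)
  also have "\<dots> = graph_area i g A"
    unfolding UN_pieces using A by (subst m(2)) (auto simp: Int_absorb2)
  finally show "emeasure glued_measure A = graph_area i g A" .
qed

lemma is_surface_measure_unique:
  assumes \<sigma>: "is_surface_measure S \<sigma>"
  shows "\<sigma> = glued_measure"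
proof (rule measure_eqI)
  have s: "sets \<sigma> = sets borel" and 0: "emeasure \<sigma> (- S) = 0"
    and g: "\<And>i g U A. graph_chart S i g U \<Longrightarrow> A \<in> sets borel \<Longrightarrow> A \<subseteq> S \<inter> U \<Longrightarrow> emeasure \<sigma> A = graph_area i g A"
    using \<sigma> unfolding is_surface_measure_def by blast+
  show "sets \<sigma> = sets glued_measure" using s by simp
  fix A assume "A \<in> sets \<sigma>"
  then have A [measurable]: "A \<in> sets borel" using s by simp
  have "emeasure \<sigma> A = emeasure \<sigma> (A \<inter> S)"
  proof (rule emeasure_eq_AE)
    have "- S \<in> null_sets \<sigma>" using 0 s by (simp add: null_sets_def)
    then show "AE x in \<sigma>. x \<in> A \<longleftrightarrow> x \<in> A \<inter> S" by (rule AE_I') auto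
  qed (auto simp: s)
  also have "A \<inter> S = (\<Union>k. piece k \<inter> A)" using UN_pieces by auto
  also have "emeasure \<sigma> \<dots> = (\<Sum>k. emeasure \<sigma> (piece k \<inter> A))"
    using disjoint_pieces by (intro suminf_emeasure[symmetric]) (auto simp: s disjoint_family_on_def)
  also have "\<dots> = (\<Sum>k. graph_area (ix k) (gx k) (piece k \<inter> A))"
    using piece_subset by (intro suminf_cong g[OF chart]) auto
  also have "\<dots> = emeasure glued_measure A" by (simp add: emeasure_glued_measure)
  finally show "emeasure \<sigma> A = emeasure glued_measure A" .
qed

abbreviation "\<sigma> \<equiv> surface_measure S"

lemma is_surface_measure_surface_measure: "is_surface_measure S \<sigma>"
proof -
  have "\<sigma> = glued_measure" unfolding surface_measure_def
    using is_surface_measure_glued_measure is_surface_measure_unique by (rule the_equality)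
  then show ?thesis using is_surface_measure_glued_measure by simp
qed

lemma sets_surface_measure [simp, measurable_cong]: "sets \<sigma> = sets borel"
  using is_surface_measure_surface_measure by (simp add: is_surface_measure_def)

lemma emeasure_surface_measure:
  "graph_chart S i g U \<Longrightarrow> A \<in> sets borel \<Longrightarrow> A \<subseteq> S \<inter> U \<Longrightarrow> emeasure \<sigma> A = graph_area i g A"
  using is_surface_measure_surface_measure unfolding is_surface_measure_def by (elim conjE) simp

text \<open>The area formula for functions: both sides are integrals with respect to measures that agree on all
  Borel sets.\<close>

lemma nn_integral_surface_chart:
  assumes c: "graph_chart S i g U" and A [measurable]: "A \<in> sets borel" and AU: "A \<subseteq> S \<inter> U"
    and f [measurable]: "f \<in> borel_measurable borel"
  shows "(\<integral>\<^sup>+p\<in>A. f p \<partial>\<sigma>) = (\<integral>\<^sup>+y\<in>sheet i g A. ennreal (area_density i g y) * f (graph_point i g y) \<partial>lborel)"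
proof -
  have AU': "A \<subseteq> U" using AU by auto
  have "density \<sigma> (indicator A) = chart_measure i g U A"
  proof (rule measure_eqI)
    show "sets (density \<sigma> (indicator A)) = sets (chart_measure i g U A)"
      using sets_chart_measure[OF c A AU'] by simp
    fix E assume "E \<in> sets (density \<sigma> (indicator A))"
    then have E [measurable]: "E \<in> sets borel" by simp
    have "emeasure (density \<sigma> (indicator A)) E = emeasure \<sigma> (A \<inter> E)"
      by (subst emeasure_density) (auto simp flip: indicator_inter_arith)
    also have "\<dots> = emeasure (chart_measure i g U A) E"
      using AU by (subst emeasure_surface_measure[OF c]) (auto simp: emeasure_chart_measure[OF c A AU'])
    finally show "emeasure (density \<sigma> (indicator A)) E = emeasure (chart_measure i g U A) E" .
  qed
  moreover have "(\<integral>\<^sup>+p\<in>A. f p \<partial>\<sigma>) = nn_integral (density \<sigma> (indicator A)) f"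
    by (subst nn_integral_density) (auto simp: mult.commute)
  ultimately show ?thesis using nn_integral_chart_measure[OF c A AU' f] by simp
qed

text \<open>On each piece the absolute value of a component is a continuous expression in the gradient of the
  chart. Its sign depends on the side of \<open>\<Omega>\<close> and is not seen by the chart.\<close>

lemma measurable_normal_component [measurable]:
  "(\<lambda>p. if p \<in> S then \<bar>N p $ i\<bar> else 0) \<in> borel_measurable borel"
proof -
  let ?f = "\<lambda>p. if p \<in> S then \<bar>N p $ i\<bar> else 0"
  show ?thesis
  proof (rule measurable_piecewise_restrict[of "insert (- S) (range piece)"])
    show "space borel \<subseteq> \<Union>(insert (- S) (range piece))" using UN_pieces by auto
    fix \<Omega> assume "\<Omega> \<in> insert (- S) (range piece)"
    then consider "\<Omega> = - S" | k where "\<Omega> = piece k" by auto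
    then show "?f \<in> borel_measurable (restrict_space borel \<Omega>)"
    proof cases
      case 1
      then have "?f x = 0" if "x \<in> space (restrict_space borel \<Omega>)" for x
        using that by (simp add: space_restrict_space)
      then show ?thesis by (subst measurable_cong[where g = "\<lambda>_. 0"]) auto
    next
      case 2
      let ?g = "\<lambda>p. (if i = ix k then 1 else \<bar>grad (gx k) p $ i\<bar>) / sqrt (1 + grad_sq (gx k) p)"
      have pos: "sqrt (1 + grad_sq (gx k) p) > 0" for p
        by (simp add: grad_sq_eq add_pos_nonneg)
      have "?f p = ?g p" if "p \<in> piece k" for p
      proof -
        have p: "p \<in> S" "p \<in> Ux k" using that piece_subset by auto
        show ?thesis
        proof (cases "i = ix k")
          case True
          then show ?thesis using chart_normal_scale[OF chart normal p] pos[of p] p by (simp add: field_simps)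
        next
          case False
          then show ?thesis using area_density_tilt[OF chart normal p False] pos[of p] p by (simp add: field_simps)
        qed
      qed
      moreover have "continuous_on (piece k) ?g"
      proof -
        have "continuous_on (Ux k) ?g"
          using continuous_on_area[OF chart[of k]] chart_continuous_on_grad[OF chart[of k]] pos less_imp_neq[OF pos]
          by (cases "i = ix k") (auto intro!: continuous_intros)
        then show ?thesis using piece_subset by (auto intro: continuous_on_subset)
      qed
      ultimately have "continuous_on (piece k) ?f" by (simp cong: continuous_on_cong)
      then show ?thesis unfolding 2 by (rule borel_measurable_continuous_on_restrict)
    qed
  qed auto
qed

lemma nn_integral_pieces:
  assumes [measurable]: "f \<in> borel_measurable borel" "B \<in> sets borel"
  shows "(\<integral>\<^sup>+p\<in>S \<inter> B. f p \<partial>\<sigma>) = (\<Sum>k. \<integral>\<^sup>+p\<in>piece k \<inter> B. f p \<partial>\<sigma>)"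
proof -
  have d: "disjoint_family (\<lambda>k. piece k \<inter> B)"
    using disjoint_pieces unfolding disjoint_family_on_def by blast
  have u: "(\<Union>k. piece k \<inter> B) = S \<inter> B" using UN_pieces by blast
  have f: "f \<in> borel_measurable \<sigma>" by measurable
  have m: "piece k \<inter> B \<in> sets \<sigma>" for k by measurable
  from nn_integral_disjoint_family[OF f m d] show ?thesis unfolding u .
qed

text \<open>If the chart points in the direction of projection, area density and normal component cancel and
  equality holds. Otherwise the projection is an image of the base under \<open>tilt\<close>.\<close>

lemma shadow_le_flux_piece:
  assumes B: "B \<in> sets borel" "B \<subseteq> piece k"
  shows "shadow i B \<in> sets lebesgue"
    and "emeasure lebesgue (shadow i B) \<le> (\<integral>\<^sup>+p\<in>B. ennreal \<bar>N p $ i\<bar> \<partial>\<sigma>)"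
proof -
  let ?p = "graph_point (ix k) (gx k)" and ?w = "area_density (ix k) (gx k)" and ?Sh = "sheet (ix k) (gx k) B"
  have BS: "B \<subseteq> S \<inter> Ux k" using B(2) piece_subset[of k] by (rule order_trans)
  have "(\<integral>\<^sup>+p\<in>B. ennreal \<bar>N p $ i\<bar> \<partial>\<sigma>) = (\<integral>\<^sup>+p\<in>B. ennreal (if p \<in> S then \<bar>N p $ i\<bar> else 0) \<partial>\<sigma>)"
    using BS by (auto simp: indicator_def intro!: nn_integral_cong)
  also have "\<dots> = (\<integral>\<^sup>+y\<in>?Sh. ennreal (?w y) *
      ennreal (if ?p y \<in> S then \<bar>N (?p y) $ i\<bar> else 0) \<partial>lborel)"
    by (rule nn_integral_surface_chart[OF chart B(1) BS]) measurable
  finally have flux: "(\<integral>\<^sup>+p\<in>B. ennreal \<bar>N p $ i\<bar> \<partial>\<sigma>) = \<dots>" .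
  have "shadow i B \<in> sets lebesgue \<and> emeasure lebesgue (shadow i B) \<le> (\<integral>\<^sup>+p\<in>B. ennreal \<bar>N p $ i\<bar> \<partial>\<sigma>)"
  proof (cases "i = ix k")
    case True
    have sh: "shadow i B = ?Sh" using sheet_eq_shadow[OF chart BS] True by simp
    have m: "?Sh \<in> sets borel" using BS B by (intro sheet_borel[OF chart]) auto
    have "(\<integral>\<^sup>+p\<in>B. ennreal \<bar>N p $ i\<bar> \<partial>\<sigma>) = (\<integral>\<^sup>+y. indicator (?Sh) y \<partial>lborel)"
      unfolding flux
    proof (intro nn_integral_cong)
      fix y
      have "?w y * \<bar>N (?p y) $ i\<bar> = 1"
        "?p y \<in> S"
        if "y \<in> ?Sh"
      proof -
        have p: "?p y \<in> S" "?p y \<in> Ux k"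
          using that BS by (auto simp: sheet_def)
        show "?w y * \<bar>N (?p y) $ i\<bar> = 1"
          using chart_normal_scale[OF chart normal p] True by (simp add: area_density_def mult.commute)
        show "?p y \<in> S" by fact
      qed
      then show "ennreal (?w y) *
         ennreal (if ?p y \<in> S then \<bar>N (?p y) $ i\<bar> else 0) *
         indicator (?Sh) y = indicator (?Sh) y"
        by (auto simp: indicator_def ennreal_mult''[symmetric])
    qed
    then show ?thesis using m by (simp add: sh)
  next
    case False
    have "(\<integral>\<^sup>+p\<in>B. ennreal \<bar>N p $ i\<bar> \<partial>\<sigma>) =
      (\<integral>\<^sup>+y\<in>?Sh. ennreal \<bar>grad (gx k) (?p y) $ i\<bar> \<partial>lborel)"
      unfolding flux
    proof (intro nn_integral_cong)
      fix y
      have "\<bar>grad (gx k) (?p y) $ i\<bar> = ?w y * \<bar>N (?p y) $ i\<bar>"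
        "?p y \<in> S"
        if "y \<in> ?Sh"
      proof -
        have p: "?p y \<in> S" "?p y \<in> Ux k"
          using that BS by (auto simp: sheet_def)
        show "\<bar>grad (gx k) (?p y) $ i\<bar> = ?w y * \<bar>N (?p y) $ i\<bar>"
          using area_density_tilt[OF chart normal p False] by (simp add: area_density_def mult.commute)
        show "?p y \<in> S" by fact
      qed
      then show "ennreal (?w y) *
         ennreal (if ?p y \<in> S then \<bar>N (?p y) $ i\<bar> else 0) *
         indicator (?Sh) y = ennreal \<bar>grad (gx k) (?p y) $ i\<bar> * indicator (?Sh) y"
        by (auto simp: indicator_def ennreal_mult''[symmetric])
    qed
    then show ?thesis using shadow_le_tilt[OF chart False B(1) BS] by simp
  qed
  then show "shadow i B \<in> sets lebesgue"
    and "emeasure lebesgue (shadow i B) \<le> (\<integral>\<^sup>+p\<in>B. ennreal \<bar>N p $ i\<bar> \<partial>\<sigma>)" by auto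
qed

text \<open>The projection of a hypersurface along a coordinate, counted without multiplicity, is at most as large
  as the flux of the coordinate direction through it, counted without sign.\<close>

lemma shadow_le_flux:
  assumes B [measurable]: "B \<in> sets borel"
  shows "shadow i (S \<inter> B) \<in> sets lebesgue"
    and "emeasure lebesgue (shadow i (S \<inter> B)) \<le> (\<integral>\<^sup>+p\<in>S \<inter> B. ennreal \<bar>N p $ i\<bar> \<partial>\<sigma>)"
proof -
  have sh: "shadow i (S \<inter> B) = (\<Union>k. shadow i (piece k \<inter> B))"
  proof -
    have "S \<inter> B = (\<Union>k. piece k \<inter> B)" using UN_pieces by blast
    then show ?thesis by (simp only:) (auto simp: shadow_def)
  qed
  have m: "shadow i (piece k \<inter> B) \<in> sets lebesgue" for k
    by (rule shadow_le_flux_piece) auto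
  show "shadow i (S \<inter> B) \<in> sets lebesgue" unfolding sh using m by (intro sets.countable_UN) auto
  have "emeasure lebesgue (shadow i (S \<inter> B)) \<le> (\<Sum>k. emeasure lebesgue (shadow i (piece k \<inter> B)))"
    unfolding sh using m by (intro emeasure_subadditive_countably) auto
  also have "\<dots> \<le> (\<Sum>k. \<integral>\<^sup>+p\<in>piece k \<inter> B. ennreal \<bar>N p $ i\<bar> \<partial>\<sigma>)"
    by (intro suminf_le shadow_le_flux_piece(2)) auto
  also have "\<dots> = (\<Sum>k. \<integral>\<^sup>+p\<in>piece k \<inter> B. ennreal (if p \<in> S then \<bar>N p $ i\<bar> else 0) \<partial>\<sigma>)"
    using piece_subset by (intro suminf_cong nn_integral_cong) (auto simp: indicator_def)
  also have "\<dots> = (\<integral>\<^sup>+p\<in>S \<inter> B. ennreal (if p \<in> S then \<bar>N p $ i\<bar> else 0) \<partial>\<sigma>)"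
    by (rule nn_integral_pieces[symmetric]) auto
  also have "\<dots> = (\<integral>\<^sup>+p\<in>S \<inter> B. ennreal \<bar>N p $ i\<bar> \<partial>\<sigma>)"
    by (intro nn_integral_cong) (auto simp: indicator_def)
  finally show "emeasure lebesgue (shadow i (S \<inter> B)) \<le> (\<integral>\<^sup>+p\<in>S \<inter> B. ennreal \<bar>N p $ i\<bar> \<partial>\<sigma>)" .
qed

text \<open>A line in the direction of a graph meets it in at most one point.\<close>

lemma null_hypersurface: "S \<in> null_sets lborel"
proof -
  have "piece k \<in> null_sets lborel" for k
  proof -
    have le: "(\<integral>\<^sup>+t. indicator (piece k) (set_coord (ix k) t y) \<partial>lborel) = 0" for y
    proof -
      have "indicator (piece k) (set_coord (ix k) t y) \<le> (indicator {gx k y} t :: ennreal)" for t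
      proof (cases "set_coord (ix k) t y \<in> piece k")
        case True
        then have "set_coord (ix k) t y \<in> S" "set_coord (ix k) t y \<in> Ux k" using piece_subset[of k] by auto
        then have "t = gx k y"
          using chart_mem_iff[OF chart, of "set_coord (ix k) t y" k] by (simp add: chart_set_coord[OF chart])
        then show ?thesis by (simp add: indicator_def)
      qed simp
      then have "(\<integral>\<^sup>+t. indicator (piece k) (set_coord (ix k) t y) \<partial>lborel) \<le> (\<integral>\<^sup>+t. indicator {gx k y} t \<partial>lborel)"
        by (intro nn_integral_mono) 
      then show ?thesis by simp
    qed
    have "emeasure lborel (piece k) = (\<integral>\<^sup>+y. indicator (piece k) y \<partial>lborel)" by simp
    also have "\<dots> = 0" by (subst nn_integral_slab[of _ "ix k"]) (auto simp: le)
    finally show ?thesis by auto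
  qed
  then have "(\<Union>k. piece k) \<in> null_sets lborel" by (intro null_sets_UN) auto
  then show ?thesis by (simp only: UN_pieces)
qed

end

section \<open>Lattice translations and periodic sets\<close>

definition lat :: "int^'n \<Rightarrow> real^'n" where
  "lat m = (\<chi> i. real_of_int (m $ i))"

lemma lat_nth [simp]: "lat m $ i = real_of_int (m $ i)"
  by (simp add: lat_def)

lemma lat_minus: "lat (- m) = - lat m"
  by (simp add: vec_eq_iff)

lemma lattice_invariant:
  fixes f :: "real^'n \<Rightarrow> 'b"
  assumes f: "\<And>x i. f (x + axis i 1) = f x"
  shows "f (x + lat m) = f x"
proof -
  define G where "G = {v. \<forall>x. f (x + v) = f x}"
  have add: "v + w \<in> G" if "v \<in> G" "w \<in> G" for v w
    using that by (simp add: G_def add.assoc[symmetric])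
  have minus: "- v \<in> G" if v: "v \<in> G" for v
  proof -
    have "f (x + - v) = f x" for x
    proof -
      have "f ((x + - v) + v) = f (x + - v)" using v by (simp only: G_def mem_Collect_eq)
      then show ?thesis by simp
    qed
    then show ?thesis by (simp add: G_def)
  qed
  have nat: "real k *\<^sub>R v \<in> G" if v: "v \<in> G" for v k
  proof (induction k)
    case 0 show ?case by (simp add: G_def)
  next
    case (Suc k)
    have "real (Suc k) *\<^sub>R v = real k *\<^sub>R v + v" by (simp add: algebra_simps)
    then show ?case using add[OF Suc v] by simp
  qed
  have int: "real_of_int k *\<^sub>R v \<in> G" if v: "v \<in> G" for v k
  proof (cases "k \<ge> 0")
    case True
    then show ?thesis using nat[OF v, of "nat k"] by simp
  next
    case False
    then show ?thesis using minus[OF nat[OF v, of "nat (- k)"]] by simp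
  qed
  have "(\<Sum>i\<in>I. real_of_int (m $ i) *\<^sub>R axis i 1) \<in> G" if "finite I" for I
    using that
  proof induction
    case empty show ?case by (simp add: G_def)
  next
    case (insert i I)
    have "axis i 1 \<in> G" using f by (simp add: G_def)
    then show ?case using insert add int by simp
  qed
  moreover have "lat m = (\<Sum>i\<in>UNIV. real_of_int (m $ i) *\<^sub>R axis i 1)"
    using basis_expansion[of "lat m"] by (simp add: scalar_mult_eq_scaleR)
  ultimately show ?thesis by (simp add: G_def)
qed

lemma half_open_cube_borel [measurable]: "half_open_cube \<in> sets borel"
  unfolding half_open_cube_def by measurable

lemma half_open_cube_unique:
  assumes "x \<in> half_open_cube" "x + lat m \<in> half_open_cube"
  shows "m = 0"
proof -
  have "m $ i = 0" for i
  proof -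
    have "-1/2 \<le> x $ i" "x $ i < 1/2" "-1/2 \<le> x $ i + real_of_int (m $ i)" "x $ i + real_of_int (m $ i) < 1/2"
      using assms by (auto simp: half_open_cube_def)
    then have "real_of_int (m $ i) < 1" "real_of_int (m $ i) > -1" by auto
    then show ?thesis by linarith
  qed
  then show ?thesis by (simp add: vec_eq_iff)
qed

lemma half_open_cube_covers: "\<exists>m. x + lat m \<in> half_open_cube"
proof
  show "x + lat (\<chi> i. - \<lfloor>x $ i + 1/2\<rfloor>) \<in> half_open_cube"
    unfolding half_open_cube_def
    using floor_correct[of "x $ i + 1/2" for i] by (auto simp: algebra_simps) linarith
qed

text \<open>\<open>V\<close> contains at most one point and \<open>W\<close> at least one point of every class modulo the lattice. Cut \<open>V\<close>
  into its intersections with the translates of \<open>W\<close> and move these pieces into \<open>W\<close>; there they do not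
  overlap.\<close>

lemma periodic_nn_integral_le:
  fixes F :: "real^'n \<Rightarrow> ennreal"
  assumes F [measurable]: "F \<in> borel_measurable borel" and per: "\<And>x i. F (x + axis i 1) = F x"
    and V [measurable]: "V \<in> sets borel" and W [measurable]: "W \<in> sets borel"
    and pack: "\<And>x m. x \<in> V \<Longrightarrow> x + lat m \<in> V \<Longrightarrow> m = 0"
    and cover: "\<And>x. \<exists>m. x + lat m \<in> W"
  shows "(\<integral>\<^sup>+x\<in>V. F x \<partial>lborel) \<le> (\<integral>\<^sup>+x\<in>W. F x \<partial>lborel)"
proof -
  have one: "(\<integral>\<^sup>+m. indicator {m0} m \<partial>count_space UNIV) = (1::ennreal)" for m0 :: "int^'n"
    by (subst nn_integral_indicator) (auto simp: emeasure_count_space)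
  have ctbl: "countable (UNIV :: (int^'n) set)" by simp
  have "(\<integral>\<^sup>+x\<in>V. F x \<partial>lborel) \<le> (\<integral>\<^sup>+x. (\<integral>\<^sup>+m. F x * indicator V x * indicator W (x + lat m) \<partial>count_space UNIV) \<partial>lborel)"
  proof (rule nn_integral_mono)
    fix x :: "real^'n"
    obtain m0 where m0: "x + lat m0 \<in> W" using cover by blast
    have "1 \<le> (\<integral>\<^sup>+m. indicator W (x + lat m) \<partial>count_space UNIV :: ennreal)"
      unfolding one[of m0, symmetric] by (rule nn_integral_mono) (use m0 in \<open>auto simp: indicator_def\<close>)
    then have "F x * indicator V x * 1 \<le> F x * indicator V x * (\<integral>\<^sup>+m. indicator W (x + lat m) \<partial>count_space UNIV)"
      by (rule mult_left_mono) simp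
    then show "F x * indicator V x \<le> (\<integral>\<^sup>+m. F x * indicator V x * indicator W (x + lat m) \<partial>count_space UNIV)"
      by (subst nn_integral_cmult) auto
  qed
  also have "\<dots> = (\<integral>\<^sup>+m. (\<integral>\<^sup>+x. F x * indicator V x * indicator W (x + lat m) \<partial>lborel) \<partial>count_space UNIV)"
    by (rule nn_integral_count_space_nn_integral[OF ctbl]) measurable
  also have "\<dots> = (\<integral>\<^sup>+m. (\<integral>\<^sup>+x. F x * indicator W x * indicator V (x + lat (- m)) \<partial>lborel) \<partial>count_space UNIV)"
  proof (rule nn_integral_cong)
    fix m :: "int^'n"
    have "(\<integral>\<^sup>+x. F x * indicator W x * indicator V (x + lat (- m)) \<partial>lborel)
      = (\<integral>\<^sup>+x. F (lat m + x) * indicator W (lat m + x) * indicator V (lat m + x + lat (- m)) \<partial>lborel)"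
      by (rule nn_integral_lborel_translate[symmetric]) measurable
    also have "\<dots> = (\<integral>\<^sup>+x. F x * indicator V x * indicator W (x + lat m) \<partial>lborel)"
      using lattice_invariant[of F, OF per]
      by (intro nn_integral_cong) (simp add: lat_minus add.commute mult_ac)
    finally show "(\<integral>\<^sup>+x. F x * indicator V x * indicator W (x + lat m) \<partial>lborel) =
      (\<integral>\<^sup>+x. F x * indicator W x * indicator V (x + lat (- m)) \<partial>lborel)" by simp
  qed
  also have "\<dots> = (\<integral>\<^sup>+x. (\<integral>\<^sup>+m. F x * indicator W x * indicator V (x + lat (- m)) \<partial>count_space UNIV) \<partial>lborel)"
    by (rule nn_integral_count_space_nn_integral[OF ctbl, symmetric]) measurable
  also have "\<dots> \<le> (\<integral>\<^sup>+x\<in>W. F x \<partial>lborel)"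
  proof (rule nn_integral_mono)
    fix x :: "real^'n"
    have "(\<integral>\<^sup>+m. indicator V (x + lat (- m)) \<partial>count_space UNIV :: ennreal) \<le> 1"
    proof (cases "\<exists>m0. x + lat (- m0) \<in> V")
      case True
      then obtain m0 where m0: "x + lat (- m0) \<in> V" by blast
      have "m = m0" if "x + lat (- m) \<in> V" for m
      proof -
        have "x + lat (- m0) + lat (m0 - m) = x + lat (- m)" by (simp add: vec_eq_iff)
        then have "m0 - m = 0" using pack[OF m0] that by metis
        then show ?thesis by simp
      qed
      then show ?thesis
        unfolding one[of m0, symmetric] by (intro nn_integral_mono) (auto simp: indicator_def)
    qed simp
    then have "F x * indicator W x * (\<integral>\<^sup>+m. indicator V (x + lat (- m)) \<partial>count_space UNIV) \<le> F x * indicator W x * 1"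
      by (rule mult_left_mono) simp
    then show "(\<integral>\<^sup>+m. F x * indicator W x * indicator V (x + lat (- m)) \<partial>count_space UNIV) \<le> F x * indicator W x"
      by (subst nn_integral_cmult) auto
  qed
  finally show ?thesis .
qed

lemma periodic_nn_integral_shift:
  fixes F :: "real^'n \<Rightarrow> ennreal"
  assumes F [measurable]: "F \<in> borel_measurable borel" and per: "\<And>x i. F (x + axis i 1) = F x"
  shows "(\<integral>\<^sup>+x\<in>half_open_cube. F (x + z) \<partial>lborel) = (\<integral>\<^sup>+x\<in>half_open_cube. F x \<partial>lborel)"
proof -
  define H where "H = (\<lambda>x. x - z) -` (half_open_cube :: (real^'n) set)"
  have H [measurable]: "H \<in> sets borel"
    unfolding H_def using measurable_sets[of "\<lambda>x. x - z" borel borel half_open_cube] by simp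
  have "(\<integral>\<^sup>+x\<in>H. F x \<partial>lborel) = (\<integral>\<^sup>+x. F (z + x) * indicator H (z + x) \<partial>lborel)"
    by (rule nn_integral_lborel_translate[symmetric]) measurable
  also have "\<dots> = (\<integral>\<^sup>+x\<in>half_open_cube. F (x + z) \<partial>lborel)"
    by (intro nn_integral_cong) (simp add: H_def indicator_def add.commute)
  finally have eq: "(\<integral>\<^sup>+x\<in>half_open_cube. F (x + z) \<partial>lborel) = (\<integral>\<^sup>+x\<in>H. F x \<partial>lborel)" by simp
  have cov: "\<exists>m. x + lat m \<in> H" for x
    using half_open_cube_covers[of "x - z"] by (simp add: H_def algebra_simps)
  have pack: "m = 0" if "x \<in> H" "x + lat m \<in> H" for x m
    using half_open_cube_unique[of "x - z" m] that by (simp add: H_def algebra_simps)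
  show ?thesis
    unfolding eq
    by (rule antisym[OF periodic_nn_integral_le[OF F per H half_open_cube_borel pack half_open_cube_covers]
      periodic_nn_integral_le[OF F per half_open_cube_borel H half_open_cube_unique cov]])
qed

text \<open>The exact form of a periodic set: two open sets instead of a set and its complement, with identities
  that hold at every point.\<close>

locale antiperiodic_pair =
  fixes Inn Out :: "(real^'n) set"
  assumes open_Inn: "open Inn" and open_Out: "open Out"
    and disjoint: "Inn \<inter> Out = {}"
    and null_rest: "- (Inn \<union> Out) \<in> null_sets lborel"
    and shift_Inn: "\<And>x i. x + axis i 1 \<in> Inn \<longleftrightarrow> x \<in> Out"
    and shift_Out: "\<And>x i. x + axis i 1 \<in> Out \<longleftrightarrow> x \<in> Inn"
    and reflect: "\<And>x. - x \<in> Out \<longleftrightarrow> x \<in> Inn"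
begin

lemma Inn_borel [measurable]: "Inn \<in> sets borel" using open_Inn by (rule borel_open)
lemma Out_borel [measurable]: "Out \<in> sets borel" using open_Out by (rule borel_open)

definition changes :: "real^'n \<Rightarrow> real^'n \<Rightarrow> bool" where
  "changes z x \<longleftrightarrow> x \<in> Inn \<and> x + z \<in> Out \<or> x \<in> Out \<and> x + z \<in> Inn"

lemma changes_periodic: "changes z (x + axis i 1) = changes z x"
proof -
  have "x + axis i 1 + z = (x + z) + axis i 1" by simp
  then show ?thesis unfolding changes_def by (simp only: shift_Inn shift_Out) blast
qed

definition change_volume :: "real^'n \<Rightarrow> ennreal" where
  "change_volume z = (\<integral>\<^sup>+x\<in>half_open_cube. indicator {x. changes z x} x \<partial>lborel)"

lemma measurable_changes [measurable]:
  assumes [measurable]: "f \<in> borel_measurable M" "g \<in> borel_measurable M"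
  shows "Measurable.pred M (\<lambda>w. changes (f w) (g w))"
  unfolding changes_def by measurable

end

text \<open>If \<open>y\<close> were not interior to the complement, it would be a limit of interior points of \<open>\<Omega>\<close>. Then the
  open set of all points with \<open>\<phi>\<close>-image in the interior of \<open>\<Omega>\<close>, which contains \<open>y\<close>, would meet the
  interior of \<open>\<Omega>\<close> in a nonempty open subset of a null set.\<close>

lemma complementary_interior:
  fixes \<Omega> :: "(real^'n) set"
  assumes \<phi>: "continuous_on UNIV \<phi>" and neg: "negligible {y. \<phi> y \<in> \<Omega> \<and> y \<in> \<Omega>}"
    and bd: "frontier \<Omega> \<subseteq> closure (interior \<Omega>)" and y: "\<phi> y \<in> interior \<Omega>"
  shows "y \<in> interior (- \<Omega>)"
proof (rule ccontr)
  assume "y \<notin> interior (- \<Omega>)"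
  then have "y \<in> closure (interior \<Omega>)"
    using bd closure_subset[of "interior \<Omega>"] by (auto simp: interior_complement frontier_def)
  define T where "T = \<phi> -` interior \<Omega>"
  have T: "open T" "y \<in> T"
    using continuous_on_open_vimage[of UNIV \<phi>] \<phi> y by (auto simp: T_def)
  then have "T \<inter> interior \<Omega> \<noteq> {}"
    using \<open>y \<in> closure (interior \<Omega>)\<close> open_Int_closure_eq_empty by blast
  moreover have "open (T \<inter> interior \<Omega>)" using T by auto
  ultimately have "\<not> negligible (T \<inter> interior \<Omega>)" by (simp add: open_not_negligible)
  moreover have "T \<inter> interior \<Omega> \<subseteq> {y. \<phi> y \<in> \<Omega> \<and> y \<in> \<Omega>}"
    using interior_subset by (auto simp: T_def)
  ultimately show False using neg negligible_subset by blast
qed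

lemma frontier_in_closure_interiors:
  fixes \<Omega> :: "(real^'n) set"
  assumes "smooth_hypersurface (frontier \<Omega>)"
    and field: "\<forall>x\<in>frontier \<Omega>. exterior_unit_normal \<Omega> x (N x)"
  shows "frontier \<Omega> \<subseteq> closure (interior \<Omega>) \<inter> closure (interior (- \<Omega>))"
proof
  fix p assume p: "p \<in> frontier \<Omega>"
  then obtain i g U where U: "graph_chart (frontier \<Omega>) i g U" "p \<in> U"
    using assms(1) unfolding smooth_hypersurface_def by blast
  have n: "N p \<bullet> N p = 1" using field p by (simp add: exterior_unit_normal_def dot_square_norm)
  have lim: "((\<lambda>t. p + t *\<^sub>R a) \<longlongrightarrow> p) (at_right (0::real))" for a
  proof -
    have "((\<lambda>t. p + t *\<^sub>R a) \<longlongrightarrow> p + 0 *\<^sub>R a) (at_right (0::real))" by (intro tendsto_intros)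
    then show ?thesis by simp
  qed
  have cl: "p \<in> closure T" if "eventually (\<lambda>t. p + t *\<^sub>R a \<in> T) (at_right 0)" for a T
    using that lim[of a] by (intro Lim_in_closed_set[of "closure T" "\<lambda>t. p + t *\<^sub>R a"])
      (auto elim!: eventually_mono intro: closure_subset[THEN subsetD])
  show "p \<in> closure (interior \<Omega>) \<inter> closure (interior (- \<Omega>))"
    using cl[OF exterior_normal_sides(1)[OF U(1) p U(2) field, of "N p"]]
      cl[OF exterior_normal_sides(2)[OF U(1) p U(2) field, of "- N p"]] n by simp
qed

text \<open>Each of the exchanges between the interiors is an instance of \<open>complementary_interior\<close>, for \<open>\<Omega>\<close> or
  its complement and for \<open>\<phi>\<close> the translation, its inverse or the reflection.\<close>

lemma antiperiodic_pair_of_periodic: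
  fixes \<Omega> :: "(real^'n) set"
  assumes per: "periodic \<Omega>" and hs: "smooth_hypersurface (frontier \<Omega>)"
    and null: "frontier \<Omega> \<in> null_sets lborel"
    and field: "\<forall>x\<in>frontier \<Omega>. exterior_unit_normal \<Omega> x (N x)"
  shows "antiperiodic_pair (interior \<Omega>) (interior (- \<Omega>))"
proof -
  note bd = frontier_in_closure_interiors[OF hs field]
  have bd1: "frontier \<Omega> \<subseteq> closure (interior \<Omega>)" and bd2: "frontier (- \<Omega>) \<subseteq> closure (interior (- \<Omega>))"
    using bd by (auto simp: frontier_complement)
  have Z: "negligible (sym_diff ((\<lambda>x. x + axis i 1) ` \<Omega>) (- \<Omega>))" for i
    using per by (simp add: periodic_def ae_eq_def negligible_iff_null_sets)
  have Z': "negligible (sym_diff (uminus ` \<Omega>) (- \<Omega>))"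
    using per by (simp add: periodic_def ae_eq_def negligible_iff_null_sets)
  have im: "y \<in> (\<lambda>x. x + axis i 1) ` \<Omega> \<longleftrightarrow> y - axis i 1 \<in> \<Omega>" for y i
    by (auto intro: image_eqI[of _ _ "y - axis i 1"])
  have im': "y \<in> uminus ` \<Omega> \<longleftrightarrow> - y \<in> \<Omega>" for y by (metis image_iff minus_minus)
  have d1: "negligible {y. y - axis i 1 \<in> \<Omega> \<and> y \<in> \<Omega>}" for i
    by (rule negligible_subset[OF Z[of i]]) (auto simp: im)
  have d2: "negligible {y. y - axis i 1 \<in> - \<Omega> \<and> y \<in> - \<Omega>}" for i
    by (rule negligible_subset[OF Z[of i]]) (auto simp: im)
  have tr: "negligible {y. P (y + axis i 1) y}" if "negligible {y. P y (y - axis i 1)}" for P and i :: 'n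
  proof -
    have "{y. P (y + axis i 1) y} = (+) (- axis i 1) ` {y. P y (y - axis i 1)}"
      by (auto intro: image_eqI[of _ _ "y + axis i 1" for y])
    then show ?thesis by (simp only: negligible_translation[OF that])
  qed
  have d3: "negligible {y. y + axis i 1 \<in> \<Omega> \<and> y \<in> \<Omega>}" for i
    by (rule tr) (use d1[of i] in \<open>simp add: conj_commute\<close>)
  have d4: "negligible {y. y + axis i 1 \<in> - \<Omega> \<and> y \<in> - \<Omega>}" for i
    by (rule tr) (use d2[of i] in \<open>simp add: conj_commute\<close>)
  have d5: "negligible {y. - y \<in> \<Omega> \<and> y \<in> \<Omega>}"
    by (rule negligible_subset[OF Z']) (auto simp: im')
  have d6: "negligible {y. - y \<in> - \<Omega> \<and> y \<in> - \<Omega>}"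
    by (rule negligible_subset[OF Z']) (auto simp: im')
  have c: "continuous_on UNIV (\<lambda>y. y - axis i (1::real) :: real^'n)" "continuous_on UNIV (\<lambda>y. y + axis i (1::real) :: real^'n)"
    "continuous_on UNIV (uminus :: real^'n \<Rightarrow> _)" for i
    by (intro continuous_intros)+
  show ?thesis
  proof
    show "interior \<Omega> \<inter> interior (- \<Omega>) = {}" using interior_subset[of \<Omega>] interior_subset[of "- \<Omega>"] by auto
    show "- (interior \<Omega> \<union> interior (- \<Omega>)) \<in> null_sets lborel"
    proof -
      have "- (interior \<Omega> \<union> interior (- \<Omega>)) = frontier \<Omega>"
        by (auto simp: frontier_def interior_complement)
      then show ?thesis using null by simp
    qed
    show "x + axis i 1 \<in> interior \<Omega> \<longleftrightarrow> x \<in> interior (- \<Omega>)" for x i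
      using complementary_interior[OF c(1)[of i] d2[of i] bd2, of "x + axis i 1"]
        complementary_interior[OF c(2)[of i] d3[of i] bd1, of x] by auto
    show "x + axis i 1 \<in> interior (- \<Omega>) \<longleftrightarrow> x \<in> interior \<Omega>" for x i
      using complementary_interior[OF c(1)[of i] d1[of i] bd1, of "x + axis i 1"]
        complementary_interior[OF c(2)[of i] d4[of i] bd2, of x] by auto
    show "- x \<in> interior (- \<Omega>) \<longleftrightarrow> x \<in> interior \<Omega>" for x
      using complementary_interior[OF c(3) d5 bd1, of "- x"]
        complementary_interior[OF c(3) d6 bd2, of x] by auto
  qed auto
qed

section \<open>Gaussian noise and the probability of changing sides\<close>

definition gauss :: "real^'n \<Rightarrow> real" where
  "gauss y = (\<Prod>i\<in>UNIV. std_normal_density (y $ i))"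

lemma gauss_nonneg [simp]: "0 \<le> gauss y"
  unfolding gauss_def by (intro prod_nonneg) auto

lemma gauss_measurable [measurable]: "gauss \<in> borel_measurable borel"
  unfolding gauss_def by measurable

lemma gauss_radial: "gauss (y :: real^'n) = (1 / sqrt (2 * pi)) ^ CARD('n) * exp (- (norm y)\<^sup>2 / 2)"
proof -
  have "(norm y)\<^sup>2 = (\<Sum>i\<in>UNIV. (y $ i)\<^sup>2)"
    unfolding power2_norm_eq_inner by (simp add: inner_vec_def power2_eq_square)
  then have "- (norm y)\<^sup>2 / 2 = (\<Sum>i\<in>UNIV. - (y $ i)\<^sup>2 / 2)"
    by (simp add: sum_negf sum_divide_distrib)
  then show ?thesis
    unfolding gauss_def std_normal_density_def prod.distrib by (simp add: exp_sum)
qed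

lemma nn_integral_gauss_coordinate:
  fixes f :: "real \<Rightarrow> real"
  assumes [measurable]: "f \<in> borel_measurable borel" and f0: "\<And>t. 0 \<le> f t"
  shows "(\<integral>\<^sup>+y. ennreal (gauss (y :: real^'n) * f (y $ i)) \<partial>lborel) = (\<integral>\<^sup>+t. ennreal (std_normal_density t * f t) \<partial>lborel)"
proof -
  define h where "h b t = (if b = axis i 1 then ennreal (std_normal_density t * f t) else ennreal (std_normal_density t))"
    for b :: "real^'n" and t
  have one: "(\<integral>\<^sup>+t. ennreal (std_normal_density t) \<partial>lborel) = 1"
    using prob_space.emeasure_space_1[OF prob_space_normal_density[of 1 0]]
    by (simp add: emeasure_density)
  have "(\<integral>\<^sup>+y. ennreal (gauss (y :: real^'n) * f (y $ i)) \<partial>lborel) = (\<integral>\<^sup>+y. (\<Prod>b\<in>Basis. h b (y \<bullet> b)) \<partial>lborel)"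
  proof (rule nn_integral_cong)
    fix y :: "real^'n"
    have "(\<Prod>b\<in>Basis. h b (y \<bullet> b)) = (\<Prod>k\<in>UNIV. h (axis k 1) (y $ k))"
      by (simp add: prod_Basis_cart inner_axis)
    also have "\<dots> = h (axis i 1) (y $ i) * (\<Prod>k\<in>UNIV - {i}. h (axis k 1) (y $ k))"
      by (rule prod.remove) auto
    also have "\<dots> = ennreal (std_normal_density (y $ i) * f (y $ i)) * (\<Prod>k\<in>UNIV - {i}. ennreal (std_normal_density (y $ k)))"
      by (simp add: h_def axis_eq_axis cong: prod.cong) (intro arg_cong2[of _ _ _ _ "(*)"] prod.cong, auto simp: axis_eq_axis)
    also have "\<dots> = ennreal (std_normal_density (y $ i) * f (y $ i) * (\<Prod>k\<in>UNIV - {i}. std_normal_density (y $ k)))"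
      by (simp add: prod_ennreal ennreal_mult' f0 prod_nonneg ennreal_mult'')
    also have "\<dots> = ennreal (gauss y * f (y $ i))"
      unfolding gauss_def by (subst prod.remove[of UNIV i]) (auto simp: mult_ac)
    finally show "ennreal (gauss y * f (y $ i)) = (\<Prod>b\<in>Basis. h b (y \<bullet> b))" by simp
  qed
  also have "\<dots> = (\<Prod>b\<in>Basis. \<integral>\<^sup>+t. h b t \<partial>lborel)"
    by (rule nn_integral_lborel_prod) (auto simp: h_def)
  also have "\<dots> = (\<Prod>k\<in>UNIV. \<integral>\<^sup>+t. h (axis k 1) t \<partial>lborel)"
    by (rule prod_Basis_cart)
  also have "\<dots> = (\<integral>\<^sup>+t. h (axis i 1) t \<partial>lborel) * (\<Prod>k\<in>UNIV - {i}. \<integral>\<^sup>+t. h (axis k 1) t \<partial>lborel)"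
    by (rule prod.remove) auto
  also have "(\<Prod>k\<in>UNIV - {i}. \<integral>\<^sup>+t. h (axis k 1) t \<partial>lborel) = 1"
    by (rule prod.neutral) (auto simp: h_def axis_eq_axis one)
  finally show ?thesis by (simp add: h_def)
qed

lemma nn_integral_gauss: "(\<integral>\<^sup>+y. ennreal (gauss (y :: real^'n)) \<partial>lborel) = 1"
proof -
  have "(\<integral>\<^sup>+y. ennreal (gauss (y :: real^'n)) \<partial>lborel) = (\<integral>\<^sup>+t. ennreal (std_normal_density t) \<partial>lborel)"
    using nn_integral_gauss_coordinate[of "\<lambda>_. 1" "undefined :: 'n"] by simp
  also have "\<dots> = 1"
    using prob_space.emeasure_space_1[OF prob_space_normal_density[of 1 0]]
    by (simp add: emeasure_density)
  finally show ?thesis .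
qed

text \<open>By rotation invariance \<open>v\<close> may be taken along a coordinate axis, where the integral is the first
  absolute moment of the standard normal distribution.\<close>

lemma gauss_abs_inner:
  fixes v :: "real^'n"
  shows "(\<integral>\<^sup>+y. ennreal (gauss y) * ennreal \<bar>v \<bullet> y\<bar> \<partial>lborel) = ennreal (sqrt (2 / pi) * norm v)"
proof -
  let ?i = "undefined :: 'n"
  have "\<exists>f :: real^'n \<Rightarrow> real^'n. orthogonal_transformation f \<and> f v = norm v *\<^sub>R axis ?i 1"
    by (rule orthogonal_transformation_exists[of v "norm v *\<^sub>R axis ?i (1::real)"], simp, blast)
  then obtain f :: "real^'n \<Rightarrow> real^'n" where f: "orthogonal_transformation f" "f v = norm v *\<^sub>R axis ?i 1"
    by blast
  have nf: "norm (f y) = norm y" for y using f(1) by (rule orthogonal_transformation_norm)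
  have "(\<integral>\<^sup>+y. ennreal (gauss y) * ennreal \<bar>v \<bullet> y\<bar> \<partial>lborel)
    = (\<integral>\<^sup>+y. ennreal (gauss (f y)) * ennreal (norm v * \<bar>f y $ ?i\<bar>) \<partial>lborel)"
  proof (rule nn_integral_cong)
    fix y
    have "v \<bullet> y = f v \<bullet> f y" using f(1) by (simp add: orthogonal_transformation_def)
    also have "\<dots> = norm v * f y $ ?i" unfolding f(2) by (simp add: inner_axis')
    finally show "ennreal (gauss y) * ennreal \<bar>v \<bullet> y\<bar> = ennreal (gauss (f y)) * ennreal (norm v * \<bar>f y $ ?i\<bar>)"
      by (simp add: gauss_radial nf abs_mult)
  qed
  also have "\<dots> = (\<integral>\<^sup>+y. ennreal (gauss y) * ennreal (norm v * \<bar>y $ ?i\<bar>) \<partial>distr lborel borel f)"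
  proof (rule nn_integral_distr[symmetric])
    have "linear f" using f(1) by (rule orthogonal_transformation_linear)
    then have "f \<in> borel_measurable borel"
      by (intro borel_measurable_continuous_onI linear_continuous_on) (simp add: linear_conv_bounded_linear)
    then show "f \<in> measurable lborel borel" by simp
  qed auto
  also have "\<dots> = (\<integral>\<^sup>+y. ennreal (gauss y) * ennreal (norm v * \<bar>y $ ?i\<bar>) \<partial>lborel)"
    unfolding distr_lborel_orthogonal[OF f(1)] ..
  also have "\<dots> = (\<integral>\<^sup>+y. ennreal (norm v) * ennreal (gauss y * \<bar>y $ ?i\<bar>) \<partial>lborel)"
    by (intro nn_integral_cong) (simp add: ennreal_mult'[symmetric] mult_ac)
  also have "\<dots> = ennreal (norm v) * (\<integral>\<^sup>+t. ennreal (std_normal_density t * \<bar>t\<bar>) \<partial>lborel)"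
    by (subst nn_integral_cmult, simp) (simp add: nn_integral_gauss_coordinate)
  also have "(\<integral>\<^sup>+t. ennreal (std_normal_density t * \<bar>t\<bar>) \<partial>lborel) = ennreal (sqrt (2 / pi))"
  proof -
    have "has_bochner_integral lborel (\<lambda>t. std_normal_density t * \<bar>t\<bar>) (sqrt (2 / pi))"
      using std_normal_moment_abs_odd[of 0] by simp
    then show ?thesis
      by (subst nn_integral_eq_integral) (auto simp: has_bochner_integral_iff)
  qed
  finally show ?thesis by (simp add: ennreal_mult'[symmetric] mult.commute)
qed

lemma emeasure_cube: "emeasure lborel (cube :: (real^'n) set) = 1"
proof -
  have "cube = cbox (\<chi> i. -1/2) (\<chi> i. 1/2 :: real^'n)"
    by (auto simp: cube_def mem_box_cart)
  also have "emeasure lborel \<dots> = (\<Prod>b\<in>Basis. ((\<chi> i. 1/2) - (\<chi> i. -1/2) :: real^'n) \<bullet> b)"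
  proof (rule emeasure_lborel_cbox)
    fix b :: "real^'n" assume "b \<in> Basis"
    then have "\<exists>k. b = axis k 1" by (auto simp: Basis_vec_def)
    then show "(\<chi> i. -1/2) \<bullet> b \<le> (\<chi> i. 1/2) \<bullet> b" by (auto simp: inner_axis)
  qed
  also have "(\<Prod>b\<in>Basis. ((\<chi> i. 1/2) - (\<chi> i. -1/2) :: real^'n) \<bullet> b) = 1"
    by (simp add: prod_Basis_cart inner_axis)
  finally show ?thesis by simp
qed

lemma AE_cube_half_open: "AE x in lborel. x \<in> cube \<longleftrightarrow> x \<in> (half_open_cube :: (real^'n) set)"
proof -
  have "AE x in lborel. (x :: real^'n) $ i \<noteq> 1/2" for i
  proof -
    have "{x :: real^'n. x $ i = 1/2} \<in> null_sets lebesgue"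
      using negligible_standard_hyperplane[of "axis i 1 :: real^'n" "1/2"]
      by (simp add: negligible_iff_null_sets inner_axis)
    moreover have "{x :: real^'n. x $ i = 1/2} \<in> sets borel" by measurable
    ultimately have "{x :: real^'n. x $ i = 1/2} \<in> null_sets lborel"
      by (simp add: null_sets_completion_iff)
    then show ?thesis by (rule AE_I') auto
  qed
  then have "AE x in lborel. \<forall>i. (x :: real^'n) $ i \<noteq> 1/2"
    by (subst AE_all_countable) simp
  then show ?thesis
  proof eventually_elim
    case (elim x)
    then have "x $ i \<le> 1/2 \<longleftrightarrow> x $ i < 1/2" for i by (simp add: order_le_less)
    then show ?case by (simp add: cube_def half_open_cube_def)
  qed
qed

lemma emeasure_half_open_cube: "emeasure lborel (half_open_cube :: (real^'n) set) = 1"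
proof -
  have c: "cube \<in> sets (borel :: (real^'n) measure)" unfolding cube_def by measurable
  have "emeasure lborel (half_open_cube :: (real^'n) set) = emeasure lborel (cube :: (real^'n) set)"
    by (rule emeasure_eq_AE) (use AE_cube_half_open c in \<open>auto elim!: eventually_mono\<close>)
  then show ?thesis by (simp add: emeasure_cube)
qed

lemma nn_integral_lborel_uminus:
  fixes f :: "real^'n \<Rightarrow> ennreal"
  assumes [measurable]: "f \<in> borel_measurable borel"
  shows "(\<integral>\<^sup>+x. f (- x) \<partial>lborel) = (\<integral>\<^sup>+x. f x \<partial>lborel)"
proof -
  have "orthogonal_transformation (uminus :: real^'n \<Rightarrow> _)"
    by (simp add: orthogonal_transformation_def linear_uminus)
  then have "(\<integral>\<^sup>+x. f x \<partial>lborel) = (\<integral>\<^sup>+x. f x \<partial>distr lborel borel uminus)"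
    by (simp add: distr_lborel_orthogonal)
  also have "\<dots> = (\<integral>\<^sup>+x. f (- x) \<partial>lborel)"
    by (subst nn_integral_distr) auto
  finally show ?thesis by simp
qed

text \<open>The closed cube of the distribution of \<open>X\<close> and the half-open cube differ by a null set. Only the
  half-open one is an exact fundamental domain.\<close>

lemma nn_integral_uniform_gaussian:
  fixes X Y :: "'m \<Rightarrow> real^'n" and F :: "(real^'n) \<times> (real^'n) \<Rightarrow> ennreal"
  assumes M: "prob_space M" and ind: "prob_space.indep_var M borel X borel Y"
    and X: "uniform_on_cube M X" and Y: "standard_gaussian M Y"
    and F [measurable]: "F \<in> borel_measurable (borel \<Otimes>\<^sub>M borel)"
  shows "(\<integral>\<^sup>+\<omega>. F (X \<omega>, Y \<omega>) \<partial>M) = (\<integral>\<^sup>+y. ennreal (gauss y) * (\<integral>\<^sup>+x\<in>half_open_cube. F (x, y) \<partial>lborel) \<partial>lborel)"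
proof -
  interpret prob_space M by fact
  have rv [measurable]: "X \<in> borel_measurable M" "Y \<in> borel_measurable M"
    and joint: "distr M borel X \<Otimes>\<^sub>M distr M borel Y = distr M (borel \<Otimes>\<^sub>M borel) (\<lambda>x. (X x, Y x))"
    using ind unfolding indep_var_distribution_eq by auto
  have dl: "distr M lborel Z = distr M borel Z" for Z :: "'m \<Rightarrow> real^'n"
    by (rule distr_cong) auto
  have "x / 1 = x" for x :: ennreal by (simp add: divide_ennreal_def)
  then have dX: "distr M borel X = density lborel (\<lambda>x. indicator cube x)"
    using X by (simp add: uniform_on_cube_def distributed_def dl emeasure_cube)
  have dY: "distr M borel Y = density lborel (\<lambda>y. ennreal (gauss y))"
    using Y by (simp add: standard_gaussian_def distributed_def dl gauss_def[abs_def])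
  interpret PX: prob_space "distr M borel X" by (rule prob_space_distr) simp
  interpret PY: prob_space "distr M borel Y" by (rule prob_space_distr) simp
  interpret P: pair_prob_space "distr M borel X" "distr M borel Y" ..
  have cube [measurable]: "cube \<in> sets borel" unfolding cube_def by measurable
  have "(\<integral>\<^sup>+\<omega>. F (X \<omega>, Y \<omega>) \<partial>M) = (\<integral>\<^sup>+p. F p \<partial>distr M (borel \<Otimes>\<^sub>M borel) (\<lambda>x. (X x, Y x)))"
    by (subst nn_integral_distr) auto
  also have "\<dots> = (\<integral>\<^sup>+y. (\<integral>\<^sup>+x. F (x, y) \<partial>distr M borel X) \<partial>distr M borel Y)"
    unfolding joint[symmetric] by (subst P.nn_integral_snd[symmetric]) auto
  also have "\<dots> = (\<integral>\<^sup>+y. ennreal (gauss y) * (\<integral>\<^sup>+x. F (x, y) \<partial>distr M borel X) \<partial>lborel)"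
    unfolding dY by (subst nn_integral_density) auto
  also have "\<dots> = (\<integral>\<^sup>+y. ennreal (gauss y) * (\<integral>\<^sup>+x\<in>half_open_cube. F (x, y) \<partial>lborel) \<partial>lborel)"
  proof (rule nn_integral_cong)
    fix y
    have "(\<integral>\<^sup>+x. F (x, y) \<partial>distr M borel X) = (\<integral>\<^sup>+x. indicator cube x * F (x, y) \<partial>lborel)"
      unfolding dX by (subst nn_integral_density) auto
    also have "\<dots> = (\<integral>\<^sup>+x\<in>half_open_cube. F (x, y) \<partial>lborel)"
      by (rule nn_integral_cong_AE) (use AE_cube_half_open in eventually_elim, auto simp: indicator_def)
    finally show "ennreal (gauss y) * (\<integral>\<^sup>+x. F (x, y) \<partial>distr M borel X) = ennreal (gauss y) * (\<integral>\<^sup>+x\<in>half_open_cube. F (x, y) \<partial>lborel)"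
      by simp
  qed
  finally show ?thesis .
qed

context antiperiodic_pair
begin

lemma change_volume_measurable [measurable (raw)]:
  assumes [measurable]: "f \<in> borel_measurable M"
  shows "(\<lambda>w. change_volume (f w)) \<in> borel_measurable M"
proof -
  have "change_volume \<in> borel_measurable borel"
    unfolding change_volume_def by measurable
  from measurable_compose[OF assms this] show ?thesis .
qed

definition change_prob :: "real \<Rightarrow> ennreal" where
  "change_prob \<epsilon> = (\<integral>\<^sup>+y. ennreal (gauss y) * change_volume (\<epsilon> *\<^sub>R y) \<partial>lborel)"

lemma AE_decided: "AE x in lborel. x + z \<in> Inn \<or> x + z \<in> Out"
proof -
  have [measurable]: "Measurable.pred lborel (\<lambda>x. \<not> (x + z \<in> Inn \<or> x + z \<in> Out))" by measurable
  have "(\<integral>\<^sup>+x. indicator (- (Inn \<union> Out)) (z + x) \<partial>lborel) = (\<integral>\<^sup>+x. indicator (- (Inn \<union> Out)) x \<partial>lborel)"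
    by (rule nn_integral_lborel_translate) measurable
  also have "\<dots> = 0" using null_rest by auto
  finally have "AE x in lborel. indicator (- (Inn \<union> Out)) (z + x) = (0::ennreal)"
    by (subst (asm) nn_integral_0_iff_AE) measurable
  then show ?thesis by eventually_elim (auto simp: indicator_def add.commute split: if_splits)
qed

text \<open>Almost surely both \<open>X\<close> and \<open>X + \<epsilon> Y\<close> belong to one of the two open sets. The three possibilities to
  stay in one set, to stay in the other one, and to change have total probability one, and the first
  two are equally likely because the joint law is invariant under reflection.\<close>

lemma stay_prob_change_prob:
  fixes X Y :: "'m \<Rightarrow> real^'n"
  assumes M: "prob_space M" and ind: "prob_space.indep_var M borel X borel Y"
    and X: "uniform_on_cube M X" and Y: "standard_gaussian M Y"
    and \<Omega>: "Inn \<subseteq> \<Omega>" "\<Omega> \<inter> Out = {}"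
  shows "2 * ennreal (stay_prob M X Y \<epsilon> \<Omega>) + change_prob \<epsilon> = 1"
proof -
  interpret prob_space M by fact
  have rv [measurable]: "X \<in> borel_measurable M" "Y \<in> borel_measurable M"
    using ind unfolding indep_var_distribution_eq by auto
  note joint = nn_integral_uniform_gaussian[OF M ind X Y]
  define Q where "Q A = {\<omega> \<in> space M. X \<omega> \<in> A \<and> X \<omega> + \<epsilon> *\<^sub>R Y \<omega> \<in> A}" for A :: "(real^'n) set"
  define K where "K A y = (\<integral>\<^sup>+x\<in>half_open_cube. indicator {x. x \<in> A \<and> x + \<epsilon> *\<^sub>R y \<in> A} x \<partial>lborel)"
    for A and y :: "real^'n"
  have Km: "K A \<in> borel_measurable borel" if [measurable]: "A \<in> sets borel" for A
    unfolding K_def by measurable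
  note [measurable] = Km[OF Inn_borel] Km[OF Out_borel]
  define J where "J A = (\<integral>\<^sup>+y. ennreal (gauss y) * K A y \<partial>lborel)" for A
  have QJ: "emeasure M (Q A) = J A" if [measurable]: "A \<in> sets borel" for A
  proof -
    have [measurable]: "Q A \<in> sets M" unfolding Q_def by measurable
    have "emeasure M (Q A) = (\<integral>\<^sup>+\<omega>. indicator {p. fst p \<in> A \<and> fst p + \<epsilon> *\<^sub>R snd p \<in> A} (X \<omega>, Y \<omega>) \<partial>M)"
      unfolding nn_integral_indicator[OF \<open>Q A \<in> sets M\<close>, symmetric]
      by (intro nn_integral_cong) (auto simp: Q_def indicator_def)
    also have "\<dots> = J A" unfolding J_def K_def
      by (subst joint) (auto simp: indicator_def cong: nn_integral_cong)
    finally show ?thesis .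
  qed
  have eqJ: "J Out = J Inn"
  proof -
    have "K Out (- y) = K Inn y" for y
    proof -
      let ?f = "\<lambda>x. indicator {x. x \<in> Out \<and> x + \<epsilon> *\<^sub>R (- y) \<in> Out} x * indicator cube x :: ennreal"
      have "K Out (- y) = (\<integral>\<^sup>+x. ?f x \<partial>lborel)"
        unfolding K_def
        by (rule nn_integral_cong_AE) (use AE_cube_half_open in eventually_elim, auto simp: indicator_def)
      also have "\<dots> = (\<integral>\<^sup>+x. ?f (- x) \<partial>lborel)"
      proof (rule nn_integral_lborel_uminus[symmetric])
        have [measurable]: "cube \<in> sets (borel :: (real^'n) measure)" unfolding cube_def by measurable
        show "?f \<in> borel_measurable borel" by measurable
      qed
      also have "\<dots> = (\<integral>\<^sup>+x\<in>cube. indicator {x. x \<in> Inn \<and> x + \<epsilon> *\<^sub>R y \<in> Inn} x \<partial>lborel)"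
      proof (rule nn_integral_cong)
        fix x :: "real^'n"
        have "- x + \<epsilon> *\<^sub>R (- y) = - (x + \<epsilon> *\<^sub>R y)" by simp
        then have "- x + \<epsilon> *\<^sub>R (- y) \<in> Out \<longleftrightarrow> x + \<epsilon> *\<^sub>R y \<in> Inn" by (simp only: reflect)
        moreover have "- x \<in> cube \<longleftrightarrow> x \<in> cube"
          unfolding cube_def by (auto simp: minus_le_iff)
        ultimately show "?f (- x) = indicator {x. x \<in> Inn \<and> x + \<epsilon> *\<^sub>R y \<in> Inn} x * indicator cube x"
          unfolding indicator_def mem_Collect_eq by (simp only: reflect)
      qed
      also have "\<dots> = K Inn y"
        unfolding K_def
        by (rule nn_integral_cong_AE) (use AE_cube_half_open in eventually_elim, auto simp: indicator_def)
      finally show ?thesis .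
    qed
    then have "J Inn = (\<integral>\<^sup>+y. ennreal (gauss (- y)) * K Out (- y) \<partial>lborel)"
      by (simp add: J_def gauss_radial)
    also have "\<dots> = J Out"
      unfolding J_def by (rule nn_integral_lborel_uminus) measurable
    finally have "J Out = J Inn" by simp
    then show ?thesis .
  qed
  have total: "J Inn + J Out + change_prob \<epsilon> = 1"
  proof -
    have "J Inn + J Out + change_prob \<epsilon> =
        (\<integral>\<^sup>+y. ennreal (gauss y) * K Inn y + ennreal (gauss y) * K Out y + ennreal (gauss y) * change_volume (\<epsilon> *\<^sub>R y) \<partial>lborel)"
    proof -
      have m: "(\<lambda>y. ennreal (gauss y) * K Inn y) \<in> borel_measurable lborel"
        "(\<lambda>y. ennreal (gauss y) * K Out y) \<in> borel_measurable lborel"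
        "(\<lambda>y. ennreal (gauss y) * change_volume (\<epsilon> *\<^sub>R y)) \<in> borel_measurable lborel"
        by measurable
      show ?thesis
        unfolding nn_integral_add[OF borel_measurable_add[OF m(1,2)] m(3)] nn_integral_add[OF m(1,2)]
        unfolding J_def change_prob_def ..
    qed
    also have "\<dots> = (\<integral>\<^sup>+y. ennreal (gauss (y :: real^'n)) \<partial>lborel)"
    proof (rule nn_integral_cong)
      fix y :: "real^'n"
      have "K Inn y + K Out y + change_volume (\<epsilon> *\<^sub>R y) =
        (\<integral>\<^sup>+x. indicator {x. x \<in> Inn \<and> x + \<epsilon> *\<^sub>R y \<in> Inn} x * indicator half_open_cube x +
          indicator {x. x \<in> Out \<and> x + \<epsilon> *\<^sub>R y \<in> Out} x * indicator half_open_cube x +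
          indicator {x. changes (\<epsilon> *\<^sub>R y) x} x * indicator half_open_cube x \<partial>lborel)"
      proof -
        have m: "(\<lambda>x. indicator {x. x \<in> Inn \<and> x + \<epsilon> *\<^sub>R y \<in> Inn} x * indicator half_open_cube x :: ennreal) \<in> borel_measurable lborel"
          "(\<lambda>x. indicator {x. x \<in> Out \<and> x + \<epsilon> *\<^sub>R y \<in> Out} x * indicator half_open_cube x :: ennreal) \<in> borel_measurable lborel"
          "(\<lambda>x. indicator {x. changes (\<epsilon> *\<^sub>R y) x} x * indicator half_open_cube x :: ennreal) \<in> borel_measurable lborel"
          by measurable
        show ?thesis
          unfolding nn_integral_add[OF borel_measurable_add[OF m(1,2)] m(3)] nn_integral_add[OF m(1,2)]
          unfolding change_volume_def K_def ..
      qed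
      also have "\<dots> = (\<integral>\<^sup>+x. indicator (half_open_cube :: (real^'n) set) x \<partial>lborel)"
      proof (rule nn_integral_cong_AE)
        show "AE x in lborel. indicator {x. x \<in> Inn \<and> x + \<epsilon> *\<^sub>R y \<in> Inn} x * indicator half_open_cube x +
          indicator {x. x \<in> Out \<and> x + \<epsilon> *\<^sub>R y \<in> Out} x * indicator half_open_cube x +
          indicator {x. changes (\<epsilon> *\<^sub>R y) x} x * indicator half_open_cube x = (indicator half_open_cube x :: ennreal)"
          using AE_decided[of 0] AE_decided[of "\<epsilon> *\<^sub>R y"]
        proof eventually_elim
          case (elim x)
          then show ?case using disjoint by (auto simp: indicator_def changes_def)
        qed
      qed
      also have "\<dots> = 1" using emeasure_half_open_cube[where 'n = 'n] by simp
      finally have "K Inn y + K Out y + change_volume (\<epsilon> *\<^sub>R y) = 1" .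
      then show "ennreal (gauss y) * K Inn y + ennreal (gauss y) * K Out y + ennreal (gauss y) * change_volume (\<epsilon> *\<^sub>R y)
        = ennreal (gauss y)"
        by (simp add: distrib_left[symmetric])
    qed
    also have "\<dots> = 1" by (rule nn_integral_gauss)
    finally show ?thesis .
  qed
  have AE2: "AE \<omega> in M. (X \<omega> \<in> Inn \<or> X \<omega> \<in> Out) \<and> (X \<omega> + \<epsilon> *\<^sub>R Y \<omega> \<in> Inn \<or> X \<omega> + \<epsilon> *\<^sub>R Y \<omega> \<in> Out)"
  proof -
    define Bad where "Bad = {p :: (real^'n) \<times> (real^'n). \<not> ((fst p \<in> Inn \<or> fst p \<in> Out) \<and> (fst p + \<epsilon> *\<^sub>R snd p \<in> Inn \<or> fst p + \<epsilon> *\<^sub>R snd p \<in> Out))}"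
    have "{p \<in> space (borel \<Otimes>\<^sub>M borel). p \<in> Bad} \<in> sets (borel \<Otimes>\<^sub>M borel)"
      unfolding Bad_def mem_Collect_eq by measurable
    then have [measurable]: "Bad \<in> sets (borel \<Otimes>\<^sub>M borel)" by (simp add: space_pair_measure)
    have "(\<integral>\<^sup>+\<omega>. indicator Bad (X \<omega>, Y \<omega>) \<partial>M) = (\<integral>\<^sup>+y. ennreal (gauss y) * (\<integral>\<^sup>+x\<in>half_open_cube. indicator Bad (x, y) \<partial>lborel) \<partial>lborel)"
      by (rule joint) measurable
    also have "\<dots> = (\<integral>\<^sup>+y. 0 \<partial>(lborel :: (real^'n) measure))"
    proof (rule nn_integral_cong)
      fix y :: "real^'n"
      have "AE x in lborel. indicator Bad (x, y) * indicator half_open_cube x = (0::ennreal)"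
        using AE_decided[of 0] AE_decided[of "\<epsilon> *\<^sub>R y"]
        by eventually_elim (auto simp: Bad_def)
      then have "(\<integral>\<^sup>+x\<in>half_open_cube. indicator Bad (x, y) \<partial>lborel) = (\<integral>\<^sup>+x. 0 \<partial>(lborel :: (real^'n) measure))"
        by (rule nn_integral_cong_AE)
      then show "ennreal (gauss y) * (\<integral>\<^sup>+x\<in>half_open_cube. indicator Bad (x, y) \<partial>lborel) = 0" by simp
    qed
    finally have z: "(\<integral>\<^sup>+\<omega>. indicator Bad (X \<omega>, Y \<omega>) \<partial>M) = 0" by simp
    have "(\<lambda>\<omega>. indicator Bad (X \<omega>, Y \<omega>) :: ennreal) \<in> borel_measurable M" by measurable
    from nn_integral_0_iff_AE[OF this] z have "AE \<omega> in M. indicator Bad (X \<omega>, Y \<omega>) = (0::ennreal)" by simp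
    then show ?thesis by eventually_elim (auto simp: Bad_def indicator_def split: if_splits)
  qed
  have Qm [measurable]: "Q Inn \<in> sets M" unfolding Q_def by measurable
  have AEQ: "AE \<omega> in completion M. \<omega> \<in> Q Inn \<longleftrightarrow> \<omega> \<in> Q \<Omega>"
    using AE_completion[OF AE2]
  proof eventually_elim
    case (elim \<omega>)
    then show ?case using \<Omega> by (auto simp: Q_def)
  qed
  have Q\<Omega>: "Q \<Omega> \<in> sets (completion M)"
    by (rule completion.in_sets_AE[OF AEQ]) (auto simp: Q_def)
  have "stay_prob M X Y \<epsilon> \<Omega> = measure (completion M) (Q \<Omega>)"
    by (simp add: stay_prob_def Q_def)
  also have "\<dots> = measure (completion M) (Q Inn)"
    using AEQ Q\<Omega> by (intro measure_eq_AE) auto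
  also have "\<dots> = measure M (Q Inn)" by simp
  finally have "ennreal (stay_prob M X Y \<epsilon> \<Omega>) = J Inn"
    using QJ[OF Inn_borel] by (simp add: emeasure_eq_measure)
  then show ?thesis using total eqJ by (simp add: mult_2)
qed

end

section \<open>Periodic half spaces\<close>

lemma sin_pi_floor: "sin (pi * u) = cos (pi * of_int \<lfloor>u\<rfloor>) * sin (pi * frac u)"
proof -
  have "pi * u = pi * frac u + pi * of_int \<lfloor>u\<rfloor>"
    by (simp add: frac_def algebra_simps)
  moreover have "sin (pi * of_int \<lfloor>u\<rfloor>) = 0" by (simp add: mult.commute)
  ultimately show ?thesis by (simp add: sin_add)
qed

lemma sin_pi_sign_change:
  assumes "sin (pi * u) * sin (pi * v) < 0"
  shows "1 \<le> \<bar>real_of_int \<lfloor>v\<rfloor> - real_of_int \<lfloor>u\<rfloor>\<bar>"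
proof -
  have "\<lfloor>v\<rfloor> \<noteq> \<lfloor>u\<rfloor>"
  proof
    assume eq: "\<lfloor>v\<rfloor> = \<lfloor>u\<rfloor>"
    have s: "0 \<le> sin (pi * frac w)" for w
      by (rule sin_ge_zero) (use frac_lt_1[of w] in auto)
    have "sin (pi * u) * sin (pi * v) = (cos (pi * of_int \<lfloor>u\<rfloor>))\<^sup>2 * (sin (pi * frac u) * sin (pi * frac v))"
      using sin_pi_floor[of u] sin_pi_floor[of v] by (simp add: eq power2_eq_square)
    also have "\<dots> \<ge> 0" using s by simp
    finally show False using assms by simp
  qed
  then have "1 \<le> \<bar>\<lfloor>v\<rfloor> - \<lfloor>u\<rfloor>\<bar>" by linarith
  then have "real_of_int 1 \<le> real_of_int \<bar>\<lfloor>v\<rfloor> - \<lfloor>u\<rfloor>\<bar>" by (simp only: of_int_le_iff)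
  then show ?thesis by simp
qed

definition half_space_interior :: "real^'n \<Rightarrow> (real^'n) set" where
  "half_space_interior s = {x. sin (pi * (s \<bullet> x)) > 0}"

definition half_space_exterior :: "real^'n \<Rightarrow> (real^'n) set" where
  "half_space_exterior s = {x. sin (pi * (s \<bullet> x)) < 0}"

context
  fixes s :: "real^'n"
  assumes s: "\<And>i. s $ i \<in> {-1, 1}"
begin

lemma antiperiodic_pair_half_space: "antiperiodic_pair (half_space_interior s) (half_space_exterior s)"
proof
  have c: "continuous_on UNIV (\<lambda>x. sin (pi * (s \<bullet> x)))" by (intro continuous_intros)
  show "open (half_space_interior s)"
    unfolding half_space_interior_def by (intro open_Collect_less c continuous_intros)
  show "open (half_space_exterior s)"
    unfolding half_space_exterior_def by (intro open_Collect_less c continuous_intros)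
  show "half_space_interior s \<inter> half_space_exterior s = {}"
    by (auto simp: half_space_interior_def half_space_exterior_def)
  show "- (half_space_interior s \<union> half_space_exterior s) \<in> null_sets lborel"
  proof -
    have s0: "s \<noteq> 0" using s[of undefined] by auto
    have eq: "- (half_space_interior s \<union> half_space_exterior s) = (\<Union>k::int. {x. s \<bullet> x = of_int k})"
      by (auto simp: half_space_interior_def half_space_exterior_def not_less order_eq_iff[of "sin _" 0, symmetric]
          sin_zero_iff_int2 intro: antisym)
        (auto simp: sin_zero_iff_int2 mult.commute dest!: antisym)
    have "{x. s \<bullet> x = of_int k} \<in> null_sets lborel" for k :: int
    proof -
      have "{x. s \<bullet> x = of_int k} \<in> null_sets lebesgue"
        using negligible_hyperplane[of s "of_int k"] s0 by (simp add: negligible_iff_null_sets)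
      moreover have "{x. s \<bullet> x = of_int k} \<in> sets borel" by measurable
      ultimately show ?thesis by (simp add: null_sets_completion_iff)
    qed
    then show ?thesis unfolding eq by (intro null_sets_UN) auto
  qed
  have shift: "sin (pi * (s \<bullet> (x + axis i 1))) = - sin (pi * (s \<bullet> x))" for x i
    using s[of i] by (auto simp: inner_add_right inner_axis distrib_left sin_add right_diff_distrib sin_diff)
  show "x + axis i 1 \<in> half_space_interior s \<longleftrightarrow> x \<in> half_space_exterior s" for x i
    by (simp add: half_space_interior_def half_space_exterior_def shift)
  show "x + axis i 1 \<in> half_space_exterior s \<longleftrightarrow> x \<in> half_space_interior s" for x i
    by (simp add: half_space_interior_def half_space_exterior_def shift)
  show "- x \<in> half_space_exterior s \<longleftrightarrow> x \<in> half_space_interior s" for x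
    by (simp add: half_space_interior_def half_space_exterior_def)
qed

interpretation H: antiperiodic_pair "half_space_interior s" "half_space_exterior s"
  by (rule antiperiodic_pair_half_space)

text \<open>The number of integers between \<open>s \<bullet> x\<close> and \<open>s \<bullet> (x + z)\<close> bounds the indicator of a change. Up to the
  sign of \<open>s \<bullet> z\<close> it equals \<open>\<bar>s \<bullet> z\<bar>\<close> plus a difference of fractional parts at \<open>x\<close> and \<open>x + z\<close>. As a
  function of \<open>x\<close> the fractional part is periodic under the lattice, so the two fractional parts have
  the same integral.\<close>

lemma half_space_change_volume: "H.change_volume z \<le> ennreal \<bar>s \<bullet> z\<bar>"
proof -
  let ?fr = "\<lambda>x. ennreal (frac (s \<bullet> x))"
  have frm [measurable]: "(\<lambda>x::real. frac x) \<in> borel_measurable borel" unfolding frac_def by measurable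
  have per: "?fr (x + axis i 1) = ?fr x" for x i
    using s[of i] frac_1_eq[of "s \<bullet> x"] frac_1_eq[of "s \<bullet> x - 1"]
    by (auto simp: inner_add_right inner_axis)
  have shift: "(\<integral>\<^sup>+x\<in>half_open_cube. ?fr (x + z) \<partial>lborel) = (\<integral>\<^sup>+x\<in>half_open_cube. ?fr x \<partial>lborel)"
    by (rule periodic_nn_integral_shift[OF _ per]) measurable
  have "(\<integral>\<^sup>+x\<in>half_open_cube. ?fr x \<partial>lborel) \<le> (\<integral>\<^sup>+x. indicator half_open_cube x \<partial>(lborel :: (real^'n) measure))"
    by (intro nn_integral_mono) (auto simp: indicator_def less_imp_le[OF frac_lt_1])
  also have "\<dots> = 1" using emeasure_half_open_cube[where 'n = 'n] by simp
  finally have fin: "(\<integral>\<^sup>+x\<in>half_open_cube. ?fr x \<partial>lborel) \<noteq> \<infinity>" by (auto simp: top_unique)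
  have floor: "1 \<le> \<bar>real_of_int \<lfloor>s \<bullet> (x + z)\<rfloor> - real_of_int \<lfloor>s \<bullet> x\<rfloor>\<bar>" if "H.changes z x" for x
    using that unfolding H.changes_def
    by (intro sin_pi_sign_change) (auto simp: half_space_interior_def half_space_exterior_def mult_less_0_iff)
  have sz: "s \<bullet> (x + z) = s \<bullet> x + s \<bullet> z" for x by (rule inner_add_right)
  have m: "(\<lambda>x. indicator {x. H.changes z x} x * indicator half_open_cube x :: ennreal) \<in> borel_measurable lborel"
    "(\<lambda>x. ?fr x * indicator half_open_cube x) \<in> borel_measurable lborel"
    "(\<lambda>x. ?fr (x + z) * indicator half_open_cube x) \<in> borel_measurable lborel"
    "(\<lambda>x. ennreal \<bar>s \<bullet> z\<bar> * indicator half_open_cube x) \<in> borel_measurable (lborel :: (real^'n) measure)"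
    by measurable
  have const: "(\<integral>\<^sup>+x. ennreal \<bar>s \<bullet> z\<bar> * indicator half_open_cube x \<partial>(lborel :: (real^'n) measure)) = ennreal \<bar>s \<bullet> z\<bar>"
    using emeasure_half_open_cube[where 'n = 'n] by (subst nn_integral_cmult_indicator) auto
  note sum2 = nn_integral_add[OF m(4,2), unfolded const, symmetric]
    and sum3 = nn_integral_add[OF m(4,3), unfolded const, symmetric]
  show ?thesis
  proof (cases "s \<bullet> z \<ge> 0")
    case True
    have "H.change_volume z + (\<integral>\<^sup>+x\<in>half_open_cube. ?fr (x + z) \<partial>lborel)
      \<le> ennreal \<bar>s \<bullet> z\<bar> + (\<integral>\<^sup>+x\<in>half_open_cube. ?fr x \<partial>lborel)"
      unfolding H.change_volume_def nn_integral_add[OF m(1,3), symmetric] sum2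
    proof (rule nn_integral_mono)
      fix x :: "real^'n"
      have mono: "\<lfloor>s \<bullet> x\<rfloor> \<le> \<lfloor>s \<bullet> (x + z)\<rfloor>" using True by (intro floor_mono) (simp add: sz)
      have "indicator {x. H.changes z x} x + frac (s \<bullet> (x + z)) \<le> \<bar>s \<bullet> z\<bar> + frac (s \<bullet> x)"
        using floor[of x] mono True by (auto simp: frac_def sz indicator_def)
      then have "ennreal (indicator {x. H.changes z x} x + frac (s \<bullet> (x + z))) \<le> ennreal (\<bar>s \<bullet> z\<bar> + frac (s \<bullet> x))"
        by (rule ennreal_leI)
      then show "indicator {x. H.changes z x} x * indicator half_open_cube x + ?fr (x + z) * indicator half_open_cube x
        \<le> ennreal \<bar>s \<bullet> z\<bar> * indicator half_open_cube x + ?fr x * indicator half_open_cube x"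
        by (auto simp: indicator_def ennreal_plus)
    qed
    then show ?thesis using fin shift by (simp add: add.commute[of _ "\<integral>\<^sup>+x\<in>half_open_cube. ?fr x \<partial>lborel"])
  next
    case False
    have "H.change_volume z + (\<integral>\<^sup>+x\<in>half_open_cube. ?fr x \<partial>lborel)
      \<le> ennreal \<bar>s \<bullet> z\<bar> + (\<integral>\<^sup>+x\<in>half_open_cube. ?fr (x + z) \<partial>lborel)"
      unfolding H.change_volume_def nn_integral_add[OF m(1,2), symmetric] sum3
    proof (rule nn_integral_mono)
      fix x :: "real^'n"
      have mono: "\<lfloor>s \<bullet> (x + z)\<rfloor> \<le> \<lfloor>s \<bullet> x\<rfloor>" using False by (intro floor_mono) (simp add: sz)
      have "indicator {x. H.changes z x} x + frac (s \<bullet> x) \<le> \<bar>s \<bullet> z\<bar> + frac (s \<bullet> (x + z))"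
        using floor[of x] mono False by (auto simp: frac_def sz indicator_def)
      then have "ennreal (indicator {x. H.changes z x} x + frac (s \<bullet> x)) \<le> ennreal (\<bar>s \<bullet> z\<bar> + frac (s \<bullet> (x + z)))"
        by (rule ennreal_leI)
      then show "indicator {x. H.changes z x} x * indicator half_open_cube x + ?fr x * indicator half_open_cube x
        \<le> ennreal \<bar>s \<bullet> z\<bar> * indicator half_open_cube x + ?fr (x + z) * indicator half_open_cube x"
        by (auto simp: indicator_def ennreal_plus)
    qed
    then show ?thesis using fin shift by (simp add: add.commute[of _ "\<integral>\<^sup>+x\<in>half_open_cube. ?fr x \<partial>lborel"])
  qed
qed

lemma half_space_change_prob:
  assumes "\<epsilon> > 0"
  shows "H.change_prob \<epsilon> \<le> ennreal (\<epsilon> * (sqrt (2 / pi) * sqrt (real CARD('n))))"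
proof -
  have sq: "(s $ i)\<^sup>2 = 1" for i using s[of i] by auto
  have norm_s: "norm s = sqrt (real CARD('n))"
    by (simp add: norm_eq_sqrt_inner inner_vec_def power2_eq_square[symmetric] sq)
  have "H.change_prob \<epsilon> \<le> (\<integral>\<^sup>+y. ennreal (gauss y) * ennreal \<bar>s \<bullet> (\<epsilon> *\<^sub>R y)\<bar> \<partial>lborel)"
    unfolding H.change_prob_def by (intro nn_integral_mono mult_left_mono half_space_change_volume) simp
  also have "\<dots> = (\<integral>\<^sup>+y. ennreal \<epsilon> * (ennreal (gauss y) * ennreal \<bar>s \<bullet> y\<bar>) \<partial>lborel)"
    using assms by (intro nn_integral_cong) (simp add: abs_mult ennreal_mult mult.left_commute)
  also have "\<dots> = ennreal \<epsilon> * ennreal (sqrt (2 / pi) * norm s)"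
    by (subst nn_integral_cmult) (auto simp: gauss_abs_inner)
  also have "\<dots> = ennreal (\<epsilon> * (sqrt (2 / pi) * sqrt (real CARD('n))))"
    using assms by (simp add: ennreal_mult norm_s)
  finally show ?thesis .
qed

end

text \<open>This holds for every positive \<open>\<epsilon>\<close> and every half space with the same bound, so the half spaces contribute
  nothing to the error term of the comparison.\<close>

lemma stay_prob_half_space:
  fixes B :: "(real^'n) set" and X Y :: "'m \<Rightarrow> real^'n"
  assumes B: "periodic_half_space B" and \<epsilon>: "\<epsilon> > 0"
    and M: "prob_space M" and ind: "prob_space.indep_var M borel X borel Y"
    and X: "uniform_on_cube M X" and Y: "standard_gaussian M Y"
  shows "1 - \<epsilon> * (sqrt (2 / pi) * sqrt (real CARD('n))) \<le> 2 * stay_prob M X Y \<epsilon> B"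
proof -
  obtain t :: "'n \<Rightarrow> real" where t: "\<forall>i. t i \<in> {-1, 1}" "B = {x. sin (pi * (\<Sum>i\<in>UNIV. t i * x $ i)) \<ge> 0}"
    using B unfolding periodic_half_space_def by blast
  define s where "s = (\<chi> i. t i)"
  have s: "s $ i \<in> {-1, 1}" for i using t by (simp add: s_def)
  have B_eq: "B = {x. sin (pi * (s \<bullet> x)) \<ge> 0}" by (simp add: t s_def inner_vec_def)
  interpret antiperiodic_pair "half_space_interior s" "half_space_exterior s"
    by (rule antiperiodic_pair_half_space[OF s])
  have sub: "half_space_interior s \<subseteq> B" "B \<inter> half_space_exterior s = {}"
    by (auto simp: B_eq half_space_interior_def half_space_exterior_def)
  have "2 * ennreal (stay_prob M X Y \<epsilon> B) + change_prob \<epsilon> = 1"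
    by (rule stay_prob_change_prob[OF M ind X Y sub])
  moreover have "change_prob \<epsilon> \<le> ennreal (\<epsilon> * (sqrt (2 / pi) * sqrt (real CARD('n))))"
    by (rule half_space_change_prob[OF s \<epsilon>])
  ultimately have "1 \<le> 2 * ennreal (stay_prob M X Y \<epsilon> B) + ennreal (\<epsilon> * (sqrt (2 / pi) * sqrt (real CARD('n))))"
    by (metis add_left_mono)
  also have "\<dots> = ennreal (2 * stay_prob M X Y \<epsilon> B + \<epsilon> * (sqrt (2 / pi) * sqrt (real CARD('n))))"
    using \<epsilon> by (simp add: stay_prob_def ennreal_mult)
  finally show ?thesis
    by (subst (asm) ennreal_1[symmetric], subst (asm) ennreal_le_iff) (use \<epsilon> in \<open>auto simp: stay_prob_def intro!: add_nonneg_nonneg\<close>)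
qed

section \<open>Lower bound for small noise\<close>

text \<open>All nonzero translates of the union of the sets form a closed set, as the lattice is closed and the
  union compact. It is disjoint from the union because the half-open cube contains only one point of
  each class modulo the lattice.\<close>

lemma separated_lattice_translates:
  fixes K :: "nat \<Rightarrow> (real^'n) set"
  assumes K: "\<And>k. compact (K k)" "\<And>k. K k \<subseteq> half_open_cube"
    and disj: "\<And>k l. k \<noteq> l \<Longrightarrow> K k \<inter> K l = {}"
  obtains \<delta> where "\<delta> > 0"
    "\<And>k l p q m. k < n \<Longrightarrow> l < n \<Longrightarrow> p \<in> K k \<Longrightarrow> q \<in> K l \<Longrightarrow> dist (p + lat m) q < \<delta> \<Longrightarrow> k = l \<and> m = 0"
proof -
  define C where "C = (\<Union>k<n. K k)"
  have C: "compact C" "C \<subseteq> half_open_cube" unfolding C_def using K by (auto intro: compact_UN)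
  define D where "D = range (lat :: int^'n \<Rightarrow> _) - {0}"
  have "closed D"
  proof (rule discrete_imp_closed[of 1])
    show "\<forall>x\<in>D. \<forall>y\<in>D. dist y x < 1 \<longrightarrow> y = x"
    proof (intro ballI impI)
      fix x y assume x: "x \<in> D" and y: "y \<in> D" and d: "dist y x < 1"
      obtain m m' where m: "x = lat m" "y = lat m'" using x y by (auto simp: D_def)
      have "m' $ i = m $ i" for i
      proof -
        have "\<bar>(y - x) $ i\<bar> < 1"
          using component_le_norm_cart[of "y - x" i] d by (simp add: dist_norm)
        then have "\<bar>real_of_int (m' $ i - m $ i)\<bar> < 1" by (simp add: m)
        then have "\<bar>m' $ i - m $ i\<bar> < 1" by linarith
        then show ?thesis by simp
      qed
      then show "y = x" by (simp add: m vec_eq_iff)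
    qed
  qed simp
  then have T: "closed (\<Union>x\<in>D. \<Union>y\<in>C. {x + y})"
    using C(1) by (rule closed_compact_sums)
  have "C \<inter> (\<Union>x\<in>D. \<Union>y\<in>C. {x + y}) = {}" (is "_ \<inter> ?T = _")
  proof -
    have False if q: "q \<in> C" and eq: "q = lat m + p" and p: "p \<in> C" and m: "lat m \<noteq> 0" for q p m
    proof -
      have "p \<in> half_open_cube" "p + lat m \<in> half_open_cube" using q p eq C(2) by (auto simp: add.commute)
      then have "m = 0" by (rule half_open_cube_unique)
      then show False using m by (simp add: lat_def zero_vec_def)
    qed
    then show ?thesis by (auto simp: D_def)
  qed
  then have "\<exists>d>0. \<forall>q\<in>C. \<forall>t\<in>?T. d \<le> dist q t"
    by (rule separate_compact_closed[OF C(1) T])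
  then obtain d0 where d0: "d0 > 0" "\<And>q t. q \<in> C \<Longrightarrow> t \<in> ?T \<Longrightarrow> d0 \<le> dist q t"
    by auto
  have "\<exists>d>0. \<forall>p\<in>K k. \<forall>q\<in>K l. k \<noteq> l \<longrightarrow> d \<le> dist p q" for k l
  proof (cases "k = l")
    case True
    then show ?thesis by (intro exI[of _ 1]) auto
  next
    case False
    have "\<exists>d>0. \<forall>p\<in>K k. \<forall>q\<in>K l. d \<le> dist p q"
      by (rule separate_compact_closed[OF K(1) compact_imp_closed[OF K(1)] disj[OF False]])
    then show ?thesis by auto
  qed
  then obtain d where d: "\<And>k l. d k l > 0" "\<And>k l p q. p \<in> K k \<Longrightarrow> q \<in> K l \<Longrightarrow> k \<noteq> l \<Longrightarrow> d k l \<le> dist p q"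
    by metis
  define \<delta> where "\<delta> = Min (insert d0 ((\<lambda>(k, l). d k l) ` ({..<n} \<times> {..<n})))"
  have fin: "finite (insert d0 ((\<lambda>(k, l). d k l) ` ({..<n} \<times> {..<n})))" by simp
  have le: "\<delta> \<le> d0" "k < n \<Longrightarrow> l < n \<Longrightarrow> \<delta> \<le> d k l" for k l
    unfolding \<delta>_def by (auto intro!: Min_le[OF fin])
  have pos: "\<delta> > 0"
    unfolding \<delta>_def using d0 d by (subst Min_gr_iff[OF fin]) auto
  have "k = l \<and> m = 0" if kl: "k < n" "l < n" and p: "p \<in> K k" and q: "q \<in> K l" and near: "dist (p + lat m) q < \<delta>" for k l p q m
  proof -
    have m: "m = 0"
    proof (rule ccontr)
      assume "m \<noteq> 0"
      then have "lat m \<noteq> 0" by (auto simp: vec_eq_iff)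
      then have "lat m \<in> D" by (simp add: D_def)
      moreover have pq: "p \<in> C" "q \<in> C" using kl p q by (auto simp: C_def)
      ultimately have "lat m + p \<in> ?T" by blast
      then have "d0 \<le> dist q (lat m + p)" using d0 pq by blast
      then show False using near le(1) by (simp add: dist_commute add.commute)
    qed
    moreover have "k = l"
    proof (rule ccontr)
      assume "k \<noteq> l"
      then have "d k l \<le> dist p q" using d p q by blast
      then show False using near le(2)[OF kl] by (simp add: m lat_def zero_vec_def[symmetric])
    qed
    ultimately show ?thesis by simp
  qed
  with pos show ?thesis by (rule that)
qed

lemma sum_liminf_le:
  fixes u :: "nat \<Rightarrow> nat \<Rightarrow> ennreal"
  shows "(\<Sum>k<n. liminf (u k)) \<le> liminf (\<lambda>m. \<Sum>k<n. u k m)"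
proof -
  have "(\<integral>\<^sup>+k. liminf (\<lambda>m. u k m) \<partial>count_space {..<n}) \<le> liminf (\<lambda>m. \<integral>\<^sup>+k. u k m \<partial>count_space {..<n})"
    by (rule nn_integral_liminf) simp
  then show ?thesis by (simp add: nn_integral_count_space_finite)
qed

lemma mult_liminf_le:
  fixes u :: "nat \<Rightarrow> ennreal"
  shows "c * liminf u \<le> liminf (\<lambda>m. c * u m)"
proof -
  have "c * liminf u = (SUP n. c * (INF i\<in>{n..}. u i))"
    unfolding liminf_SUP_INF by (rule SUP_mult_left_ennreal)
  also have "\<dots> \<le> liminf (\<lambda>m. c * u m)"
    unfolding liminf_SUP_INF
    by (intro SUP_mono) (auto intro!: INF_greatest mult_left_mono INF_lower)
  finally show ?thesis .
qed

text \<open>A smooth hypersurface that separates an antiperiodic pair, with the normals pointing to \<open>Out\<close>.\<close>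

locale hypersurface_pair = charted_hypersurface S N ix gx Ux + antiperiodic_pair Inn Out
  for S :: "(real^'n) set" and N ix gx Ux and Inn Out :: "(real^'n) set" +
  assumes S_eq: "S = - (Inn \<union> Out)"
    and side_Out: "\<And>p a. p \<in> S \<Longrightarrow> N p \<bullet> a > 0 \<Longrightarrow> eventually (\<lambda>t. p + t *\<^sub>R a \<in> Out) (at_right 0)"
    and side_Inn: "\<And>p a. p \<in> S \<Longrightarrow> N p \<bullet> a < 0 \<Longrightarrow> eventually (\<lambda>t. p + t *\<^sub>R a \<in> Inn) (at_right 0)"
begin

text \<open>Only those \<open>s\<close> are counted for which the normal components of \<open>s e\<^sub>i\<close> and \<open>s e\<^sub>i + y\<close> are nonzero and
  of opposite sign. They form the open interval between \<open>0\<close> and \<open>- (N p \<bullet> y) / N p $ i\<close>.\<close>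

lemma liminf_changes:
  fixes e :: "nat \<Rightarrow> real"
  assumes e: "\<And>m. e m > 0" "e \<longlonglongrightarrow> 0" and p: "p \<in> S" and V: "open V" "p \<in> V" and i: "N p $ i \<noteq> 0"
  shows "ennreal \<bar>N p \<bullet> y\<bar> * ennreal (1 / \<bar>N p $ i\<bar>) \<le>
    (\<integral>\<^sup>+s. liminf (\<lambda>m. indicator V (p + (e m * s) *\<^sub>R axis i 1) *
      indicator {x. changes (e m *\<^sub>R y) x} (p + (e m * s) *\<^sub>R axis i 1)) \<partial>lborel)"
proof -
  let ?b = "- (N p \<bullet> y) / (N p $ i)"
  have ev: "filterlim e (at_right 0) sequentially"
    using e by (intro tendsto_imp_filterlim_at_right) auto
  have "indicator {min 0 ?b <..< max 0 ?b} s \<le> liminf (\<lambda>m. indicator V (p + (e m * s) *\<^sub>R axis i 1) *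
      indicator {x. changes (e m *\<^sub>R y) x} (p + (e m * s) *\<^sub>R axis i 1) :: ennreal)" for s
  proof (cases "s \<in> {min 0 ?b <..< max 0 ?b}")
    case True
    let ?a = "s *\<^sub>R axis i 1 :: real^'n"
    have Na: "N p \<bullet> ?a = s * N p $ i" by (simp add: inner_axis)
    have "N p \<bullet> ?a < 0 \<and> N p \<bullet> (?a + y) > 0 \<or> N p \<bullet> ?a > 0 \<and> N p \<bullet> (?a + y) < 0"
    proof -
      have "N p \<bullet> (?a + y) = (s - ?b) * N p $ i"
        using i by (simp only: inner_add_right Na) (simp add: field_simps)
      moreover have "s < 0 \<and> s - ?b > 0 \<or> s > 0 \<and> s - ?b < 0" using True by (auto simp: min_def max_def split: if_splits)
      ultimately show ?thesis using i unfolding Na by (auto simp: mult_less_0_iff zero_less_mult_iff)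
    qed
    then have "eventually (\<lambda>t. changes (t *\<^sub>R y) (p + t *\<^sub>R ?a)) (at_right 0)"
    proof (elim disjE conjE)
      assume "N p \<bullet> ?a < 0" "N p \<bullet> (?a + y) > 0"
      from side_Inn[OF p this(1)] side_Out[OF p this(2)] show ?thesis
        by eventually_elim (auto simp: changes_def scaleR_add_right add.assoc)
    next
      assume "N p \<bullet> ?a > 0" "N p \<bullet> (?a + y) < 0"
      from side_Out[OF p this(1)] side_Inn[OF p this(2)] show ?thesis
        by eventually_elim (auto simp: changes_def scaleR_add_right add.assoc)
    qed
    moreover have "eventually (\<lambda>t. p + t *\<^sub>R ?a \<in> V) (at_right 0)"
    proof -
      have "((\<lambda>t. p + t *\<^sub>R ?a) \<longlongrightarrow> p + 0 *\<^sub>R ?a) (at_right (0::real))" by (intro tendsto_intros)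
      then show ?thesis using V by (intro topological_tendstoD[of _ p]) simp_all
    qed
    ultimately have "eventually (\<lambda>t. p + t *\<^sub>R ?a \<in> V \<and> changes (t *\<^sub>R y) (p + t *\<^sub>R ?a)) (at_right 0)"
      by eventually_elim simp
    then have "eventually (\<lambda>m. p + e m *\<^sub>R ?a \<in> V \<and> changes (e m *\<^sub>R y) (p + e m *\<^sub>R ?a)) sequentially"
      by (rule eventually_compose_filterlim[OF _ ev])
    then have "eventually (\<lambda>m. (1::ennreal) \<le> indicator V (p + (e m * s) *\<^sub>R axis i 1) *
      indicator {x. changes (e m *\<^sub>R y) x} (p + (e m * s) *\<^sub>R axis i 1)) sequentially"
      by eventually_elim simp
    from Liminf_bounded[OF this] show ?thesis using True by simp
  qed simp
  then have "(\<integral>\<^sup>+s. indicator {min 0 ?b <..< max 0 ?b} s \<partial>lborel) \<le> (\<integral>\<^sup>+s. liminf (\<lambda>m. indicator V (p + (e m * s) *\<^sub>R axis i 1) *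
      indicator {x. changes (e m *\<^sub>R y) x} (p + (e m * s) *\<^sub>R axis i 1)) \<partial>lborel)"
    by (intro nn_integral_mono)
  moreover have "(\<integral>\<^sup>+s. indicator {min 0 ?b <..< max 0 ?b} s \<partial>lborel) = ennreal \<bar>?b\<bar>"
  proof -
    have "max 0 b - min 0 b = \<bar>b\<bar>" for b :: real by (simp add: min_def max_def)
    then show ?thesis
      by (subst nn_integral_indicator, simp, subst emeasure_lborel_Ioo) (simp_all only: min.cobounded1 max.cobounded1 order_trans[OF min.cobounded1 max.cobounded1])
  qed
  moreover have "ennreal \<bar>?b\<bar> = ennreal \<bar>N p \<bullet> y\<bar> * ennreal (1 / \<bar>N p $ i\<bar>)"
    by (simp add: ennreal_mult'[symmetric])
  ultimately show ?thesis by simp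
qed

text \<open>Disjoint compact parts of the pieces have open neighbourhoods \<open>V k\<close> that stay disjoint modulo the
  lattice. The event of a change may thus be restricted to each \<open>V k\<close> separately, where it is
  integrated in the coordinates \<open>z\<close> on the base and \<open>s\<close> given by \<open>x = p + \<epsilon> s e\<^sub>i\<close> with \<open>p\<close> the graph
  point over \<open>z\<close>. Restricting to the base of the compact part only decreases the integral.\<close>

lemma change_prob_liminf_compact:
  fixes e :: "nat \<Rightarrow> real" and K :: "nat \<Rightarrow> (real^'n) set"
  assumes e: "\<And>m. e m > 0" "e \<longlonglongrightarrow> 0"
    and K: "\<And>k. compact (K k)" "\<And>k. K k \<subseteq> piece k \<inter> half_open_cube"
  shows "(\<Sum>k<n. ennreal (sqrt (2 / pi)) * emeasure \<sigma> (K k)) \<le> liminf (\<lambda>m. change_prob (e m) * ennreal (1 / e m))"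
proof -
  have Kb [measurable]: "K k \<in> sets borel" for k using K(1) by (intro borel_closed compact_imp_closed)
  have Kd: "K k \<inter> K l = {}" if "k \<noteq> l" for k l
    using K(2)[of k] K(2)[of l] disjoint_pieces that unfolding disjoint_family_on_def by blast
  have Kc: "K k \<subseteq> half_open_cube" for k using K(2)[of k] by blast
  obtain \<delta> where \<delta>: "\<delta> > 0"
    "\<And>k l p q m. k < n \<Longrightarrow> l < n \<Longrightarrow> p \<in> K k \<Longrightarrow> q \<in> K l \<Longrightarrow> dist (p + lat m) q < \<delta> \<Longrightarrow> k = l \<and> m = 0"
    using separated_lattice_translates[of K n, OF K(1) Kc Kd] by blast
  define V where "V k = (\<Union>p\<in>K k. ball p (\<delta> / 2))" for k
  have Vo: "open (V k)" for k unfolding V_def by auto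
  have Vb [measurable]: "V k \<in> sets borel" for k using Vo by (rule borel_open)
  have VK: "K k \<subseteq> V k" for k using \<delta>(1) by (auto simp: V_def)
  have pack: "k = l \<and> m = 0" if "k < n" "l < n" "x \<in> V k" "x + lat m \<in> V l" for k l m x
  proof -
    obtain p q where pq: "p \<in> K k" "dist p x < \<delta> / 2" "q \<in> K l" "dist q (x + lat m) < \<delta> / 2"
      using \<open>x \<in> V k\<close> \<open>x + lat m \<in> V l\<close> by (auto simp: V_def)
    have "dist (p + lat m) q \<le> dist (p + lat m) (x + lat m) + dist (x + lat m) q" by (rule dist_triangle)
    also have "\<dots> < \<delta>" using pq by (simp add: dist_commute)
    finally show ?thesis using \<delta>(2) that pq by blast
  qed
  let ?Sh = "\<lambda>k. sheet (ix k) (gx k) (K k)"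
  have KU: "K k \<subseteq> Ux k" "K k \<subseteq> S \<inter> Ux k" for k using K(2)[of k] piece_subset[of k] by auto
  have Shb [measurable]: "?Sh k \<in> sets borel" for k by (rule sheet_borel[OF chart Kb KU(1)])
  \<comment> \<open>a version of the graph point that is measurable on the whole space\<close>
  define gp where "gp k z = (if graph_point (ix k) (gx k) z \<in> Ux k then graph_point (ix k) (gx k) z else 0)" for k z
  have gpm [measurable]: "gp k \<in> borel_measurable borel" for k
    unfolding gp_def using measurable_on_graph[OF chart continuous_on_id] by simp
  have gp_eq: "gp k z = graph_point (ix k) (gx k) z" if "z \<in> ?Sh k" for k z
    using that KU(1)[of k] by (auto simp: gp_def sheet_def)
  \<comment> \<open>the event of a change inside \<open>V k\<close>, in the coordinates \<open>z\<close> and \<open>s\<close>\<close>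
  define \<Phi> where "\<Phi> k m y z s = (indicator (?Sh k) z * (indicator (V k) (gp k z + (e m * s) *\<^sub>R axis (ix k) 1) *
      indicator {x. changes (e m *\<^sub>R y) x} (gp k z + (e m * s) *\<^sub>R axis (ix k) 1)) :: ennreal)"
    for k m and y z :: "real^'n" and s :: real
  let ?W = "\<lambda>k m y z. \<integral>\<^sup>+s. \<Phi> k m y z s \<partial>lborel"
  have \<Phi>_eq: "\<Phi> k m y z s = indicator (?Sh k) z *
      (indicator (V k) (graph_point (ix k) (gx k) z + (e m * s) *\<^sub>R axis (ix k) 1) *
      indicator {x. changes (e m *\<^sub>R y) x} (graph_point (ix k) (gx k) z + (e m * s) *\<^sub>R axis (ix k) 1))" for k m y z s
    using gp_eq[of z k] by (auto simp: \<Phi>_def indicator_def)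
  have \<Phi>m [measurable (raw)]: "(\<lambda>w. \<Phi> k m (a w) (b w) (c w)) \<in> borel_measurable L"
    if [measurable]: "a \<in> borel_measurable L" "b \<in> borel_measurable L" "c \<in> borel_measurable L"
    for k m and a b :: "'l \<Rightarrow> real^'n" and c :: "'l \<Rightarrow> real" and L
    unfolding \<Phi>_def by measurable
  have vol: "(\<Sum>k<n. \<integral>\<^sup>+z. ?W k m y z \<partial>lborel) \<le> change_volume (e m *\<^sub>R y) * ennreal (1 / e m)" for m y
  proof -
    let ?F = "\<lambda>x. indicator {x. changes (e m *\<^sub>R y) x} x :: ennreal"
    have Fm [measurable]: "?F \<in> borel_measurable borel" by measurable
    have one: "ennreal (e m) * (\<integral>\<^sup>+z. ?W k m y z \<partial>lborel) \<le> (\<integral>\<^sup>+x. ?F x * indicator (V k) x \<partial>lborel)" for k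
    proof -
      let ?i = "ix k" and ?g = "gx k"
      have "ennreal (e m) * (\<integral>\<^sup>+z. ?W k m y z \<partial>lborel)
        = (\<integral>\<^sup>+z. ennreal (e m) * ?W k m y z \<partial>lborel)"
        by (rule nn_integral_cmult[symmetric]) measurable
      \<comment> \<open>the substitution \<open>t = g z + \<epsilon> s\<close> on the vertical line through \<open>z\<close> gives the factor \<open>\<epsilon>\<close>\<close>
      also have "\<dots> \<le> (\<integral>\<^sup>+z\<in>slab ?i. (\<integral>\<^sup>+t. ?F (set_coord ?i t z) * indicator (V k) (set_coord ?i t z) \<partial>lborel) \<partial>lborel)"
      proof (rule nn_integral_mono)
        fix z :: "real^'n"
        show "ennreal (e m) * ?W k m y z \<le>
          (\<integral>\<^sup>+t. ?F (set_coord ?i t z) * indicator (V k) (set_coord ?i t z) \<partial>lborel) * indicator (slab ?i) z"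
        proof (cases "z \<in> ?Sh k")
          case True
          have sc: "set_coord ?i (?g z + e m * s) z = graph_point ?i ?g z + (e m * s) *\<^sub>R axis ?i 1" for s
            by (simp add: graph_point_set_coord set_coord_eq algebra_simps)
          have "(\<integral>\<^sup>+t. ?F (set_coord ?i t z) * indicator (V k) (set_coord ?i t z) \<partial>lborel)
            = ennreal \<bar>e m\<bar> * (\<integral>\<^sup>+s. ?F (set_coord ?i (?g z + e m * s) z) * indicator (V k) (set_coord ?i (?g z + e m * s) z) \<partial>lborel)"
            using e(1)[of m] by (intro nn_integral_real_affine) auto
          also have "\<dots> = ennreal (e m) * ?W k m y z"
            using e(1)[of m] True unfolding sc \<Phi>_eq by (simp add: mult.commute)
          finally show ?thesis using True by (simp add: sheet_def)
        next
          case False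
          then show ?thesis by (simp add: \<Phi>_def)
        qed
      qed
      also have "\<dots> = (\<integral>\<^sup>+x. ?F x * indicator (V k) x \<partial>lborel)"
        by (rule nn_integral_slab[symmetric]) measurable
      finally show ?thesis .
    qed
    have "ennreal (e m) * (\<Sum>k<n. \<integral>\<^sup>+z. ?W k m y z \<partial>lborel) \<le> (\<Sum>k<n. \<integral>\<^sup>+x. ?F x * indicator (V k) x \<partial>lborel)"
      unfolding sum_distrib_left by (intro sum_mono one)
    also have "\<dots> = (\<integral>\<^sup>+x. (\<Sum>k<n. ?F x * indicator (V k) x) \<partial>lborel)"
      by (rule nn_integral_sum[symmetric]) measurable
    also have "\<dots> = (\<integral>\<^sup>+x. ?F x * indicator (\<Union>k<n. V k) x \<partial>lborel)"
    proof (intro nn_integral_cong)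
      fix x :: "real^'n"
      have "disjoint_family_on V {..<n}"
        unfolding disjoint_family_on_def using pack[of _ _ _ 0] by (auto simp: lat_def zero_vec_def[symmetric])
      then show "(\<Sum>k<n. ?F x * indicator (V k) x) = ?F x * indicator (\<Union>k<n. V k) x"
        by (simp add: indicator_UN_disjoint sum_distrib_left)
    qed
    also have "\<dots> \<le> change_volume (e m *\<^sub>R y)"
      unfolding change_volume_def
    proof (rule periodic_nn_integral_le)
      show "?F (x + axis i 1) = ?F x" for x i by (simp add: indicator_def changes_periodic)
      show "k = 0" if "x \<in> (\<Union>k<n. V k)" "x + lat k \<in> (\<Union>k<n. V k)" for x k using that pack by blast
    qed (use half_open_cube_covers in auto)
    finally have "ennreal (e m) * (\<Sum>k<n. \<integral>\<^sup>+z. ?W k m y z \<partial>lborel) * ennreal (1 / e m)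
      \<le> change_volume (e m *\<^sub>R y) * ennreal (1 / e m)"
      by (rule mult_right_mono) simp
    moreover have "ennreal (e m) * A * ennreal (1 / e m) = A" for A
    proof -
      have "ennreal (e m) * ennreal (1 / e m) = 1"
        using e(1)[of m] by (simp add: ennreal_mult'[symmetric])
      then show ?thesis by (metis mult.assoc mult.commute mult.left_neutral)
    qed
    ultimately show ?thesis by simp
  qed
  \<comment> \<open>the noise \<open>y\<close> is integrated before the base point \<open>z\<close>, so that the Gaussian mean of
    \<open>\<bar>N p \<bullet> y\<bar>\<close> is taken for one fixed normal at a time\<close>
  define u where "u k m = (\<integral>\<^sup>+z. (\<integral>\<^sup>+y. ennreal (gauss y) * ?W k m y z \<partial>lborel) \<partial>lborel)" for k m
  have prob: "(\<Sum>k<n. u k m) \<le> change_prob (e m) * ennreal (1 / e m)" for m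
  proof -
    have "u k m = (\<integral>\<^sup>+y. ennreal (gauss y) * (\<integral>\<^sup>+z. ?W k m y z \<partial>lborel) \<partial>lborel)" for k
    proof -
      have "u k m = (\<integral>\<^sup>+y. (\<integral>\<^sup>+z. ennreal (gauss y) * ?W k m y z \<partial>lborel) \<partial>lborel)"
        unfolding u_def by (rule lborel_pair.Fubini') measurable
      also have "\<dots> = (\<integral>\<^sup>+y. ennreal (gauss y) * (\<integral>\<^sup>+z. ?W k m y z \<partial>lborel) \<partial>lborel)"
        by (intro nn_integral_cong nn_integral_cmult) measurable
      finally show ?thesis .
    qed
    then have "(\<Sum>k<n. u k m) = (\<integral>\<^sup>+y. (\<Sum>k<n. ennreal (gauss y) * (\<integral>\<^sup>+z. ?W k m y z \<partial>lborel)) \<partial>lborel)"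
      by (simp only:) (rule nn_integral_sum[symmetric], measurable)
    also have "\<dots> \<le> (\<integral>\<^sup>+y. ennreal (gauss y) * change_volume (e m *\<^sub>R y) * ennreal (1 / e m) \<partial>lborel)"
      unfolding sum_distrib_left[symmetric] mult.assoc by (intro nn_integral_mono mult_left_mono vol) simp
    also have "\<dots> = change_prob (e m) * ennreal (1 / e m)"
      unfolding change_prob_def by (rule nn_integral_multc) measurable
    finally show ?thesis .
  qed
  \<comment> \<open>Fatou's lemma for each of the integrals over \<open>z\<close>, \<open>y\<close> and \<open>s\<close>\<close>
  have fatou: "ennreal (sqrt (2 / pi)) * emeasure \<sigma> (K k) \<le> liminf (u k)" for k
  proof -
    have "ennreal (sqrt (2 / pi)) * emeasure \<sigma> (K k) =
      ennreal (sqrt (2 / pi)) * (\<integral>\<^sup>+z. indicator (?Sh k) z * ennreal (area_density (ix k) (gx k) z) \<partial>lborel)"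
      using emeasure_surface_measure[OF chart Kb KU(2)] by (simp add: graph_area_sheet mult.commute)
    also have "\<dots> = (\<integral>\<^sup>+z. ennreal (sqrt (2 / pi)) * (indicator (?Sh k) z * ennreal (area_density (ix k) (gx k) z)) \<partial>lborel)"
      using measurable_area_density[OF chart Kb KU(1)] by (intro nn_integral_cmult[symmetric]) simp
    also have "\<dots> \<le> (\<integral>\<^sup>+z. liminf (\<lambda>m. \<integral>\<^sup>+y. ennreal (gauss y) * ?W k m y z \<partial>lborel) \<partial>lborel)"
    proof (rule nn_integral_mono)
      fix z :: "real^'n"
      show "ennreal (sqrt (2 / pi)) * (indicator (?Sh k) z * ennreal (area_density (ix k) (gx k) z)) \<le>
        liminf (\<lambda>m. \<integral>\<^sup>+y. ennreal (gauss y) * ?W k m y z \<partial>lborel)"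
      proof (cases "z \<in> ?Sh k")
        case True
        define p where "p = graph_point (ix k) (gx k) z"
        have pK: "p \<in> K k" using True by (simp add: p_def sheet_def)
        then have p: "p \<in> S" "p \<in> Ux k" "p \<in> V k" using KU[of k] VK by auto
        have sc: "\<bar>N p $ ix k\<bar> * area_density (ix k) (gx k) z = 1"
          using chart_normal_scale[OF chart normal p(1,2)] by (simp add: area_density_def p_def)
        then have Ni: "N p $ ix k \<noteq> 0" by auto
        then have w: "1 / \<bar>N p $ ix k\<bar> = area_density (ix k) (gx k) z" using sc by (simp add: field_simps)
        have nN: "norm (N p) = 1" using normal p(1) by (simp add: unit_normal_field_def)
        have "ennreal (sqrt (2 / pi)) * ennreal (area_density (ix k) (gx k) z)
          = (\<integral>\<^sup>+y. ennreal (gauss y) * ennreal \<bar>N p \<bullet> y\<bar> \<partial>lborel) * ennreal (1 / \<bar>N p $ ix k\<bar>)"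
          by (simp add: gauss_abs_inner nN w)
        also have "\<dots> = (\<integral>\<^sup>+y. ennreal (gauss y) * (ennreal \<bar>N p \<bullet> y\<bar> * ennreal (1 / \<bar>N p $ ix k\<bar>)) \<partial>lborel)"
          unfolding mult.assoc[symmetric] by (rule nn_integral_multc[symmetric]) measurable
        also have "\<dots> \<le> (\<integral>\<^sup>+y. ennreal (gauss y) * (\<integral>\<^sup>+s. liminf (\<lambda>m. \<Phi> k m y z s) \<partial>lborel) \<partial>lborel)"
        proof (intro nn_integral_mono mult_left_mono)
          fix y :: "real^'n"
          have "(\<lambda>m. \<Phi> k m y z s) = (\<lambda>m. indicator (V k) (p + (e m * s) *\<^sub>R axis (ix k) 1) *
            indicator {x. changes (e m *\<^sub>R y) x} (p + (e m * s) *\<^sub>R axis (ix k) 1))" for s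
            using True by (simp add: fun_eq_iff \<Phi>_eq p_def)
          then show "ennreal \<bar>N p \<bullet> y\<bar> * ennreal (1 / \<bar>N p $ ix k\<bar>) \<le> (\<integral>\<^sup>+s. liminf (\<lambda>m. \<Phi> k m y z s) \<partial>lborel)"
            using liminf_changes[OF e p(1) Vo p(3) Ni, of y] by simp
        qed simp
        also have "\<dots> \<le> (\<integral>\<^sup>+y. ennreal (gauss y) * liminf (\<lambda>m. \<integral>\<^sup>+s. \<Phi> k m y z s \<partial>lborel) \<partial>lborel)"
          by (intro nn_integral_mono mult_left_mono nn_integral_liminf) measurable
        also have "\<dots> \<le> (\<integral>\<^sup>+y. liminf (\<lambda>m. ennreal (gauss y) * ?W k m y z) \<partial>lborel)"
          by (intro nn_integral_mono mult_liminf_le)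
        also have "\<dots> \<le> liminf (\<lambda>m. \<integral>\<^sup>+y. ennreal (gauss y) * ?W k m y z \<partial>lborel)"
          by (rule nn_integral_liminf) measurable
        finally show ?thesis using True by simp
      qed simp
    qed
    also have "\<dots> \<le> liminf (u k)"
      unfolding u_def by (rule nn_integral_liminf) measurable
    finally show ?thesis .
  qed
  have "(\<Sum>k<n. ennreal (sqrt (2 / pi)) * emeasure \<sigma> (K k)) \<le> (\<Sum>k<n. liminf (u k))"
    by (intro sum_mono fatou)
  also have "\<dots> \<le> liminf (\<lambda>m. \<Sum>k<n. u k m)" by (rule sum_liminf_le)
  also have "\<dots> \<le> liminf (\<lambda>m. change_prob (e m) * ennreal (1 / e m))"
    by (intro Liminf_mono always_eventually allI prob)
  finally show ?thesis .
qed

end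

context hypersurface_pair
begin

text \<open>Inner regularity of the finite measure that \<open>\<sigma>\<close> induces on a single piece.\<close>

lemma compact_approx:
  assumes [measurable]: "B \<in> sets borel" and \<eta>: "\<eta> > 0"
  obtains K where "compact K" "K \<subseteq> piece k \<inter> B" "emeasure \<sigma> (piece k \<inter> B) \<le> emeasure \<sigma> K + ennreal \<eta>"
proof -
  let ?P = "piece k \<inter> B" and ?\<mu> = "density \<sigma> (indicator (piece k))"
  have \<mu>: "emeasure ?\<mu> A = emeasure \<sigma> (piece k \<inter> A)" if [measurable]: "A \<in> sets borel" for A
    by (subst emeasure_density) (auto simp flip: indicator_inter_arith)
  have fin: "emeasure \<sigma> (piece k) < \<infinity>"
    using finite_area[of "piece k" k] piece_subset[of k] by (subst emeasure_surface_measure[OF chart[of k]]) auto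
  have "emeasure ?\<mu> ?P = (SUP K \<in> {K. K \<subseteq> ?P \<and> compact K}. emeasure ?\<mu> K)"
  proof (rule inner_regular)
    show "sets ?\<mu> = sets borel" by simp
    show "emeasure ?\<mu> (space ?\<mu>) \<noteq> \<infinity>"
      using \<mu>[of UNIV] fin sets_eq_imp_space_eq[OF sets_surface_measure] by simp
  qed measurable
  then have sup: "emeasure \<sigma> ?P = (SUP K \<in> {K. K \<subseteq> ?P \<and> compact K}. emeasure ?\<mu> K)"
    using \<mu>[of ?P] by (simp add: Int_assoc[symmetric])
  have finP: "emeasure \<sigma> ?P \<noteq> \<infinity>"
    using emeasure_mono[of ?P "piece k" \<sigma>] fin by (auto simp: top_unique)
  show ?thesis
  proof (cases "emeasure \<sigma> ?P = 0")
    case True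
    then show ?thesis by (intro that[of "{}"]) auto
  next
    case False
    then have "emeasure \<sigma> ?P - ennreal \<eta> < emeasure \<sigma> ?P"
      using finP \<eta> by (intro ennreal_between) (auto simp: zero_less_iff_neq_zero less_top[symmetric])
    then obtain K where K: "K \<subseteq> ?P" "compact K" "emeasure \<sigma> ?P - ennreal \<eta> < emeasure ?\<mu> K"
      unfolding sup less_SUP_iff by auto
    have "K \<in> sets borel" using K(2) by (intro borel_closed compact_imp_closed)
    then have "emeasure ?\<mu> K = emeasure \<sigma> K" using K(1) by (simp add: \<mu> Int_absorb1)
    then have "emeasure \<sigma> ?P \<le> emeasure \<sigma> K + ennreal \<eta>"
      using K(3) by (metis ennreal_minus_le_iff less_imp_le add.commute)
    then show ?thesis using K by (intro that)
  qed
qed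

lemma change_prob_liminf:
  fixes e :: "nat \<Rightarrow> real"
  assumes e: "\<And>m. e m > 0" "e \<longlonglongrightarrow> 0"
  shows "ennreal (sqrt (2 / pi)) * emeasure \<sigma> (S \<inter> half_open_cube) \<le> liminf (\<lambda>m. change_prob (e m) * ennreal (1 / e m))"
    (is "?c * _ \<le> ?L")
proof -
  let ?P = "\<lambda>k. piece k \<inter> half_open_cube"
  have partial: "(\<Sum>k<n. ?c * emeasure \<sigma> (?P k)) \<le> ?L" for n
  proof (rule ennreal_le_epsilon)
    fix \<eta> :: real assume \<eta>: "\<eta> > 0"
    \<comment> \<open>so that \<open>n\<close> errors of size \<open>sqrt (2 / pi) * \<theta>\<close> add up to at most \<open>\<eta>\<close>\<close>
    define \<theta> where "\<theta> = \<eta> / (sqrt (2 / pi) * (real n + 1))"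
    have \<theta>: "\<theta> > 0" using \<eta> by (simp add: \<theta>_def)
    have "\<exists>K. compact K \<and> K \<subseteq> ?P k \<and> emeasure \<sigma> (?P k) \<le> emeasure \<sigma> K + ennreal \<theta>" for k
      using compact_approx[OF half_open_cube_borel \<theta>, of k] by blast
    then obtain K where K: "\<And>k. compact (K k)" "\<And>k. K k \<subseteq> ?P k"
      "\<And>k. emeasure \<sigma> (?P k) \<le> emeasure \<sigma> (K k) + ennreal \<theta>" by metis
    have "(\<Sum>k<n. ?c * emeasure \<sigma> (?P k)) \<le> (\<Sum>k<n. ?c * emeasure \<sigma> (K k) + ?c * ennreal \<theta>)"
      unfolding distrib_left[symmetric] by (intro sum_mono mult_left_mono K) simp
    also have "\<dots> = (\<Sum>k<n. ?c * emeasure \<sigma> (K k)) + of_nat n * (?c * ennreal \<theta>)"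
      by (simp add: sum.distrib)
    also have "of_nat n * (?c * ennreal \<theta>) = ennreal (real n * (sqrt (2 / pi) * \<theta>))"
      using \<theta> by (simp add: ennreal_of_nat_eq_real_of_nat ennreal_mult)
    also have "(\<Sum>k<n. ?c * emeasure \<sigma> (K k)) + ennreal (real n * (sqrt (2 / pi) * \<theta>)) \<le> ?L + ennreal \<eta>"
    proof (rule add_mono)
      show "(\<Sum>k<n. ?c * emeasure \<sigma> (K k)) \<le> ?L" by (rule change_prob_liminf_compact[OF e K(1,2)])
      have "a * (\<eta> / (a * b)) = \<eta> / b" if "a > 0" for a b :: real using that by simp
      from this[of "sqrt (2 / pi)"] have "real n * (sqrt (2 / pi) * \<theta>) = \<eta> * (real n / (real n + 1))"
        unfolding \<theta>_def by (simp del: real_sqrt_divide)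
      also have "\<dots> \<le> \<eta> * 1" using \<eta> by (intro mult_left_mono) auto
      finally show "ennreal (real n * (sqrt (2 / pi) * \<theta>)) \<le> ennreal \<eta>" by (intro ennreal_leI) simp
    qed
    finally show "(\<Sum>k<n. ?c * emeasure \<sigma> (?P k)) \<le> ?L + ennreal \<eta>" .
  qed
  have "emeasure \<sigma> (S \<inter> half_open_cube) = (\<Sum>k. emeasure \<sigma> (?P k))"
  proof -
    have "S \<inter> half_open_cube = (\<Union>k. ?P k)" using UN_pieces by blast
    moreover have "disjoint_family ?P"
      using disjoint_pieces unfolding disjoint_family_on_def by blast
    ultimately show ?thesis
      by (simp only:) (rule suminf_emeasure[symmetric], auto)
  qed
  then have "?c * emeasure \<sigma> (S \<inter> half_open_cube) = (\<Sum>k. ?c * emeasure \<sigma> (?P k))" by simp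
  also have "\<dots> \<le> ?L" using partial by (intro suminf_le_const) auto
  finally show ?thesis .
qed

section \<open>The area of the boundary\<close>

lemma S_shift: "x + axis i 1 \<in> S \<longleftrightarrow> x \<in> S"
  using shift_Inn[of x i] shift_Out[of x i] unfolding S_eq by blast

text \<open>For almost every \<open>y\<close> of the unit cube shifted into the slab, the segment from \<open>y\<close> to \<open>y + e\<^sub>i\<close> joins
  \<open>Inn\<close> and \<open>Out\<close> and meets \<open>S\<close>. A multiple of \<open>e\<^sub>i\<close> moves the point of intersection into the half-open
  cube without changing its projection.\<close>

lemma flux_ge_1: "1 \<le> (\<integral>\<^sup>+p\<in>S \<inter> half_open_cube. ennreal \<bar>N p $ i\<bar> \<partial>\<sigma>)"
proof -
  define H where "H = {y :: real^'n. y - (1/2) *\<^sub>R axis i 1 \<in> half_open_cube}"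
  have Hm [measurable]: "H \<in> sets borel"
    unfolding H_def by measurable
  have "emeasure lborel H = (\<integral>\<^sup>+y. indicator H y \<partial>lborel)" by simp
  also have "\<dots> = (\<integral>\<^sup>+y. indicator H ((1/2) *\<^sub>R axis i 1 + y) \<partial>lborel)"
    by (rule nn_integral_lborel_translate[symmetric]) measurable
  also have "\<dots> = (\<integral>\<^sup>+y. indicator (half_open_cube :: (real^'n) set) y \<partial>lborel)"
    by (intro nn_integral_cong) (simp add: H_def indicator_def)
  also have "\<dots> = 1" using emeasure_half_open_cube[where 'n = 'n] by simp
  finally have H1: "emeasure lborel H = 1" .
  have sub: "H - S \<subseteq> shadow i (S \<inter> half_open_cube)"
  proof
    fix y assume y: "y \<in> H - S"
    have yi: "0 \<le> y $ i" "y $ i < 1" and yj: "\<And>j. j \<noteq> i \<Longrightarrow> -1/2 \<le> y $ j \<and> y $ j < 1/2"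
    proof -
      have h: "-1/2 \<le> (y - (1/2) *\<^sub>R axis i 1) $ j \<and> (y - (1/2) *\<^sub>R axis i 1) $ j < 1/2" for j
        using y by (simp add: H_def half_open_cube_def)
      from h[of i] show "0 \<le> y $ i" "y $ i < 1" by (auto simp: axis_def)
      show "-1/2 \<le> y $ j \<and> y $ j < 1/2" if "j \<noteq> i" for j using h[of j] that by (simp add: axis_def)
    qed
    have "\<exists>p\<in>closed_segment y (y + axis i 1). p \<in> S"
    proof -
      have "y \<in> Inn \<and> y + axis i 1 \<in> Out \<or> y \<in> Out \<and> y + axis i 1 \<in> Inn"
        using y shift_Inn shift_Out by (auto simp: S_eq)
      moreover have "y \<in> closed_segment y (y + axis i 1)" "y + axis i 1 \<in> closed_segment y (y + axis i 1)"
        by simp_all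
      ultimately have "Inn \<inter> closed_segment y (y + axis i 1) \<noteq> {}" "Out \<inter> closed_segment y (y + axis i 1) \<noteq> {}"
        by blast+
      moreover have "connected (closed_segment y (y + axis i 1))" by simp
      ultimately have "\<not> closed_segment y (y + axis i 1) \<subseteq> Inn \<union> Out"
        using connectedD[OF _ open_Inn open_Out, of "closed_segment y (y + axis i 1)"] disjoint by blast
      then show ?thesis unfolding S_eq by blast
    qed
    then obtain u where u: "y + u *\<^sub>R axis i 1 \<in> S"
      by (auto simp: closed_segment_def algebra_simps)
    define k where "k = \<lfloor>y $ i + u + 1/2\<rfloor>"
    define p where "p = y + u *\<^sub>R axis i 1 + lat (\<chi> j. if j = i then - k else 0)"
    have "p \<in> S"
      unfolding p_def using lattice_invariant[of "\<lambda>x. x \<in> S", OF S_shift] u by simp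
    moreover have pj: "p $ j = (if j = i then y $ i + u - of_int k else y $ j)" for j
      by (simp add: p_def axis_def)
    then have "p = set_coord i (y $ i + u - of_int k) y" by (simp add: vec_eq_iff)
    moreover have "p \<in> half_open_cube"
      unfolding half_open_cube_def mem_Collect_eq
    proof
      fix j
      show "-1/2 \<le> p $ j \<and> p $ j < 1/2"
      proof (cases "j = i")
        case True
        then show ?thesis unfolding pj k_def using floor_correct[of "y $ i + u + 1/2"] by simp linarith
      next
        case False
        then show ?thesis using yj by (simp add: pj)
      qed
    qed
    ultimately show "y \<in> shadow i (S \<inter> half_open_cube)"
      using yi by (auto simp: shadow_def slab_def)
  qed
  have "1 = emeasure lborel (H - S)"
    using H1 emeasure_Diff_null_set[OF null_hypersurface, of H] by simp
  also have "\<dots> = emeasure lebesgue (H - S)" by simp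
  also have "\<dots> \<le> emeasure lebesgue (shadow i (S \<inter> half_open_cube))"
    by (rule emeasure_mono[OF sub shadow_le_flux(1)]) simp
  also have "\<dots> \<le> (\<integral>\<^sup>+p\<in>S \<inter> half_open_cube. ennreal \<bar>N p $ i\<bar> \<partial>\<sigma>)"
    by (rule shadow_le_flux(2)) simp
  finally show ?thesis .
qed

text \<open>The defect of the normal from pointing in a direction \<open>(\<plusminus>1, \<dots>, \<plusminus>1) / sqrt n\<close>. It vanishes on the
  boundary of a periodic half space.\<close>

definition deficit :: "real^'n \<Rightarrow> real" where
  "deficit p = 1 - (\<Sum>i\<in>UNIV. \<bar>N p $ i\<bar>) / sqrt (real CARD('n))"

lemma deficit_nonneg:
  assumes "p \<in> S"
  shows "0 \<le> deficit p"
proof -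
  have n1: "norm (N p) = 1" using normal assms by (simp add: unit_normal_field_def)
  have "(\<Sum>i\<in>UNIV. \<bar>N p $ i\<bar> * \<bar>1\<bar>) \<le> L2_set (\<lambda>i. N p $ i) UNIV * L2_set (\<lambda>_. 1) (UNIV :: 'n set)"
    by (rule L2_set_mult_ineq)
  also have "L2_set (\<lambda>i. N p $ i) UNIV = norm (N p)" by (simp add: norm_vec_def L2_set_def)
  also have "L2_set (\<lambda>_. 1) (UNIV :: 'n set) = sqrt (real CARD('n))" by (simp add: L2_set_def)
  finally show ?thesis by (simp add: deficit_def n1 field_simps)
qed

text \<open>The constant \<open>1\<close> is the deficit plus the normalized sum of the fluxes, each of which is at least \<open>1\<close>.
  Should the deficit not be integrable, its integral has the default value \<open>0\<close>, and the fluxes alone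
  give the inequality.\<close>

lemma area_ge_deficit:
  "ennreal (sqrt (real CARD('n)) + (LINT p : half_open_cube \<inter> S | \<sigma>. deficit p)) \<le> emeasure \<sigma> (S \<inter> half_open_cube)"
  and deficit_integral_nonneg: "0 \<le> (LINT p : half_open_cube \<inter> S | \<sigma>. deficit p)"
proof -
  let ?n = "real CARD('n)" and ?H = "half_open_cube \<inter> S" and ?I = "LINT p : half_open_cube \<inter> S | \<sigma>. deficit p"
  have n0: "sqrt ?n > 0" by simp
  have Hm [measurable]: "?H \<in> sets borel" by measurable
  define c where "c i p = (if p \<in> S then \<bar>N p $ i\<bar> else 0)" for i p
  have cm [measurable]: "c i \<in> borel_measurable borel" for i
    using measurable_normal_component[of i] by (simp add: c_def[abs_def])
  have ind: "indicator ?H p * deficit p = indicator ?H p * (1 - (\<Sum>i\<in>UNIV. c i p) / sqrt ?n)" for p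
    by (auto simp: indicator_def deficit_def c_def)
  have dm [measurable]: "(\<lambda>p. indicator ?H p * deficit p) \<in> borel_measurable \<sigma>"
    unfolding ind by measurable
  have d0: "0 \<le> indicator ?H p * deficit p" for p
    using deficit_nonneg by (auto simp: indicator_def)
  show I0: "0 \<le> ?I"
    unfolding set_lebesgue_integral_def using d0 by (intro Bochner_Integration.integral_nonneg) simp
  have I: "ennreal ?I \<le> (\<integral>\<^sup>+p. ennreal (indicator ?H p * deficit p) \<partial>\<sigma>)"
  proof (cases "integrable \<sigma> (\<lambda>p. indicator ?H p * deficit p)")
    case True
    then have "(\<integral>\<^sup>+p. ennreal (indicator ?H p * deficit p) \<partial>\<sigma>) = ennreal ?I"
      unfolding set_lebesgue_integral_def using d0 by (subst nn_integral_eq_integral) auto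
    then show ?thesis by simp
  next
    case False
    then have "?I = 0" by (simp add: set_lebesgue_integral_def not_integrable_integral_eq)
    then show ?thesis by simp
  qed
  have flux: "ennreal (sqrt ?n) \<le> (\<integral>\<^sup>+p. indicator ?H p * ennreal ((\<Sum>i\<in>UNIV. c i p) / sqrt ?n) \<partial>\<sigma>)"
  proof -
    have one: "1 \<le> (\<integral>\<^sup>+p. indicator ?H p * ennreal (c i p) \<partial>\<sigma>)" for i
    proof -
      have "(\<integral>\<^sup>+p. indicator ?H p * ennreal (c i p) \<partial>\<sigma>) = (\<integral>\<^sup>+p\<in>S \<inter> half_open_cube. ennreal \<bar>N p $ i\<bar> \<partial>\<sigma>)"
        by (intro nn_integral_cong) (auto simp: c_def indicator_def)
      then show ?thesis using flux_ge_1 by simp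
    qed
    have "ennreal (sqrt ?n) = ennreal (1 / sqrt ?n) * (\<Sum>i\<in>(UNIV :: 'n set). 1)"
      by (simp add: ennreal_of_nat_eq_real_of_nat ennreal_mult'[symmetric] real_div_sqrt)
    also have "\<dots> \<le> ennreal (1 / sqrt ?n) * (\<Sum>i\<in>UNIV. \<integral>\<^sup>+p. indicator ?H p * ennreal (c i p) \<partial>\<sigma>)"
      by (intro mult_left_mono sum_mono one) simp
    also have "\<dots> = ennreal (1 / sqrt ?n) * (\<integral>\<^sup>+p. (\<Sum>i\<in>UNIV. indicator ?H p * ennreal (c i p)) \<partial>\<sigma>)"
      by (subst nn_integral_sum) auto
    also have "\<dots> = (\<integral>\<^sup>+p. ennreal (1 / sqrt ?n) * (\<Sum>i\<in>UNIV. indicator ?H p * ennreal (c i p)) \<partial>\<sigma>)"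
      by (rule nn_integral_cmult[symmetric]) measurable
    also have "\<dots> = (\<integral>\<^sup>+p. indicator ?H p * ennreal ((\<Sum>i\<in>UNIV. c i p) / sqrt ?n) \<partial>\<sigma>)"
    proof (rule nn_integral_cong)
      fix p
      have "0 \<le> c i p" for i by (simp add: c_def)
      then show "ennreal (1 / sqrt ?n) * (\<Sum>i\<in>UNIV. indicator ?H p * ennreal (c i p)) =
        indicator ?H p * ennreal ((\<Sum>i\<in>UNIV. c i p) / sqrt ?n)"
        by (simp add: sum_distrib_left[symmetric] sum_ennreal indicator_def ennreal_mult''[symmetric] sum_nonneg)
    qed
    finally show ?thesis .
  qed
  have "ennreal (sqrt ?n + ?I) = ennreal (sqrt ?n) + ennreal ?I"
    using I0 by (simp add: ennreal_plus)
  also have "\<dots> \<le> (\<integral>\<^sup>+p. indicator ?H p * ennreal ((\<Sum>i\<in>UNIV. c i p) / sqrt ?n) \<partial>\<sigma>) +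
    (\<integral>\<^sup>+p. ennreal (indicator ?H p * deficit p) \<partial>\<sigma>)"
    by (intro add_mono flux I)
  also have "\<dots> = (\<integral>\<^sup>+p. indicator ?H p * ennreal ((\<Sum>i\<in>UNIV. c i p) / sqrt ?n) + ennreal (indicator ?H p * deficit p) \<partial>\<sigma>)"
    by (rule nn_integral_add[symmetric]) measurable
  also have "\<dots> = (\<integral>\<^sup>+p. indicator ?H p \<partial>\<sigma>)"
  proof (rule nn_integral_cong)
    fix p
    show "indicator ?H p * ennreal ((\<Sum>i\<in>UNIV. c i p) / sqrt ?n) + ennreal (indicator ?H p * deficit p) = indicator ?H p"
    proof (cases "p \<in> ?H")
      case True
      then have "p \<in> S" by simp
      have "0 \<le> (\<Sum>i\<in>UNIV. c i p) / sqrt ?n" by (simp add: c_def sum_nonneg)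
      moreover have "(\<Sum>i\<in>UNIV. c i p) / sqrt ?n + deficit p = 1" using \<open>p \<in> S\<close> by (simp add: deficit_def c_def)
      ultimately show ?thesis
        using True deficit_nonneg[OF \<open>p \<in> S\<close>] by (simp add: ennreal_plus[symmetric] del: ennreal_plus)
    qed simp
  qed
  also have "\<dots> = emeasure \<sigma> (S \<inter> half_open_cube)" by (simp add: Int_commute)
  finally show "ennreal (sqrt ?n + ?I) \<le> emeasure \<sigma> (S \<inter> half_open_cube)" .
qed

section \<open>Comparison with half spaces\<close>

text \<open>Along every sequence of noise levels that tends to zero this is \<open>change_prob_liminf\<close>. The number \<open>a\<close>
  stands for a finite lower bound of the area.\<close>

lemma change_prob_lower_bound:
  assumes a: "0 \<le> a" "ennreal a \<le> emeasure \<sigma> (S \<inter> half_open_cube)" and fin: "\<And>\<epsilon>. change_prob \<epsilon> \<le> 1" and d: "d > 0"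
  shows "eventually (\<lambda>\<epsilon>. \<epsilon> * (sqrt (2 / pi) * a) - enn2real (change_prob \<epsilon>) < d * \<epsilon>) (at_right 0)"
proof (rule sequentially_imp_eventually_at_right[of 0 1])
  fix e :: "nat \<Rightarrow> real"
  assume e: "\<And>m. 0 < e m" "e \<longlonglongrightarrow> 0"
  show "eventually (\<lambda>m. e m * (sqrt (2 / pi) * a) - enn2real (change_prob (e m)) < d * e m) sequentially"
  proof (cases "sqrt (2 / pi) * a - d < 0")
    case True
    have "e m * (sqrt (2 / pi) * a) - enn2real (change_prob (e m)) < d * e m" for m
    proof -
      have "e m * (sqrt (2 / pi) * a - d) < 0" using True e(1)[of m] by (simp add: mult_less_0_iff)
      then have "e m * (sqrt (2 / pi) * a) < d * e m" by (simp add: algebra_simps)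
      then show ?thesis using enn2real_nonneg[of "change_prob (e m)"] by linarith
    qed
    then show ?thesis by simp
  next
    case False
    have "ennreal (sqrt (2 / pi) * a - d) < ennreal (sqrt (2 / pi) * a)"
      using False d a by (intro ennreal_lessI) (auto simp: not_less)
    also have "\<dots> = ennreal (sqrt (2 / pi)) * ennreal a" by (simp add: ennreal_mult a)
    also have "\<dots> \<le> ennreal (sqrt (2 / pi)) * emeasure \<sigma> (S \<inter> half_open_cube)"
      using a by (intro mult_left_mono) auto
    also have "\<dots> \<le> liminf (\<lambda>m. change_prob (e m) * ennreal (1 / e m))"
      by (rule change_prob_liminf[OF e])
    finally have "eventually (\<lambda>m. ennreal (sqrt (2 / pi) * a - d) < change_prob (e m) * ennreal (1 / e m)) sequentially"
      by (rule less_LiminfD)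
    then show ?thesis
    proof eventually_elim
      case (elim m)
      have r: "change_prob (e m) = ennreal (enn2real (change_prob (e m)))"
        using fin[of "e m"] by (simp add: ennreal_enn2real_if top_unique) (metis ennreal_one_neq_top top_unique)
      have "ennreal (sqrt (2 / pi) * a - d) < ennreal (enn2real (change_prob (e m)) * (1 / e m))"
        using elim e(1)[of m] by (subst (asm) r) (simp add: ennreal_mult'[symmetric])
      then have "sqrt (2 / pi) * a - d < enn2real (change_prob (e m)) * (1 / e m)"
        using False by (simp add: ennreal_less_iff)
      then show ?case using e(1)[of m] by (simp add: field_simps)
    qed
  qed
qed simp

end

theorem corollary1p15:
  fixes \<Omega> :: "(real^'n) set"
    and N :: "real^'n \<Rightarrow> real^'n"
    and M :: "'m measure"
    and X Y :: "'m \<Rightarrow> real^'n"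
  assumes "CARD('n) \<ge> 2"
    and "periodic \<Omega>"
    and "smooth_hypersurface (frontier \<Omega>)"
    and "\<forall>x\<in>frontier \<Omega>. exterior_unit_normal \<Omega> x (N x)"
    and "prob_space M"
    and "prob_space.indep_var M borel X borel Y"
    and "uniform_on_cube M X"
    and "standard_gaussian M Y"
  shows "(\<exists>r \<in> o[at_right 0](\<lambda>\<epsilon>. \<epsilon>). \<forall>B \<epsilon>. periodic_half_space B \<longrightarrow> 0 < \<epsilon> \<longrightarrow> \<epsilon> < 1/2 \<longrightarrow>
            stay_prob M X Y \<epsilon> \<Omega> \<le> stay_prob M X Y \<epsilon> B
              - \<epsilon> / sqrt (2 * pi) *
                (LINT x : half_open_cube \<inter> frontier \<Omega> | surface_measure (frontier \<Omega>).
                   1 - (\<Sum>i\<in>UNIV. \<bar>N x $ i\<bar>) / sqrt (real CARD('n)))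
              + r \<epsilon>)
       \<and> (\<exists>r \<in> o[at_right 0](\<lambda>\<epsilon>. \<epsilon>). \<forall>B \<epsilon>. periodic_half_space B \<longrightarrow> 0 < \<epsilon> \<longrightarrow> \<epsilon> < 1/2 \<longrightarrow>
            stay_prob M X Y \<epsilon> \<Omega> \<le> stay_prob M X Y \<epsilon> B + r \<epsilon>)"
proof -
  let ?S = "frontier \<Omega>"
  obtain ix gx Ux where atlas: "\<And>k::nat. graph_chart ?S (ix k) (gx k) (Ux k)" "?S \<subseteq> (\<Union>k. Ux k)"
    "\<And>k A. A \<subseteq> Ux k \<Longrightarrow> graph_area (ix k) (gx k) A < \<infinity>"
    using countable_atlas[OF assms(3)] by metis
  interpret charted_hypersurface ?S N ix gx Ux
    by unfold_locales (use atlas unit_normal_field_frontier[OF assms(4)] in auto)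
  interpret antiperiodic_pair "interior \<Omega>" "interior (- \<Omega>)"
    by (rule antiperiodic_pair_of_periodic[OF assms(2,3) null_hypersurface assms(4)])
  interpret hypersurface_pair ?S N ix gx Ux "interior \<Omega>" "interior (- \<Omega>)"
  proof
    show "frontier \<Omega> = - (interior \<Omega> \<union> interior (- \<Omega>))"
      by (auto simp: frontier_def interior_complement)
    fix p a assume p: "p \<in> ?S"
    obtain i g U where U: "p \<in> U" "graph_chart ?S i g U" using assms(3) p unfolding smooth_hypersurface_def by blast
    show "N p \<bullet> a > 0 \<Longrightarrow> eventually (\<lambda>t. p + t *\<^sub>R a \<in> interior (- \<Omega>)) (at_right 0)"
      by (rule exterior_normal_sides(1)[OF U(2) p U(1) assms(4)])
    show "N p \<bullet> a < 0 \<Longrightarrow> eventually (\<lambda>t. p + t *\<^sub>R a \<in> interior \<Omega>) (at_right 0)"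
      by (rule exterior_normal_sides(2)[OF U(2) p U(1) assms(4)])
  qed
  define c where "c = sqrt (2 / pi)"
  define n where "n = sqrt (real CARD('n))"
  define I where "I = (LINT x : half_open_cube \<inter> ?S | surface_measure ?S. 1 - (\<Sum>i\<in>UNIV. \<bar>N x $ i\<bar>) / sqrt (real CARD('n)))"
  have I_def': "I = (LINT p : half_open_cube \<inter> ?S | surface_measure ?S. deficit p)"
    by (simp add: I_def deficit_def)
  have I0: "0 \<le> I" unfolding I_def' by (rule deficit_integral_nonneg)
  have area: "ennreal (n + I) \<le> emeasure (surface_measure ?S) (?S \<inter> half_open_cube)"
    unfolding I_def' n_def by (rule area_ge_deficit)
  have sub: "interior \<Omega> \<subseteq> \<Omega>" "\<Omega> \<inter> interior (- \<Omega>) = {}"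
    using interior_subset[of \<Omega>] interior_subset[of "- \<Omega>"] by auto
  note stay = stay_prob_change_prob[OF assms(5-8) sub]
  have le1: "change_prob \<epsilon> \<le> 1" for \<epsilon>
    unfolding stay[of \<epsilon>, symmetric] by simp
  have stay': "2 * stay_prob M X Y \<epsilon> \<Omega> = 1 - enn2real (change_prob \<epsilon>)" for \<epsilon>
  proof -
    have r: "change_prob \<epsilon> = ennreal (enn2real (change_prob \<epsilon>))"
      using le1[of \<epsilon>] by (cases "change_prob \<epsilon>") (auto simp: top_unique)
    have nn: "0 \<le> stay_prob M X Y \<epsilon> \<Omega>" by (simp add: stay_prob_def)
    have "ennreal (2 * stay_prob M X Y \<epsilon> \<Omega> + enn2real (change_prob \<epsilon>)) = ennreal 1"
      using stay[of \<epsilon>] nn by (subst (asm) r) (simp add: ennreal_mult ennreal_plus)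
    then show ?thesis using nn by (subst (asm) ennreal_inj) auto
  qed
  \<comment> \<open>the deviation of the probability of a change from its lower bound, which does not involve \<open>B\<close>\<close>
  define r where "r \<epsilon> = max 0 ((\<epsilon> * (c * (n + I)) - enn2real (change_prob \<epsilon>)) / 2)" for \<epsilon>
  have small: "r \<in> o[at_right 0](\<lambda>\<epsilon>. \<epsilon>)"
  proof (rule landau_o.smallI)
    fix d :: real assume d: "d > 0"
    have "eventually (\<lambda>\<epsilon>. \<epsilon> * (c * (n + I)) - enn2real (change_prob \<epsilon>) < d * \<epsilon>) (at_right 0)"
      unfolding c_def using I0 by (intro change_prob_lower_bound area le1 d) (simp add: n_def)
    moreover have "eventually (\<lambda>\<epsilon>::real. 0 < \<epsilon>) (at_right 0)" by (simp add: eventually_at_right_less)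
    ultimately show "eventually (\<lambda>\<epsilon>. norm (r \<epsilon>) \<le> d * norm \<epsilon>) (at_right 0)"
    proof eventually_elim
      case (elim \<epsilon>)
      have "0 < d * \<epsilon>" using elim d by simp
      then show ?case using elim by (auto simp: r_def max_def)
    qed
  qed
  have main: "stay_prob M X Y \<epsilon> \<Omega> \<le> stay_prob M X Y \<epsilon> B - \<epsilon> / sqrt (2 * pi) * I + r \<epsilon>"
    if "periodic_half_space B" "0 < \<epsilon>" for B \<epsilon>
  proof -
    have "1 - \<epsilon> * (c * n) \<le> 2 * stay_prob M X Y \<epsilon> B"
      unfolding c_def n_def by (rule stay_prob_half_space[OF that assms(5-8)])
    moreover have "\<epsilon> * (c * (n + I)) - enn2real (change_prob \<epsilon>) \<le> 2 * r \<epsilon>"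
      by (auto simp: r_def max_def)
    moreover have "\<epsilon> / sqrt (2 * pi) * I = \<epsilon> * c * I / 2"
    proof -
      have "c = 2 / sqrt (2 * pi)"
        unfolding c_def by (simp add: real_sqrt_divide real_sqrt_mult real_div_sqrt field_simps)
      then show ?thesis by simp
    qed
    moreover have "\<epsilon> * (c * (n + I)) = \<epsilon> * (c * n) + \<epsilon> * c * I" by (simp add: algebra_simps)
    ultimately show ?thesis using stay'[of \<epsilon>] by linarith
  qed
  have "stay_prob M X Y \<epsilon> \<Omega> \<le> stay_prob M X Y \<epsilon> B + r \<epsilon>"
    if "periodic_half_space B" "0 < \<epsilon>" for B \<epsilon>
  proof -
    have "0 \<le> \<epsilon> / sqrt (2 * pi) * I" using that(2) I0 by simp
    then show ?thesis using main[OF that] by linarith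
  qed
  then show ?thesis
    using small main unfolding I_def by blast
qed

end
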